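(* Let $N\ge1$, $m>0$, $\kappa>0$, $\mathcal V=(\nu_i)_{i=1}^N\in\mathbb R^N$, and let $(\Theta,\Omega)$, $\Omega=\dot\Theta$, be the global solution of the inertial Kuramoto model with initial data $(\Theta^0,\Omega^0)\in\mathbb R^N\times\mathbb R^N$. Let $\ell\in(0,\pi)$, $\lambda\in(0.5,1]$, $\eta\in(0,\infty)$, $\delta\in(0,1)$ be such that $(\mathcal F_1)$: $R^0>0$ and $\zeta(\eta)\le(1-\delta)R^0$; $(\mathcal F_2)$: $\delta R^0\ge\lambda+(1-\lambda)\cos\frac\ell2$ or $2\lambda+\left(\frac{\xi(\eta)}{\delta R^0}\right)^2\frac{1}{1-\cos(\ell/2)}\le1+\delta R^0$; $(\mathcal F_3)$: $\xi(\eta)<\sin\frac\ell2\left(\lambda\cos\frac\ell2-(1-\lambda)\right)$. Then the following hold. (1) (Asymptotic phase-locking) There exists a constant state $\Theta^\infty\in\mathbb R^N$ such that $$\lim_{t\to\infty}\Big(\|\Theta(t)-\nu_ct\mathbf 1_{[N]}-\Theta^\infty\|_\infty+\|\Omega(t)-\nu_c\mathbf 1_{[N]}\|_\infty\Big)=0.$$ (2) (Finite-time emergence and persistence of a majority cluster) There exist a time $t_*>0$, a subset $\mathcal A\subset[N]$ with $|\mathcal A|\ge\lambda N$, and integers $k_i$ for $i\in\mathcal A$ such that $$\mathcal D\big((\theta_i(t)-2k_i\pi)_{i\in\mathcal A}\big)<\ell,\qquad t\ge t_*.$$ Among all such subsets $\mathcal A$ there is a unique maximal one with respect to inclusion. (3)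 (Linear arrangement of the majority cluster) If in addition $(\mathcal F_4)$: $\displaystyle\frac{\mathcal D(\mathcal V)}{\kappa}+4m\kappa+2m\mathcal D(\mathcal V)<\frac{(2\lambda-1)^{3/2}}{\sqrt{2\lambda}}\,\frac{2-\lambda}{\sqrt{\lambda/2}+(1-\lambda)}$ holds, then the majority cluster $\mathcal A$ (with integers $k_i$) of (2) is arranged according to natural frequencies: there is a constant $c$ depending only on $\frac{\mathcal D(\mathcal V)}{\kappa}$, $m\kappa$ and $\lambda$ such that for any $i,j\in\mathcal A$ with $\nu_i\ge\nu_j$, $$\frac{\nu_i-\nu_j}{\kappa}\le\lim_{t\to\infty}\big(\theta_i(t)-\theta_j(t)-2(k_i-k_j)\pi\big)\le c\,\frac{\nu_i-\nu_j}{\kappa}.$$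
   Context: $[N]=\{1,\dots,N\}$. The inertial Kuramoto model is the Cauchy problem $$m\ddot\theta_i+\dot\theta_i=\nu_i+\frac\kappa N\sum_{j=1}^N\sin(\theta_j-\theta_i),\quad t>0,\qquad(\theta_i,\dot\theta_i)(0)=(\theta_i^0,\omega_i^0),\quad i\in[N],$$ with real-valued unknowns $\theta_i$ on $[0,\infty)$; it has a unique global solution. Notation: $\Theta=(\theta_i)$, $\Omega=(\omega_i)=(\dot\theta_i)$, $\Theta^0=(\theta_i^0)$, $\Omega^0=(\omega_i^0)$, $\mathbf 1_{[N]}=(1,\dots,1)$, $\nu_c=\frac1N\sum_i\nu_i$, $R^0=\left|\frac1N\sum_j e^{\mathrm i\theta_j^0}\right|$. For a finite real vector $X=(x_i)_i$, $\mathcal D(X)=\max_{i,j}|x_i-x_j|$. Moreover $$\zeta(\eta)=\frac{m(1-e^{-\eta})}{2}\left[\mathcal D(\Omega^0)+\mathcal D(\mathcal V)\eta\right]+m^2\kappa(1-e^{-\eta})^3\left[\tfrac34\mathcal D(\Omega^0)+(\mathcal D(\mathcal V)+2\kappa)\eta\right],$$ $$\xi(\eta)=(\mathcal D(\mathcal V)+2\kappa)m+\mathcal D(\Omega^0)m\max\{1,\eta\}e^{-\max\{1,\eta\}}+\frac{\mathcal D(\mathcal V)}{2\kappa}+\frac{\mathcal D(\Omega^0)}{2\kappa}\frac{e^{-\eta}}{1-e^{-\eta}}.$$ *)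

theory Defs
  imports "HOL-Analysis.Analysis"
begin

text \<open>
  Families indexed by \<open>[N]\<close> are functions on \<^typ>\<open>nat\<close> that are only inspected on \<open>{1..N}\<close>; the
  number of oscillators is a term, not a type, so that a constant can be uniform in \<open>N\<close>.
\<close>

definition diam_on :: "nat set \<Rightarrow> (nat \<Rightarrow> real) \<Rightarrow> real" where
  "diam_on I x = (MAX (i, j)\<in>I \<times> I. \<bar>x i - x j\<bar>)"

definition sup_norm_on :: "nat set \<Rightarrow> (nat \<Rightarrow> real) \<Rightarrow> real" where
  "sup_norm_on I x = (MAX i\<in>I. \<bar>x i\<bar>)"

definition mean :: "nat \<Rightarrow> (nat \<Rightarrow> real) \<Rightarrow> real" where
  "mean N x = (1 / real N) * (\<Sum>i\<in>{1..N}. x i)"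

definition order_parameter :: "nat \<Rightarrow> (nat \<Rightarrow> real) \<Rightarrow> real" where
  "order_parameter N x = cmod ((1 / of_nat N) * (\<Sum>j\<in>{1..N}. exp (\<i> * complex_of_real (x j))))"

text \<open>
  Here \<open>\<omega>\<close> is the derivative of \<open>\<theta>\<close> on \<open>[0, \<infinity>)\<close> (one-sided at \<open>0\<close>) and is continuous up to the
  initial time; the second-order equation is required for \<open>t > 0\<close>.
\<close>

definition inertial_kuramoto_solution ::
  "nat \<Rightarrow> real \<Rightarrow> real \<Rightarrow> (nat \<Rightarrow> real) \<Rightarrow> (nat \<Rightarrow> real) \<Rightarrow> (nat \<Rightarrow> real) \<Rightarrow>
   (nat \<Rightarrow> real \<Rightarrow> real) \<Rightarrow> (nat \<Rightarrow> real \<Rightarrow> real) \<Rightarrow> bool" where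
  "inertial_kuramoto_solution N m \<kappa> \<nu> \<theta>0 \<omega>0 \<theta> \<omega> \<longleftrightarrow>
     (\<forall>i\<in>{1..N}.
        \<theta> i 0 = \<theta>0 i \<and> \<omega> i 0 = \<omega>0 i \<and>
        (\<forall>t\<ge>0. (\<theta> i has_real_derivative \<omega> i t) (at t within {0..})) \<and>
        continuous_on {0..} (\<omega> i) \<and>
        (\<forall>t>0. \<exists>a. (\<omega> i has_real_derivative a) (at t) \<and>
           m * a + \<omega> i t = \<nu> i + \<kappa> / real N * (\<Sum>j\<in>{1..N}. sin (\<theta> j t - \<theta> i t))))"

text \<open>In \<open>zeta\<close> and \<open>xi\<close>, \<open>DW\<close> and \<open>DV\<close> are the diameters of the initial velocities and of
  the natural frequencies.\<close>

definition zeta :: "real \<Rightarrow> real \<Rightarrow> real \<Rightarrow> real \<Rightarrow> real \<Rightarrow> real" where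
  "zeta m \<kappa> DW DV \<eta> =
     m * (1 - exp (-\<eta>)) / 2 * (DW + DV * \<eta>)
     + m^2 * \<kappa> * (1 - exp (-\<eta>))^3 * (3 / 4 * DW + (DV + 2 * \<kappa>) * \<eta>)"

definition xi :: "real \<Rightarrow> real \<Rightarrow> real \<Rightarrow> real \<Rightarrow> real \<Rightarrow> real" where
  "xi m \<kappa> DW DV \<eta> =
     (DV + 2 * \<kappa>) * m + DW * m * max 1 \<eta> * exp (- max 1 \<eta>)
     + DV / (2 * \<kappa>) + DW / (2 * \<kappa>) * (exp (-\<eta>) / (1 - exp (-\<eta>)))"

definition majority_cluster ::
  "nat \<Rightarrow> real \<Rightarrow> real \<Rightarrow> (nat \<Rightarrow> real \<Rightarrow> real) \<Rightarrow> nat set \<Rightarrow> (nat \<Rightarrow> int) \<Rightarrow> bool" where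
  "majority_cluster N lam l \<theta> A k \<longleftrightarrow>
     A \<subseteq> {1..N} \<and> real (card A) \<ge> lam * real N \<and>
     (\<exists>T>0. \<forall>t\<ge>T. diam_on A (\<lambda>i. \<theta> i t - 2 * real_of_int (k i) * pi) < l)"

end

theory Submission
  imports Defs "HOL-Complex_Analysis.Conformal_Mappings"
begin

text \<open>
  Write \<open>F\<^sub>i\<close> for the average over \<open>j\<close> of \<open>sin (\<theta>\<^sub>j - \<theta>\<^sub>i)\<close> and \<open>R\<close> for the order parameter.

  Inertia only delays. A velocity is an exponentially weighted average of past forces, and one
  integration by parts gives, up to a drift common to all oscillators,
  \<open>\<theta>\<^sub>i' = \<kappa> (1 - e\<^bsup>-t/m\<^esup>) (F\<^sub>i + error)\<close> with an error of modulus at most \<open>\<xi>(\<eta>)\<close> from time \<open>\<eta> m\<close> on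
  (\<open>velocity_representation\<close>, \<open>deviation_le_xi\<close>). Up to that time the order parameter loses at most \<open>\<zeta>(\<eta>)\<close>
  (\<open>order_parameter_initial_layer\<close>); afterwards the model behaves like the first-order Kuramoto flow with
  a small bounded disturbance.

  For that flow, \<open>R\<^sup>2\<close> increases as long as the mean square force exceeds \<open>\<xi>\<^sup>2\<close>. This cannot go on for
  ever, and when the forces are small compared with \<open>R\<close> most oscillators are close to the mean phase
  (\<open>aligned_fraction_lower_bound\<close>). So a majority enters an arc of length \<open>l\<close>
  (\<open>majority_aligned_at_some_time\<close>). It stays there, because at the boundary the majority pulls the ends of
  the arc together more strongly than the disturbance can separate them (\<open>cluster_persists\<close>).

  Persistence bounds all relative phases: an oscillator that meets a member of the cluster modulo
  \<open>2 \<pi>\<close> joins it, and one that never does is confined between two copies of that member. Hence the energy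
  is bounded below, the velocities tend to the mean frequency and the forces converge. Given the limits
  of the forces, every value that \<open>R\<^sup>2\<close> takes at arbitrarily late times solves one of finitely many analytic
  equations and so belongs to a countable set (\<open>countable_square_root_sum_zeros\<close>). A bounded continuous
  function with countably many recurrent values converges
  (\<open>convergent_if_recurrent_values_countable\<close>). Thus \<open>R\<^sup>2\<close> converges, and by the same principle so do the
  phase differences.

  The remaining claims concern the limit state, an equilibrium. There the restoring force between the
  ends of a cluster balances their frequency difference, which is smaller than what the disturbance
  could do. This leaves room for the union of two majority clusters to be a majority cluster again
  (\<open>majority_clusters_union\<close>), whence the unique maximal one. Under the additional smallness hypothesis the
  cluster is so narrow that the force is a strictly monotone function of the position inside it, with
  slope bounded on both sides; balancing forces and frequencies orders the phases by the frequencies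
  (\<open>cluster_ordered_by_frequency\<close>).
\<close>

section \<open>Linear relaxation and convergence at infinity\<close>

text \<open>
  The integrating factor \<open>exp (s / m)\<close> turns the differential inequality into monotonicity of
  \<open>exp (s / m) * (G s - y s)\<close>.
\<close>

lemma relaxation_comparison:
  fixes y y' G G' :: "real \<Rightarrow> real"
  assumes m: "m > 0"
    and cy: "continuous_on {0..} y" and cG: "continuous_on {0..} G"
    and dy: "\<And>t. t > 0 \<Longrightarrow> (y has_real_derivative y' t) (at t)"
    and dG: "\<And>t. t > 0 \<Longrightarrow> (G has_real_derivative G' t) (at t)"
    and le: "\<And>t. t > 0 \<Longrightarrow> m * y' t + y t \<le> m * G' t + G t"
    and init: "y 0 \<le> G 0" and t: "t \<ge> 0"
  shows "y t \<le> G t"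
proof -
  define f where "f = (\<lambda>s. exp (s / m) * (G s - y s))"
  have cf: "continuous_on {0..t} f"
    unfolding f_def by (intro continuous_intros continuous_on_subset[OF cy] continuous_on_subset[OF cG]) (use m in auto)
  have df: "(f has_real_derivative exp (s / m) * ((m * G' s + G s) - (m * y' s + y s)) / m) (at s)" if "s > 0" for s
    unfolding f_def using m that
    by (auto intro!: derivative_eq_intros dy dG simp: field_simps)
  have "f 0 \<le> f t"
  proof (rule DERIV_nonneg_imp_increasing_open[OF t _ cf])
    fix s assume "0 < s" "s < t"
    show "\<exists>y. (f has_real_derivative y) (at s) \<and> 0 \<le> y"
      by (rule exI, rule conjI, rule df[OF \<open>0 < s\<close>])
         (use le[OF \<open>0<s\<close>] m in \<open>auto intro!: divide_nonneg_pos mult_nonneg_nonneg\<close>)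
  qed
  with init have "0 \<le> exp (t / m) * (G t - y t)" by (simp add: f_def)
  then show ?thesis by (simp add: zero_le_mult_iff)
qed

text \<open>
  Takes the place of Duhamel's formula: an explicit solution \<open>G\<close> of the majorising equation
  stands in for the convolution integral.
\<close>

lemma relaxation_bound:
  fixes y y' G G' :: "real \<Rightarrow> real"
  assumes m: "m > 0"
    and cy: "continuous_on {0..} y" and cG: "continuous_on {0..} G"
    and dy: "\<And>t. t > 0 \<Longrightarrow> (y has_real_derivative y' t) (at t)"
    and dG: "\<And>t. t > 0 \<Longrightarrow> (G has_real_derivative G' t) (at t)"
    and le: "\<And>t. t > 0 \<Longrightarrow> \<bar>m * y' t + y t\<bar> \<le> m * G' t + G t"
    and init: "\<bar>y 0\<bar> \<le> G 0" and t: "t \<ge> 0"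
  shows "\<bar>y t\<bar> \<le> G t"
proof -
  have "y t \<le> G t"
    by (rule relaxation_comparison[OF m cy cG dy dG _ _ t]) (use le init in \<open>auto simp: abs_le_iff\<close>)
  moreover have "(\<lambda>s. - y s) t \<le> G t"
  proof (rule relaxation_comparison[OF m _ cG _ dG _ _ t])
    show "continuous_on {0..} (\<lambda>s. - y s)" by (intro continuous_intros cy)
    show "((\<lambda>s. - y s) has_real_derivative - y' s) (at s)" if "s > 0" for s
      using dy[OF that] by (auto intro!: derivative_eq_intros)
    show "m * - y' s + - y s \<le> m * G' s + G s" if "s > 0" for s
      using le[OF that] by linarith
  qed (use init in auto)
  ultimately show ?thesis by auto
qed

text \<open>
  If \<open>f'\<close> were large at a late time, its bounded derivative would keep it large over an interval
  of fixed length, and \<open>f\<close> could not settle.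
\<close>

lemma barbalat:
  fixes f f' f'' :: "real \<Rightarrow> real"
  assumes df: "\<And>t. t \<ge> T \<Longrightarrow> (f has_real_derivative f' t) (at t)"
    and df': "\<And>t. t \<ge> T \<Longrightarrow> (f' has_real_derivative f'' t) (at t)"
    and bd: "\<And>t. t \<ge> T \<Longrightarrow> \<bar>f'' t\<bar> \<le> M"
    and lim: "(f \<longlongrightarrow> L) at_top"
  shows "(f' \<longlongrightarrow> 0) at_top"
proof (rule tendstoI)
  fix e :: real assume e: "e > 0"
  have M: "M \<ge> 0" using bd[of T] by auto
  \<comment> \<open>Over a step of length \<open>h\<close> the derivative \<open>f'\<close> changes by less than \<open>e / 2\<close>.\<close>
  define h where "h = e / (2 * (M + 1))"
  have h: "h > 0" and hM: "M * h < e / 2" using e M by (auto simp: h_def field_simps add_pos_nonneg)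
  have "\<forall>\<^sub>F t in at_top. dist (f t) L < e * h / 4"
    using tendstoD[OF lim, of "e * h / 4"] e h by simp
  then obtain S where S: "\<And>t. t \<ge> S \<Longrightarrow> \<bar>f t - L\<bar> < e * h / 4"
    unfolding eventually_at_top_linorder dist_real_def by blast
  have "\<bar>f' t\<bar> < e" if t: "t \<ge> max S T" for t
  proof -
    obtain z where z: "t < z" "z < t + h" "f (t + h) - f t = (t + h - t) * f' z"
      using MVT2[of t "t + h" f f'] h t df by auto
    obtain w where w: "t < w" "w < z" "f' z - f' t = (z - t) * f'' w"
      using MVT2[of t z f' f''] z(1) t df' by auto
    have "\<bar>f' z - f' t\<bar> \<le> h * M"
      unfolding w(3) abs_mult using z w t bd[of w] M h by (intro mult_mono) auto
    moreover have "\<bar>h * f' z\<bar> < h * (e / 2)"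
      proof -
      have "\<bar>f t - L\<bar> < e * h / 4" "\<bar>f (t + h) - L\<bar> < e * h / 4" using S t h by auto
      moreover have "f (t + h) - f t = h * f' z" using z(3) by simp
      moreover have "h * (e / 2) = 2 * (e * h / 4)" by simp
      ultimately show ?thesis by linarith
    qed
    then have "\<bar>f' z\<bar> < e / 2" using h by (simp add: abs_mult)
    ultimately show ?thesis using hM by (simp add: mult.commute)
  qed
  then show "\<forall>\<^sub>F t in at_top. dist (f' t) 0 < e"
    unfolding eventually_at_top_linorder by (auto intro!: exI[of _ "max S T"])
qed

text \<open>
  If the lower and upper limits differed, the intermediate value theorem would make every value
  between them recurrent, and these are uncountably many.
\<close>

lemma convergent_if_recurrent_values_countable:
  fixes f :: "real \<Rightarrow> real"
  assumes cont: "continuous_on {T..} f" and bd: "\<And>t. t \<ge> T \<Longrightarrow> \<bar>f t\<bar> \<le> M"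
    and S: "countable S" and rec: "\<And>y. (\<exists>\<^sub>F t in at_top. f t = y) \<Longrightarrow> y \<in> S"
  shows "\<exists>L. (f \<longlongrightarrow> L) at_top"
proof -
  define a where "a = Liminf at_top (\<lambda>t. ereal (f t))"
  define b where "b = Limsup at_top (\<lambda>t. ereal (f t))"
  have evb: "\<forall>\<^sub>F t in at_top. - M \<le> f t \<and> f t \<le> M"
    unfolding eventually_at_top_linorder using bd by (intro exI[of _ T]) (auto simp: abs_le_iff minus_le_iff)
  have a1: "ereal (- M) \<le> a"
    unfolding a_def by (rule Liminf_bounded) (use evb in \<open>auto elim: eventually_mono\<close>)
  have b1: "b \<le> ereal M"
    unfolding b_def by (rule Limsup_bounded) (use evb in \<open>auto elim: eventually_mono\<close>)
  have ab: "a \<le> b" unfolding a_def b_def by (rule Liminf_le_Limsup) simp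
  then obtain a' b' where a': "a = ereal a'" and b': "b = ereal b'"
    using a1 b1 by (cases a; cases b) auto
  have mem: "y \<in> S" if y: "a' < y" "y < b'" for y
  proof (rule rec)
    have lo: "\<exists>\<^sub>F t in at_top. f t < y"
    proof (rule ccontr)
      assume "\<not> ?thesis"
      then have "\<forall>\<^sub>F t in at_top. ereal y \<le> ereal (f t)" by (simp add: not_frequently not_less)
      then have "ereal y \<le> a" unfolding a_def by (rule Liminf_bounded)
      with y a' show False by simp
    qed
    have hi: "\<exists>\<^sub>F t in at_top. f t > y"
    proof (rule ccontr)
      assume "\<not> ?thesis"
      then have "\<forall>\<^sub>F t in at_top. ereal (f t) \<le> ereal y" by (simp add: not_frequently not_less)
      then have "b \<le> ereal y" unfolding b_def by (rule Limsup_bounded)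
      with y b' show False by simp
    qed
    show "\<exists>\<^sub>F t in at_top. f t = y"
      unfolding frequently_def eventually_at_top_linorder
    proof
      assume "\<exists>N. \<forall>n\<ge>N. f n \<noteq> y"
      then obtain s where s: "\<And>t. t \<ge> s \<Longrightarrow> f t \<noteq> y" by blast
      obtain t1 where t1: "t1 \<ge> max s T" "f t1 < y"
        using lo unfolding frequently_def eventually_at_top_linorder by blast
      obtain t2 where t2: "t2 \<ge> t1" "f t2 > y"
        using hi unfolding frequently_def eventually_at_top_linorder by blast
      have "continuous_on {t1..t2} f" by (rule continuous_on_subset[OF cont]) (use t1 in auto)
      then obtain t where "t \<ge> t1" "f t = y" using IVT'[of f t1 y t2] t1 t2 by auto
      with s[of t] t1 show False by auto
    qed
  qed
  have "a' = b'"
  proof (rule ccontr)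
    assume "a' \<noteq> b'"
    then have "a' < b'" using ab a' b' by simp
    moreover have "countable {a'<..<b'}" by (rule countable_subset[OF _ S]) (use mem in auto)
    ultimately show False using uncountable_open_interval by blast
  qed
  then have "((\<lambda>t. ereal (f t)) \<longlongrightarrow> ereal a') at_top"
    using a' b' tendsto_iff_Liminf_eq_Limsup[of at_top "\<lambda>t. ereal (f t)" "ereal a'"] unfolding a_def b_def by simp
  then show ?thesis by auto
qed

lemma countable_cos_eq: "countable {y::real. cos y = c}"
proof (cases "\<exists>y. cos y = c")
  case True
  then obtain y0 where y0: "c = cos y0" by auto
  have "{y. cos y = c} \<subseteq> range (\<lambda>n::int. y0 + 2 * real_of_int n * pi) \<union> range (\<lambda>n::int. - y0 + 2 * real_of_int n * pi)"
  proof
    fix y assume "y \<in> {y. cos y = c}"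
    then have "sin ((y + y0) / 2) * sin ((y0 - y) / 2) = 0"
      using cos_diff_cos[of y y0] y0 by simp
    then consider n where "(y + y0) / 2 = of_int n * pi" | n where "(y0 - y) / 2 = of_int n * pi"
      by (auto simp: sin_zero_iff_int2)
    then show "y \<in> range (\<lambda>n::int. y0 + 2 * real_of_int n * pi) \<union> range (\<lambda>n::int. - y0 + 2 * real_of_int n * pi)"
    proof cases
      case 1 then have "y = - y0 + 2 * real_of_int n * pi" by simp
      then show ?thesis by blast
    next
      case 2 then have "y = y0 + 2 * real_of_int (- n) * pi" by simp
      then show ?thesis by blast
    qed
  qed
  then show ?thesis by (rule countable_subset) auto
qed auto

section \<open>Averages, coupling forces and the order parameter\<close>

lemma mean_add: "mean N (\<lambda>i. f i + g i) = mean N f + mean N g"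
  by (simp add: mean_def sum.distrib algebra_simps)

lemma mean_diff: "mean N (\<lambda>i. f i - g i) = mean N f - mean N g"
  by (simp add: mean_def sum_subtractf algebra_simps)

lemma mean_cmult: "mean N (\<lambda>i. c * f i) = c * mean N f"
  by (simp add: mean_def sum_distrib_left algebra_simps)

lemma mean_const: "N \<ge> 1 \<Longrightarrow> mean N (\<lambda>i. c) = c"
  by (simp add: mean_def)

lemma mean_mono: "(\<And>i. i \<in> {1..N} \<Longrightarrow> f i \<le> g i) \<Longrightarrow> mean N f \<le> mean N g"
  unfolding mean_def by (intro mult_left_mono sum_mono) auto

lemma mean_cong: "(\<And>i. i \<in> {1..N} \<Longrightarrow> f i = g i) \<Longrightarrow> mean N f = mean N g"
  unfolding mean_def by simp

lemma mean_eq_sum_div: "mean N f = (\<Sum>i\<in>{1..N}. f i) / real N"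
  by (simp add: mean_def)

lemma mean_abs_le:
  assumes "N \<ge> 1" "\<And>i. i \<in> {1..N} \<Longrightarrow> \<bar>f i\<bar> \<le> c" shows "\<bar>mean N f\<bar> \<le> c"
proof -
  have "mean N f \<le> mean N (\<lambda>i. c)" "mean N (\<lambda>i. - c) \<le> mean N f"
    by (intro mean_mono; use assms(2) in \<open>fastforce simp: abs_le_iff\<close>)+
  then show ?thesis using assms(1) by (simp add: mean_const abs_le_iff)
qed

lemma has_real_derivative_mean:
  assumes "\<And>i. i \<in> {1..N} \<Longrightarrow> ((\<lambda>t. f t i) has_real_derivative f' i) (at s within S)"
  shows "((\<lambda>t. mean N (f t)) has_real_derivative mean N f') (at s within S)"
  unfolding mean_def using assms by (intro DERIV_cmult DERIV_sum) auto

lemma tendsto_mean [tendsto_intros]: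
  assumes "\<And>i. i \<in> {1..N} \<Longrightarrow> ((\<lambda>t. f t i) \<longlongrightarrow> l i) F"
  shows "((\<lambda>t. mean N (f t)) \<longlongrightarrow> mean N l) F"
  unfolding mean_def by (intro tendsto_intros assms)

lemma continuous_on_mean [continuous_intros]:
  assumes "\<And>i. i \<in> {1..N} \<Longrightarrow> continuous_on S (\<lambda>t. f t i)"
  shows "continuous_on S (\<lambda>t. mean N (f t))"
  unfolding mean_def by (intro continuous_intros assms)

text \<open>
  The force on oscillator \<open>i\<close>, per unit of coupling strength. Together with the alignment below it
  gives the complex order parameter in the frame of oscillator \<open>i\<close>: the alignment is its real part
  and the coupling its imaginary part.
\<close>

definition coupling :: "nat \<Rightarrow> (nat \<Rightarrow> real) \<Rightarrow> nat \<Rightarrow> real" where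
  "coupling N x i = mean N (\<lambda>j. sin (x j - x i))"

definition alignment :: "nat \<Rightarrow> (nat \<Rightarrow> real) \<Rightarrow> nat \<Rightarrow> real" where
  "alignment N x i = mean N (\<lambda>j. cos (x j - x i))"

lemma order_parameter_cartesian:
  "(order_parameter N x)\<^sup>2 = (mean N (\<lambda>j. cos (x j)))\<^sup>2 + (mean N (\<lambda>j. sin (x j)))\<^sup>2"
proof -
  have "(1 / of_nat N) * (\<Sum>j\<in>{1..N}. exp (\<i> * complex_of_real (x j)))
      = Complex (mean N (\<lambda>j. cos (x j))) (mean N (\<lambda>j. sin (x j)))"
  proof -
    have "(1 / of_nat N :: complex) = complex_of_real (1 / real N)" by simp
    then show ?thesis
      by (auto simp: complex_eq_iff mean_def exp_eq_polar Re_sum Im_sum simp del: of_real_divide)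
  qed
  then show ?thesis unfolding order_parameter_def by (simp add: cmod_power2)
qed

lemma order_parameter_nonneg: "order_parameter N x \<ge> 0"
  by (simp add: order_parameter_def)

lemma mean_shifted_cos:
  "mean N (\<lambda>j. cos (x j - y)) = mean N (\<lambda>j. cos (x j)) * cos y + mean N (\<lambda>j. sin (x j)) * sin y"
  by (simp add: cos_diff mean_add mean_cmult mult.commute[of "cos (x _)"] mult.commute[of "sin (x _)"])

lemma mean_shifted_sin:
  "mean N (\<lambda>j. sin (x j - y)) = mean N (\<lambda>j. sin (x j)) * cos y - mean N (\<lambda>j. cos (x j)) * sin y"
  by (simp add: sin_diff mean_diff mean_cmult mult.commute[of "cos (x _)"] mult.commute[of "sin (x _)"])

lemma coupling_alignment_Pythagoras:
  "(coupling N x i)\<^sup>2 + (alignment N x i)\<^sup>2 = (order_parameter N x)\<^sup>2"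
proof -
  have "(coupling N x i)\<^sup>2 + (alignment N x i)\<^sup>2
     = ((mean N (\<lambda>j. cos (x j)))\<^sup>2 + (mean N (\<lambda>j. sin (x j)))\<^sup>2) * ((cos (x i))\<^sup>2 + (sin (x i))\<^sup>2)"
    unfolding coupling_def alignment_def mean_shifted_cos mean_shifted_sin by algebra
  then show ?thesis by (simp add: order_parameter_cartesian)
qed

lemma abs_coupling_le_order_parameter: "\<bar>coupling N x i\<bar> \<le> order_parameter N x"
  using coupling_alignment_Pythagoras[of N x i] order_parameter_nonneg[of N x]
  by (metis abs_le_square_iff abs_of_nonneg le_add_same_cancel1 zero_le_power2)

lemma mean_alignment: "mean N (alignment N x) = (order_parameter N x)\<^sup>2"
proof -
  let ?X = "mean N (\<lambda>j. cos (x j))" and ?Y = "mean N (\<lambda>j. sin (x j))"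
  have "mean N (alignment N x) = mean N (\<lambda>i. ?X * cos (x i) + ?Y * sin (x i))"
    unfolding alignment_def mean_shifted_cos by simp
  also have "\<dots> = ?X * ?X + ?Y * ?Y" by (simp only: mean_add mean_cmult)
  finally show ?thesis unfolding order_parameter_cartesian by (simp only: power2_eq_square)
qed

lemma mean_coupling: "mean N (coupling N x) = 0"
proof -
  let ?X = "mean N (\<lambda>j. cos (x j))" and ?Y = "mean N (\<lambda>j. sin (x j))"
  have "mean N (coupling N x) = mean N (\<lambda>i. ?Y * cos (x i) - ?X * sin (x i))"
    unfolding coupling_def mean_shifted_sin by simp
  also have "\<dots> = ?Y * ?X - ?X * ?Y" by (simp only: mean_diff mean_cmult)
  finally show ?thesis by simp
qed

text \<open>
  Two oscillators see the same order parameter under different angles; comparing the two views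
  recovers the cosine of the phase difference.
\<close>

lemma alignment_product:
  "alignment N x i * alignment N x j + coupling N x i * coupling N x j
    = (order_parameter N x)\<^sup>2 * cos (x i - x j)"
  unfolding coupling_def alignment_def mean_shifted_cos mean_shifted_sin order_parameter_cartesian cos_diff[of "x i" "x j"]
  by algebra

lemma order_parameter_le_1: "N \<ge> 1 \<Longrightarrow> order_parameter N x \<le> 1"
proof -
  assume N: "N \<ge> 1"
  have "\<bar>mean N (alignment N x)\<bar> \<le> 1"
    unfolding alignment_def by (intro mean_abs_le N) auto
  then have "(order_parameter N x)\<^sup>2 \<le> 1" by (simp add: mean_alignment)
  then show ?thesis using order_parameter_nonneg[of N x] by (simp add: power_le_one_iff)
qed

lemma mean_cos_ge_order_parameter: "mean N (\<lambda>k. cos (x k - y)) \<le> order_parameter N x"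
proof -
  have "(mean N (\<lambda>k. cos (x k - y)))\<^sup>2 + (mean N (\<lambda>k. sin (x k - y)))\<^sup>2
     = ((mean N (\<lambda>j. cos (x j)))\<^sup>2 + (mean N (\<lambda>j. sin (x j)))\<^sup>2) * ((cos y)\<^sup>2 + (sin y)\<^sup>2)"
    unfolding mean_shifted_cos mean_shifted_sin by algebra
  then have "(mean N (\<lambda>k. cos (x k - y)))\<^sup>2 \<le> (order_parameter N x)\<^sup>2"
    by (simp add: order_parameter_cartesian) (smt (verit) zero_le_power2)
  then show ?thesis using order_parameter_nonneg by (rule power2_le_imp_le)
qed

text \<open>
  The worst case: the majority sits at its own bound \<open>c\<close> and everybody else at \<open>- 1\<close>.
\<close>

lemma mean_ge_of_majority:
  assumes A: "A \<subseteq> {1..N}" "lam * real N \<le> real (card A)" and N: "N \<ge> 1"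
    and A1: "\<And>k. k \<in> A \<Longrightarrow> c \<le> f k" and A2: "\<And>k. k \<in> {1..N} \<Longrightarrow> - 1 \<le> f k" and c: "- 1 \<le> c"
  shows "lam * c - (1 - lam) \<le> mean N f"
proof -
  have fin: "finite A" using A finite_subset by blast
  have "(lam * c - (1 - lam)) * real N = lam * real N * (c + 1) - real N" by (simp add: algebra_simps)
  also have "\<dots> \<le> real (card A) * (c + 1) - real N"
    using A(2) c by (intro diff_right_mono mult_right_mono) auto
  also have "\<dots> = (\<Sum>k\<in>A. c + 1) - real N" by simp
  also have "\<dots> \<le> (\<Sum>k\<in>A. f k + 1) - real N" using A1 by (intro diff_right_mono sum_mono) auto
  also have "\<dots> \<le> (\<Sum>k\<in>{1..N}. f k + 1) - real N"
    using A A2 by (intro diff_right_mono sum_mono2) (auto, fastforce)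
  also have "\<dots> = (\<Sum>k\<in>{1..N}. f k)" by (simp add: sum.distrib)
  finally show ?thesis using N by (simp add: mean_eq_sum_div pos_le_divide_eq)
qed

text \<open>
  Seen from the midpoint of \<open>x i\<close> and \<open>x j\<close>, every other oscillator pulls the two together or apart
  according to the sign of a single cosine.
\<close>

lemma coupling_difference_chord:
  "coupling N x j - coupling N x i
    = 2 * sin ((x i - x j) / 2) * mean N (\<lambda>k. cos (x k - (x i + x j) / 2))"
proof -
  have "sin (x k - x j) - sin (x k - x i) = 2 * sin ((x i - x j) / 2) * cos (x k - (x i + x j) / 2)" for k
    using sin_diff_sin[of "x k - x j" "x k - x i"] by (simp add: diff_divide_distrib add_divide_distrib algebra_simps)
  then show ?thesis
    by (simp add: coupling_def mean_diff[symmetric] mean_cmult[symmetric])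
qed

lemma sin_minus_period: "sin (x - 2 * real_of_int n * pi) = sin x"
proof -
  have "x - 2 * real_of_int n * pi = x - 2 * pi * of_int n" by simp
  then show ?thesis by (simp only: sin_diff sin_int_2pin cos_int_2pin mult_1_right mult_zero_right diff_zero)
qed

lemma cos_minus_period: "cos (x - 2 * real_of_int n * pi) = cos x"
proof -
  have "x - 2 * real_of_int n * pi = x - 2 * pi * of_int n" by simp
  then show ?thesis by (simp only: cos_diff sin_int_2pin cos_int_2pin mult_1_right mult_zero_right add_0_right)
qed

lemma coupling_shift: "coupling N (\<lambda>i. x i - 2 * real_of_int (k i) * pi) = coupling N x"
proof -
  have "sin ((x j - 2 * real_of_int (k j) * pi) - (x i - 2 * real_of_int (k i) * pi)) = sin (x j - x i)" for i j
    using sin_minus_period[of "x j - x i" "k j - k i"] by (simp add: algebra_simps)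
  then show ?thesis by (simp add: coupling_def fun_eq_iff)
qed

lemma cos_shift: "cos (x - 2 * real_of_int n * pi - y) = cos (x - y)"
  using cos_minus_period[of "x - y" n] by (simp add: algebra_simps)

section \<open>Diameters of finite families\<close>

lemma diam_on_upper:
  assumes "finite I" "i \<in> I" "j \<in> I" shows "\<bar>x i - x j\<bar> \<le> diam_on I x"
  unfolding diam_on_def using assms by (intro Max_ge) (auto intro!: image_eqI[of _ _ "(i, j)"])

lemma diam_on_attained:
  assumes "finite I" "I \<noteq> {}" obtains i j where "i \<in> I" "j \<in> I" "diam_on I x = x i - x j"
proof -
  have "diam_on I x \<in> (\<lambda>(i, j). \<bar>x i - x j\<bar>) ` (I \<times> I)"
    unfolding diam_on_def using assms by (intro Max_in) auto
  then obtain i j where "i \<in> I" "j \<in> I" "diam_on I x = \<bar>x i - x j\<bar>" by auto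
  then show ?thesis using that[of i j] that[of j i] by (cases "x i \<ge> x j") auto
qed

lemma diam_on_less_iff:
  assumes "finite I" "I \<noteq> {}"
  shows "diam_on I x < d \<longleftrightarrow> (\<forall>i\<in>I. \<forall>j\<in>I. x i - x j < d)"
proof
  assume "diam_on I x < d"
  then show "\<forall>i\<in>I. \<forall>j\<in>I. x i - x j < d" using diam_on_upper[OF assms(1), of _ _ x] by fastforce
next
  assume *: "\<forall>i\<in>I. \<forall>j\<in>I. x i - x j < d"
  obtain i j where "i \<in> I" "j \<in> I" "diam_on I x = x i - x j" using diam_on_attained[OF assms] .
  with * show "diam_on I x < d" by auto
qed

lemma diam_on_between:
  assumes "finite I" "i \<in> I" "j \<in> I" "diam_on I x = x i - x j" "k \<in> I"
  shows "x j \<le> x k" "x k \<le> x i"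
  using diam_on_upper[OF assms(1) assms(2,5), of x] diam_on_upper[OF assms(1) assms(5,3), of x] assms(4) by auto

lemma diam_on_midpoint:
  assumes "finite I" "I \<noteq> {}" obtains c where "\<And>i. i \<in> I \<Longrightarrow> \<bar>x i - c\<bar> \<le> diam_on I x / 2"
proof -
  obtain i j where ij: "i \<in> I" "j \<in> I" "diam_on I x = x i - x j" using diam_on_attained[OF assms] .
  have "\<bar>x k - (x i + x j) / 2\<bar> \<le> diam_on I x / 2" if "k \<in> I" for k
    using diam_on_between[OF assms(1) ij that] ij(3) unfolding abs_le_iff by (auto simp: field_simps)
  then show ?thesis by (rule that)
qed

lemma diam_on_nonneg: "finite I \<Longrightarrow> I \<noteq> {} \<Longrightarrow> diam_on I x \<ge> 0"
  using diam_on_upper[of I _ _ x] by (metis abs_ge_zero ex_in_conv order_trans)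

section \<open>Critical values of the order parameter\<close>

text \<open>
  Both sides of the equation extend holomorphically to the half-plane to the right of \<open>\<beta>\<close>. They cannot
  agree identically, because one side grows linearly and the other at most like a square root; so
  they agree on a countable set only.
\<close>

lemma countable_square_root_sum_zeros:
  fixes s b :: "nat \<Rightarrow> real"
  assumes N: "N \<ge> 1" and s: "\<And>i. i \<in> {1..N} \<Longrightarrow> \<bar>s i\<bar> \<le> 1"
    and b: "\<And>i. i \<in> {1..N} \<Longrightarrow> 0 \<le> b i \<and> b i \<le> \<beta>"
  shows "countable {y. \<beta> < y \<and> y = mean N (\<lambda>i. s i * sqrt (y - b i))}"
proof -
  define S where "S = {z. \<beta> < Re z}"
  define f where "f = (\<lambda>z. (1 / of_nat N) * (\<Sum>i\<in>{1..N}. complex_of_real (s i) * csqrt (z - complex_of_real (b i))) - z)"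
  have S: "open S" "connected S"
    unfolding S_def using open_halfspace_Re_gt[of \<beta>] convex_halfspace_Re_gt[of \<beta>]
    by (auto intro: convex_connected)
  have fsig: "fsigma S"
  proof -
    have "S = (\<Union>n::nat. {z. \<beta> + inverse (real (Suc n)) \<le> Re z})"
    proof (intro equalityI subsetI)
      fix z assume "z \<in> S"
      then obtain n where "inverse (real (Suc n)) < Re z - \<beta>"
        using reals_Archimedean[of "Re z - \<beta>"] by (auto simp: S_def)
      then show "z \<in> (\<Union>n::nat. {z. \<beta> + inverse (real (Suc n)) \<le> Re z})"
        by (auto intro!: exI[of _ n])
    next
      fix z assume "z \<in> (\<Union>n::nat. {z. \<beta> + inverse (real (Suc n)) \<le> Re z})"
      then obtain n :: nat where "\<beta> + inverse (real (Suc n)) \<le> Re z" by auto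
      moreover have "inverse (real (Suc n)) > 0" by simp
      ultimately show "z \<in> S" unfolding S_def mem_Collect_eq by linarith
    qed
    moreover have "fsigma (\<Union>n::nat. {z. \<beta> + inverse (real (Suc n)) \<le> Re z})"
      by (intro fsigma.intros closed_halfspace_Re_ge)
    ultimately show ?thesis by simp
  qed
  have hol: "f holomorphic_on S"
    unfolding f_def
  proof (intro holomorphic_intros)
    fix i z assume i: "i \<in> {1..N}" and "z \<in> S"
    then have "Re (z - complex_of_real (b i)) > 0" using b[OF i] by (auto simp: S_def)
    then show "z - complex_of_real (b i) \<notin> \<real>\<^sub>\<le>\<^sub>0" by (auto simp: complex_nonpos_Reals_iff)
  qed
  have fr: "f (of_real y) = of_real (mean N (\<lambda>i. s i * sqrt (y - b i)) - y)" if "y > \<beta>" for y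
  proof -
    have "csqrt (complex_of_real y - complex_of_real (b i)) = of_real (sqrt (y - b i))" if "i \<in> {1..N}" for i
      using csqrt_of_real[of "y - b i"] b[OF that] \<open>y > \<beta>\<close> by (simp add: of_real_diff)
    then show ?thesis by (simp add: f_def mean_def)
  qed
  have N1: "1 \<in> {1..N}" using N by auto
  have beta: "\<beta> \<ge> 0" using b[OF N1] by simp
  \<comment> \<open>Beyond \<open>max \<beta> 1\<close> the square root is strictly smaller than its argument.\<close>
  define y0 where "y0 = \<beta> + 2"
  have y0: "y0 > \<beta>" "y0 > 1" using beta by (auto simp: y0_def)
  have "\<bar>mean N (\<lambda>i. s i * sqrt (y0 - b i))\<bar> \<le> sqrt y0"
  proof (rule mean_abs_le[OF N])
    fix i assume i: "i \<in> {1..N}"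
    have "\<bar>s i * sqrt (y0 - b i)\<bar> \<le> 1 * sqrt (y0 - b i)"
      unfolding abs_mult using s[OF i] b[OF i] y0 by (intro mult_mono) auto
    then show "\<bar>s i * sqrt (y0 - b i)\<bar> \<le> sqrt y0" using b[OF i] by (smt (verit) real_sqrt_le_mono)
  qed
  moreover have "sqrt y0 < y0" using y0 by (simp add: real_less_lsqrt power2_eq_square)
  ultimately have ne: "f (of_real y0) \<noteq> 0" unfolding fr[OF y0(1)] of_real_eq_0_iff by linarith
  have y0S: "of_real y0 \<in> S" using y0 by (simp add: S_def)
  have "countable {z \<in> S. f z = 0}"
  proof (cases "f constant_on S")
    case True
    then have "{z \<in> S. f z = 0} = {}" using ne y0S unfolding constant_on_def by force
    then show ?thesis by (simp only: countable_empty)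
  next
    case False
    then show ?thesis using holomorphic_countable_zeros[OF hol S fsig] by simp
  qed
  then have "countable (complex_of_real ` {y. \<beta> < y \<and> y = mean N (\<lambda>i. s i * sqrt (y - b i))})"
    by (rule countable_subset[rotated]) (auto simp: fr S_def)
  then show ?thesis by (rule countable_image_inj_on) (simp add: inj_on_def)
qed

section \<open>Inertia as a perturbation of the first-order flow\<close>

locale inertial_kuramoto =
  fixes N :: nat and m \<kappa> :: real and \<nu> \<theta>0 \<omega>0 :: "nat \<Rightarrow> real" and \<theta> \<omega> :: "nat \<Rightarrow> real \<Rightarrow> real"
  assumes N: "N \<ge> 1" and m: "m > 0" and \<kappa>: "\<kappa> > 0"
    and solution: "inertial_kuramoto_solution N m \<kappa> \<nu> \<theta>0 \<omega>0 \<theta> \<omega>"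
begin

abbreviation "DV \<equiv> diam_on {1..N} \<nu>"
abbreviation "DW \<equiv> diam_on {1..N} \<omega>0"
abbreviation "F i t \<equiv> coupling N (\<lambda>j. \<theta> j t) i"
abbreviation "C i t \<equiv> alignment N (\<lambda>j. \<theta> j t) i"
abbreviation "R t \<equiv> order_parameter N (\<lambda>j. \<theta> j t)"

lemma index_nonempty: "{1..N} \<noteq> {}" using N by auto

lemma DV_nonneg: "DV \<ge> 0" and DW_nonneg: "DW \<ge> 0"
  using index_nonempty by (auto intro: diam_on_nonneg)

lemma initial_state: "i \<in> {1..N} \<Longrightarrow> \<theta> i 0 = \<theta>0 i" "i \<in> {1..N} \<Longrightarrow> \<omega> i 0 = \<omega>0 i"
  using solution by (auto simp: inertial_kuramoto_solution_def)

lemma theta_derivative: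
  assumes i: "i \<in> {1..N}" and t: "t > 0"
  shows "(\<theta> i has_real_derivative \<omega> i t) (at t)"
proof -
  have "(\<theta> i has_real_derivative \<omega> i t) (at t within {0..})"
    using solution i t by (auto simp: inertial_kuramoto_solution_def)
  moreover have "at t within {0..} = at t" using t by (intro at_within_interior) simp
  ultimately show ?thesis by simp
qed

lemma omega_derivative:
  assumes i: "i \<in> {1..N}" and t: "t > 0"
  shows "(\<omega> i has_real_derivative (\<nu> i + \<kappa> * F i t - \<omega> i t) / m) (at t)"
proof -
  obtain a where a: "(\<omega> i has_real_derivative a) (at t)"
    "m * a + \<omega> i t = \<nu> i + \<kappa> / real N * (\<Sum>j\<in>{1..N}. sin (\<theta> j t - \<theta> i t))"
    using solution i t unfolding inertial_kuramoto_solution_def by blast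
  have "\<kappa> / real N * (\<Sum>j\<in>{1..N}. sin (\<theta> j t - \<theta> i t)) = \<kappa> * F i t"
    by (simp add: coupling_def mean_def)
  then have "a = (\<nu> i + \<kappa> * F i t - \<omega> i t) / m" using a(2) m by (simp add: field_simps)
  with a(1) show ?thesis by simp
qed

lemma continuous_theta: "i \<in> {1..N} \<Longrightarrow> continuous_on {0..} (\<theta> i)"
  using solution unfolding inertial_kuramoto_solution_def continuous_on_eq_continuous_within[of _ "\<theta> i"]
  by (metis DERIV_continuous atLeast_iff)

lemma continuous_omega: "i \<in> {1..N} \<Longrightarrow> continuous_on {0..} (\<omega> i)"
  using solution by (auto simp: inertial_kuramoto_solution_def)

lemma coupling_derivative:
  assumes i: "i \<in> {1..N}" and t: "t > 0"
  shows "(F i has_real_derivative mean N (\<lambda>j. cos (\<theta> j t - \<theta> i t) * (\<omega> j t - \<omega> i t))) (at t)"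
  unfolding coupling_def
  by (intro has_real_derivative_mean) (auto intro!: derivative_eq_intros theta_derivative i t)

lemma continuous_coupling: "i \<in> {1..N} \<Longrightarrow> continuous_on {0..} (F i)"
  unfolding coupling_def by (intro continuous_intros continuous_theta)

lemma continuous_alignment: "i \<in> {1..N} \<Longrightarrow> continuous_on {0..} (C i)"
  unfolding alignment_def by (intro continuous_intros continuous_theta)

lemma continuous_order_parameter_squared: "continuous_on {0..} (\<lambda>t. (R t)\<^sup>2)"
  unfolding order_parameter_cartesian by (intro continuous_intros continuous_theta)

lemma order_parameter_squared_derivative:
  assumes t: "t > 0"
  shows "((\<lambda>t. (R t)\<^sup>2) has_real_derivative 2 * mean N (\<lambda>j. F j t * \<omega> j t)) (at t)"
proof -
  let ?X = "mean N (\<lambda>j. cos (\<theta> j t))" and ?Y = "mean N (\<lambda>j. sin (\<theta> j t))"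
  have X: "((\<lambda>t. mean N (\<lambda>j. cos (\<theta> j t))) has_real_derivative mean N (\<lambda>j. - sin (\<theta> j t) * \<omega> j t)) (at t)"
    and Y: "((\<lambda>t. mean N (\<lambda>j. sin (\<theta> j t))) has_real_derivative mean N (\<lambda>j. cos (\<theta> j t) * \<omega> j t)) (at t)"
    by (intro has_real_derivative_mean, auto intro!: derivative_eq_intros theta_derivative t)+
  have "((\<lambda>t. (R t)\<^sup>2) has_real_derivative
      2 * (?X * mean N (\<lambda>j. - sin (\<theta> j t) * \<omega> j t) + ?Y * mean N (\<lambda>j. cos (\<theta> j t) * \<omega> j t))) (at t)"
    unfolding order_parameter_cartesian
    by (rule derivative_eq_intros X Y refl)+ (simp add: algebra_simps)
  also have "?X * mean N (\<lambda>j. - sin (\<theta> j t) * \<omega> j t) + ?Y * mean N (\<lambda>j. cos (\<theta> j t) * \<omega> j t)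
      = mean N (\<lambda>j. ?X * (- sin (\<theta> j t) * \<omega> j t) + ?Y * (cos (\<theta> j t) * \<omega> j t))"
    by (simp only: mean_add mean_cmult)
  also have "\<dots> = mean N (\<lambda>j. F j t * \<omega> j t)"
    unfolding coupling_def mean_shifted_sin by (simp add: algebra_simps)
  finally show ?thesis .
qed

abbreviation "decay t \<equiv> exp (- t / m)"

lemma decay_bounds: "t \<ge> 0 \<Longrightarrow> decay t \<le> 1" "decay t > 0" "t > 0 \<Longrightarrow> decay t < 1"
  using m by auto

lemma decay_derivative: "(decay has_real_derivative - decay t / m) (at t)"
  using m by (auto intro!: derivative_eq_intros)

text \<open>
  The coupling forces on two oscillators differ by at most \<open>2\<close>, so the velocity gap relaxes from
  \<open>DW\<close> towards \<open>DV + 2 * \<kappa>\<close> at rate \<open>1 / m\<close>.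
\<close>

lemma velocity_diameter:
  assumes i: "i \<in> {1..N}" and j: "j \<in> {1..N}" and t: "t \<ge> 0"
  shows "\<bar>\<omega> i t - \<omega> j t\<bar> \<le> DW * decay t + (DV + 2 * \<kappa>) * (1 - decay t)"
proof (rule relaxation_bound[OF m, where y = "\<lambda>t. \<omega> i t - \<omega> j t" and
      G = "\<lambda>t. DW * decay t + (DV + 2 * \<kappa>) * (1 - decay t)"
      and y' = "\<lambda>t. (\<nu> i + \<kappa> * F i t - \<omega> i t) / m - (\<nu> j + \<kappa> * F j t - \<omega> j t) / m"
      and G' = "\<lambda>t. DW * (- decay t / m) + (DV + 2 * \<kappa>) * (decay t / m)"])
  show "continuous_on {0..} (\<lambda>t. \<omega> i t - \<omega> j t)"
    by (intro continuous_intros continuous_omega i j)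
  show "continuous_on {0..} (\<lambda>t. DW * decay t + (DV + 2 * \<kappa>) * (1 - decay t))"
    by (intro continuous_intros) (use m in auto)
  show "((\<lambda>t. \<omega> i t - \<omega> j t) has_real_derivative
      (\<nu> i + \<kappa> * F i t - \<omega> i t) / m - (\<nu> j + \<kappa> * F j t - \<omega> j t) / m) (at t)" if "t > 0" for t
    by (intro derivative_intros omega_derivative i j that)
  show "((\<lambda>t. DW * decay t + (DV + 2 * \<kappa>) * (1 - decay t)) has_real_derivative
      DW * (- decay t / m) + (DV + 2 * \<kappa>) * (decay t / m)) (at t)" for t
    by (rule decay_derivative derivative_eq_intros refl)+ (simp add: algebra_simps)
  show "\<bar>m * ((\<nu> i + \<kappa> * F i s - \<omega> i s) / m - (\<nu> j + \<kappa> * F j s - \<omega> j s) / m) + (\<omega> i s - \<omega> j s)\<bar>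
      \<le> m * (DW * (- decay s / m) + (DV + 2 * \<kappa>) * (decay s / m))
         + (DW * decay s + (DV + 2 * \<kappa>) * (1 - decay s))" if "s > 0" for s
  proof -
    have "\<bar>F i s\<bar> \<le> 1" "\<bar>F j s\<bar> \<le> 1"
      using abs_coupling_le_order_parameter order_parameter_le_1[OF N] order_trans by blast+
    then have "\<bar>\<kappa> * (F i s - F j s)\<bar> \<le> \<kappa> * 2"
      unfolding abs_mult using \<kappa> by (intro mult_mono) auto
    moreover have "\<bar>\<nu> i - \<nu> j\<bar> \<le> DV" using i j by (intro diam_on_upper) auto
    moreover have "m * ((\<nu> i + \<kappa> * F i s - \<omega> i s) / m - (\<nu> j + \<kappa> * F j s - \<omega> j s) / m) + (\<omega> i s - \<omega> j s)
        = \<nu> i - \<nu> j + \<kappa> * (F i s - F j s)" using m by (simp add: field_simps)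
    moreover have "m * (DW * (- decay s / m) + (DV + 2 * \<kappa>) * (decay s / m))
         + (DW * decay s + (DV + 2 * \<kappa>) * (1 - decay s)) = DV + 2 * \<kappa>"
      using m by (simp add: field_simps)
    ultimately show ?thesis by linarith
  qed
  show "\<bar>\<omega> i 0 - \<omega> j 0\<bar> \<le> DW * decay 0 + (DV + 2 * \<kappa>) * (1 - decay 0)"
    using diam_on_upper[of "{1..N}" i j \<omega>0] i j initial_state by simp
qed (rule t)

text \<open>
  The solution, starting from \<open>0\<close>, of \<open>m G' + G = m \<kappa> (1 - decay) W\<close>, where \<open>W\<close> is the bound of
  \<open>velocity_diameter\<close>: the error made by evaluating the whole history of the force at the present time.
\<close>

definition memory_error :: "real \<Rightarrow> real" where
  "memory_error t = m * \<kappa> * (DW * (decay t * (t / m - 1 + decay t))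
      + (DV + 2 * \<kappa>) * (1 - 2 * (t / m) * decay t - (decay t)\<^sup>2))"

text \<open>
  A velocity is an exponentially weighted average of past forces. Integrating by parts replaces the
  past force by the present one; what remains is driven by the derivative of the force, which is at
  most the velocity diameter. In differential form, the difference on the left, say \<open>y\<close>, satisfies
  \<open>m y' + y = - m \<kappa> (1 - decay) F'\<close> and starts from \<open>0\<close>.
\<close>

lemma velocity_representation:
  assumes i: "i \<in> {1..N}" and t: "t \<ge> 0"
  shows "\<bar>\<omega> i t - (decay t * \<omega>0 i + (1 - decay t) * \<nu> i) - \<kappa> * (1 - decay t) * F i t\<bar> \<le> memory_error t"
proof (rule relaxation_bound[OF m, where G = memory_error
      and y = "\<lambda>t. \<omega> i t - (decay t * \<omega>0 i + (1 - decay t) * \<nu> i) - \<kappa> * (1 - decay t) * F i t"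
      and y' = "\<lambda>t. (\<nu> i + \<kappa> * F i t - \<omega> i t) / m - decay t / m * (\<nu> i - \<omega>0 i)
         - \<kappa> * (decay t / m * F i t
           + (1 - decay t) * mean N (\<lambda>j. cos (\<theta> j t - \<theta> i t) * (\<omega> j t - \<omega> i t)))"
      and G' = "\<lambda>t. \<kappa> * (DW * (decay t * (2 - t / m - 2 * decay t))
         + (DV + 2 * \<kappa>) * (2 * (t / m) * decay t - 2 * decay t + 2 * (decay t)\<^sup>2))"])
  show "continuous_on {0..} (\<lambda>t. \<omega> i t - (decay t * \<omega>0 i + (1 - decay t) * \<nu> i) - \<kappa> * (1 - decay t) * F i t)"
    by (intro continuous_intros continuous_omega continuous_coupling i) (use m in auto)
  show "continuous_on {0..} memory_error"
    unfolding memory_error_def by (intro continuous_intros) (use m in auto)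
  show "((\<lambda>t. \<omega> i t - (decay t * \<omega>0 i + (1 - decay t) * \<nu> i) - \<kappa> * (1 - decay t) * F i t)
      has_real_derivative (\<nu> i + \<kappa> * F i s - \<omega> i s) / m - decay s / m * (\<nu> i - \<omega>0 i)
         - \<kappa> * (decay s / m * F i s
           + (1 - decay s) * mean N (\<lambda>j. cos (\<theta> j s - \<theta> i s) * (\<omega> j s - \<omega> i s)))) (at s)"
    if "s > 0" for s
  proof -
    note d = omega_derivative[OF i that] coupling_derivative[OF i that] decay_derivative[of s]
    have d1: "((\<lambda>t. decay t * \<omega>0 i + (1 - decay t) * \<nu> i) has_real_derivative decay s / m * (\<nu> i - \<omega>0 i)) (at s)"
      by (rule derivative_eq_intros d refl)+ (use m in \<open>simp add: field_simps\<close>)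
    have d2: "((\<lambda>t. \<kappa> * (1 - decay t) * F i t) has_real_derivative \<kappa> * (decay s / m * F i s
           + (1 - decay s) * mean N (\<lambda>j. cos (\<theta> j s - \<theta> i s) * (\<omega> j s - \<omega> i s)))) (at s)"
      by (rule derivative_eq_intros d refl)+ (use m in \<open>simp add: field_simps\<close>)
    show ?thesis by (intro DERIV_diff d(1) d1 d2)
  qed
  show "(memory_error has_real_derivative \<kappa> * (DW * (decay s * (2 - s / m - 2 * decay s))
         + (DV + 2 * \<kappa>) * (2 * (s / m) * decay s - 2 * decay s + 2 * (decay s)\<^sup>2))) (at s)" for s
  proof -
    note d3 = decay_derivative[of s]
    have dx: "((\<lambda>t. t / m) has_real_derivative 1 / m) (at s)"
      by (rule DERIV_cdivide) (rule DERIV_ident)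
    have "((\<lambda>t. decay t * (t / m - 1 + decay t)) has_real_derivative (decay s * (2 - s / m - 2 * decay s)) / m) (at s)"
      by (rule derivative_eq_intros d3 dx refl)+ (use m in \<open>simp add: field_simps\<close>)
    moreover have "((\<lambda>t. 1 - 2 * (t / m) * decay t - (decay t)\<^sup>2) has_real_derivative
        (2 * (s / m) * decay s - 2 * decay s + 2 * (decay s)\<^sup>2) / m) (at s)"
      by (rule derivative_eq_intros d3 dx refl)+ (use m in \<open>simp add: field_simps power2_eq_square\<close>)
    ultimately have "((\<lambda>t. m * \<kappa> * (DW * (decay t * (t / m - 1 + decay t))
      + (DV + 2 * \<kappa>) * (1 - 2 * (t / m) * decay t - (decay t)\<^sup>2))) has_real_derivative
      m * \<kappa> * (DW * ((decay s * (2 - s / m - 2 * decay s)) / m)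
      + (DV + 2 * \<kappa>) * ((2 * (s / m) * decay s - 2 * decay s + 2 * (decay s)\<^sup>2) / m))) (at s)"
      by (intro DERIV_cmult DERIV_add)
    moreover have "m * \<kappa> * (DW * (a / m) + (DV + 2 * \<kappa>) * (b / m)) = \<kappa> * (DW * a + (DV + 2 * \<kappa>) * b)" for a b
      using m by (simp add: field_simps)
    ultimately show ?thesis unfolding memory_error_def by (simp only:)
  qed
  show "\<bar>m * ((\<nu> i + \<kappa> * F i s - \<omega> i s) / m - decay s / m * (\<nu> i - \<omega>0 i)
         - \<kappa> * (decay s / m * F i s
           + (1 - decay s) * mean N (\<lambda>j. cos (\<theta> j s - \<theta> i s) * (\<omega> j s - \<omega> i s))))
      + (\<omega> i s - (decay s * \<omega>0 i + (1 - decay s) * \<nu> i) - \<kappa> * (1 - decay s) * F i s)\<bar>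
      \<le> m * (\<kappa> * (DW * (decay s * (2 - s / m - 2 * decay s))
         + (DV + 2 * \<kappa>) * (2 * (s / m) * decay s - 2 * decay s + 2 * (decay s)\<^sup>2))) + memory_error s"
    if s: "s > 0" for s
  proof -
    let ?W = "DW * decay s + (DV + 2 * \<kappa>) * (1 - decay s)"
    define F' where "F' = mean N (\<lambda>j. cos (\<theta> j s - \<theta> i s) * (\<omega> j s - \<omega> i s))"
    have "\<bar>F'\<bar> \<le> ?W"
      unfolding F'_def
    proof (rule mean_abs_le[OF N])
      fix j assume j: "j \<in> {1..N}"
      have "\<bar>cos (\<theta> j s - \<theta> i s) * (\<omega> j s - \<omega> i s)\<bar> \<le> 1 * \<bar>\<omega> j s - \<omega> i s\<bar>"
        unfolding abs_mult by (intro mult_right_mono) auto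
      with velocity_diameter[OF j i, of s] s
      show "\<bar>cos (\<theta> j s - \<theta> i s) * (\<omega> j s - \<omega> i s)\<bar> \<le> ?W" by simp
    qed
    then have "\<bar>m * \<kappa> * (1 - decay s) * F'\<bar> \<le> m * \<kappa> * (1 - decay s) * ?W"
      using m \<kappa> decay_bounds(1)[of s] s by (simp add: abs_mult mult_left_mono)
    moreover have "m * ((\<nu> i + \<kappa> * F i s - \<omega> i s) / m - decay s / m * (\<nu> i - \<omega>0 i)
         - \<kappa> * (decay s / m * F i s + (1 - decay s) * F'))
      + (\<omega> i s - (decay s * \<omega>0 i + (1 - decay s) * \<nu> i) - \<kappa> * (1 - decay s) * F i s)
      = - (m * \<kappa> * (1 - decay s) * F')" using m by (simp add: field_simps)
    moreover have "m * (\<kappa> * (DW * (decay s * (2 - s / m - 2 * decay s))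
         + (DV + 2 * \<kappa>) * (2 * (s / m) * decay s - 2 * decay s + 2 * (decay s)\<^sup>2))) + memory_error s
      = m * \<kappa> * (1 - decay s) * ?W"
      unfolding memory_error_def by algebra
    ultimately show ?thesis unfolding F'_def by linarith
  qed
  show "\<bar>\<omega> i 0 - (decay 0 * \<omega>0 i + (1 - decay 0) * \<nu> i) - \<kappa> * (1 - decay 0) * F i 0\<bar> \<le> memory_error 0"
    using i by (simp add: memory_error_def initial_state)
qed (rule t)

end

section \<open>Survival of coherence through the initial layer\<close>

lemma mean_abs_le_root_mean_square:
  assumes N: "N \<ge> 1"
  shows "mean N (\<lambda>i. \<bar>f i\<bar>) \<le> sqrt (mean N (\<lambda>i. (f i)\<^sup>2))"
proof (rule real_le_rsqrt)
  let ?a = "mean N (\<lambda>i. \<bar>f i\<bar>)"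
  have "0 \<le> mean N (\<lambda>i. (\<bar>f i\<bar> - ?a)\<^sup>2)"
    using mean_mono[of N "\<lambda>i. 0" "\<lambda>i. (\<bar>f i\<bar> - ?a)\<^sup>2"] N by (simp add: mean_const)
  also have "\<dots> = mean N (\<lambda>i. (f i)\<^sup>2 - 2 * ?a * \<bar>f i\<bar> + ?a\<^sup>2)"
    by (intro mean_cong) (simp add: power2_diff)
  also have "\<dots> = mean N (\<lambda>i. (f i)\<^sup>2) - 2 * ?a * ?a + ?a\<^sup>2"
    using N by (simp only: mean_add mean_diff mean_cmult mean_const)
  finally show "?a\<^sup>2 \<le> mean N (\<lambda>i. (f i)\<^sup>2)" by (simp add: power2_eq_square)
qed

lemma exp_minus_mult_le_1: "exp (- x) * (1 + x) \<le> (1 :: real)"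
  using exp_ge_add_one_self[of x] by (simp add: exp_minus field_simps)

text \<open>
  The right-hand side minus the left-hand side is \<open>exp (- x)\<close> times a function that vanishes at \<open>0\<close> and
  has the derivative \<open>2 * (1 - exp (- x))\<^sup>2\<close>.
\<close>

lemma memory_bound_cubic:
  fixes x :: real assumes x: "x \<ge> 0"
  shows "1 - 2 * x * exp (- x) - (exp (- x))\<^sup>2 \<le> (1 - exp (- x)) ^ 3"
proof -
  define h where "h = (\<lambda>x::real. 2 * x - 3 + 4 * exp (- x) - (exp (- x))\<^sup>2)"
  have d: "(h has_real_derivative 2 * (1 - exp (- s))\<^sup>2) (at s)" for s
    unfolding h_def by (rule derivative_eq_intros refl)+ (simp add: power2_eq_square algebra_simps)
  have "h 0 \<le> h x"
    by (rule DERIV_nonneg_imp_nondecreasing[OF x], intro exI conjI, rule d) simp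
  then have "0 \<le> exp (- x) * h x" by (simp add: h_def)
  also have "exp (- x) * h x = (1 - exp (- x)) ^ 3 - (1 - 2 * x * exp (- x) - (exp (- x))\<^sup>2)"
    unfolding h_def by algebra
  finally show ?thesis by simp
qed

text \<open>
  The left-hand side is the integral of \<open>s \<mapsto> exp (- s) * (s - 1 + exp (- s))\<close> over \<open>{0..x}\<close>. A pointwise
  comparison of derivatives fails for large \<open>x\<close>; it succeeds after division by \<open>exp (- x)\<close>.
\<close>

lemma integrated_memory_bound_cubic:
  fixes x :: real assumes x: "x \<ge> 0"
  shows "(1 - (exp (- x))\<^sup>2) / 2 - x * exp (- x) \<le> 3 / 4 * (1 - exp (- x)) ^ 3"
proof -
  define g where "g = (\<lambda>x::real. 3 / 4 * (exp x - 3 + 3 * exp (- x) - (exp (- x))\<^sup>2) - 1 / 2 * (exp x - exp (- x)) + x)"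
  have d: "(g has_real_derivative exp s * ((1 - exp (- s))\<^sup>2 * (1 + 6 * exp (- s)) / 4)) (at s)" for s
  proof -
    have "(g has_real_derivative exp s / 4 + 1 - 11 / 4 * exp (- s) + 3 / 2 * (exp (- s))\<^sup>2) (at s)"
      unfolding g_def by (rule derivative_eq_intros refl)+ (simp add: power2_eq_square field_simps)
    moreover have "exp s * exp (- s) = 1" by (simp add: exp_minus)
    then have "exp s / 4 + 1 - 11 / 4 * exp (- s) + 3 / 2 * (exp (- s))\<^sup>2
       = exp s * ((1 - exp (- s))\<^sup>2 * (1 + 6 * exp (- s)) / 4)" by (simp add: field_simps) algebra
    ultimately show ?thesis by (simp only:)
  qed
  have "g 0 \<le> g x"
    by (rule DERIV_nonneg_imp_nondecreasing[OF x], intro exI conjI, rule d) simp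
  then have "0 \<le> exp (- x) * g x" by (simp add: g_def)
  also have "exp (- x) * g x = 3 / 4 * (1 - exp (- x)) ^ 3 - ((1 - (exp (- x))\<^sup>2) / 2 - x * exp (- x))"
  proof -
    have "exp x * exp (- x) = 1" by (simp add: exp_minus)
    then show ?thesis unfolding g_def by (simp add: field_simps) algebra
  qed
  finally show ?thesis by simp
qed

text \<open>
  The function \<open>x * exp (- x)\<close> increases up to \<open>1\<close> and decreases afterwards.
\<close>

lemma mult_exp_minus_le_max:
  fixes x \<eta> :: real assumes "x \<ge> \<eta>"
  shows "x * exp (- x) \<le> max 1 \<eta> * exp (- max 1 \<eta>)"
proof (cases "x \<ge> 1")
  case True
  define y where "y = max 1 \<eta>"
  have y: "y \<ge> 1" "x \<ge> y" using True assms by (auto simp: y_def)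
  have "x \<le> y * (1 + (x - y))" using mult_nonneg_nonneg[of "y - 1" "x - y"] y by (simp add: algebra_simps)
  also have "\<dots> \<le> y * exp (x - y)" using exp_ge_add_one_self[of "x - y"] y by (intro mult_left_mono) auto
  finally have "x * exp (- x) \<le> y * exp (x - y) * exp (- x)" by (intro mult_right_mono) auto
  also have "\<dots> = y * exp (- y)" by (simp add: exp_add[symmetric] mult.assoc)
  finally show ?thesis by (simp add: y_def)
next
  case False
  then have "max 1 \<eta> = 1" using assms by simp
  moreover have "x \<le> exp (x - 1)" using exp_ge_add_one_self[of "x - 1"] by simp
  then have "x * exp (- x) \<le> exp (x - 1) * exp (- x)" by (intro mult_right_mono) auto
  ultimately show ?thesis by (simp add: exp_add[symmetric])
qed

context inertial_kuramoto
begin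

definition deviation :: "real \<Rightarrow> real" where
  "deviation t = decay t * DW / 2 + (1 - decay t) * DV / 2 + memory_error t"

text \<open>
  Measuring frequencies and initial velocities from the midpoints of their ranges halves their
  contribution. The price is a drift that all oscillators share and that no phase difference sees.
\<close>

lemma common_drift:
  obtains g where "\<And>i t. i \<in> {1..N} \<Longrightarrow> t \<ge> 0 \<Longrightarrow> \<bar>\<omega> i t - g t - \<kappa> * (1 - decay t) * F i t\<bar> \<le> deviation t"
proof -
  obtain c where c: "\<And>i. i \<in> {1..N} \<Longrightarrow> \<bar>\<nu> i - c\<bar> \<le> DV / 2"
    using diam_on_midpoint[OF _ index_nonempty] finite_atLeastAtMost by metis
  obtain d where d: "\<And>i. i \<in> {1..N} \<Longrightarrow> \<bar>\<omega>0 i - d\<bar> \<le> DW / 2"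
    using diam_on_midpoint[OF _ index_nonempty] finite_atLeastAtMost by metis
  have "\<bar>\<omega> i t - (decay t * d + (1 - decay t) * c) - \<kappa> * (1 - decay t) * F i t\<bar> \<le> deviation t"
    if i: "i \<in> {1..N}" and t: "t \<ge> 0" for i t
  proof -
    have "\<bar>decay t * (\<omega>0 i - d)\<bar> \<le> decay t * (DW / 2)"
      using d[OF i] by (simp add: abs_mult)
    moreover have "\<bar>(1 - decay t) * (\<nu> i - c)\<bar> \<le> (1 - decay t) * (DV / 2)"
      using mult_left_mono[OF c[OF i], of "1 - decay t"] decay_bounds(1)[OF t] by (simp add: abs_mult)
    moreover have "\<omega> i t - (decay t * d + (1 - decay t) * c) - \<kappa> * (1 - decay t) * F i t
      = \<omega> i t - (decay t * \<omega>0 i + (1 - decay t) * \<nu> i) - \<kappa> * (1 - decay t) * F i t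
        + decay t * (\<omega>0 i - d) + (1 - decay t) * (\<nu> i - c)" by (simp add: algebra_simps)
    ultimately show ?thesis using velocity_representation[OF i t] unfolding deviation_def by linarith
  qed
  then show ?thesis by (rule that)
qed

text \<open>
  After division by \<open>\<kappa> * (1 - decay t)\<close> each summand of the deviation is dominated by one summand of \<open>xi\<close>;
  for the contribution of \<open>DW\<close> to the memory error this rests on \<open>exp (- x) * (1 + x) \<le> 1\<close>.
\<close>

lemma deviation_le_xi:
  assumes \<eta>: "\<eta> > 0" and t: "t \<ge> \<eta> * m"
  shows "deviation t \<le> \<kappa> * (1 - decay t) * xi m \<kappa> DW DV \<eta>"
proof -
  define x e where "x = t / m" and "e = exp (- x)"
  define E where "E = exp (- \<eta>)"
  have de: "decay t = e" by (simp add: e_def x_def)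
  have x: "x \<ge> \<eta>" using t m by (simp add: x_def field_simps)
  have e: "0 < e" "e \<le> E" "E < 1" using x \<eta> by (auto simp: e_def E_def)
  have e1: "0 < 1 - e" using e by linarith
  have "e * (1 - E) \<le> (1 - e) * E" using e by (simp add: algebra_simps)
  then have "e \<le> (1 - e) * (E / (1 - E))" using e by (simp add: pos_le_divide_eq)
  then have 1: "e * (DW / 2) \<le> (1 - e) * (E / (1 - E)) * (DW / 2)"
    using DW_nonneg by (intro mult_right_mono) auto
  have "e * (x - 1 + e) \<le> (1 - e) * (x * e)"
  proof -
    have "e * (e * (1 + x)) \<le> e * 1"
      using exp_minus_mult_le_1[of x] e unfolding e_def[symmetric] by (intro mult_left_mono) auto
    then show ?thesis by (simp add: algebra_simps)
  qed
  also have "\<dots> \<le> (1 - e) * (max 1 \<eta> * exp (- max 1 \<eta>))"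
    using mult_exp_minus_le_max[OF x] e1 unfolding e_def[symmetric] by (intro mult_left_mono) auto
  finally have 2: "DW * (e * (x - 1 + e)) \<le> DW * ((1 - e) * (max 1 \<eta> * exp (- max 1 \<eta>)))"
    using DW_nonneg by (intro mult_left_mono)
  have "1 - 2 * x * e - e\<^sup>2 \<le> (1 - e) ^ 3"
    using memory_bound_cubic[of x] x \<eta> unfolding e_def by simp
  also have "\<dots> \<le> 1 - e" using e1 e power_decreasing[of 1 3 "1 - e"] by simp
  finally have 3: "(DV + 2 * \<kappa>) * (1 - 2 * x * e - e\<^sup>2) \<le> (DV + 2 * \<kappa>) * (1 - e)"
    using DV_nonneg \<kappa> by (intro mult_left_mono) auto
  have "deviation t = e * (DW / 2) + (1 - e) * (DV / 2)
      + m * \<kappa> * (DW * (e * (x - 1 + e)) + (DV + 2 * \<kappa>) * (1 - 2 * x * e - e\<^sup>2))"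
    unfolding deviation_def memory_error_def de x_def[symmetric] by simp
  also have "\<dots> \<le> (1 - e) * (E / (1 - E)) * (DW / 2) + (1 - e) * (DV / 2)
      + m * \<kappa> * (DW * ((1 - e) * (max 1 \<eta> * exp (- max 1 \<eta>))) + (DV + 2 * \<kappa>) * (1 - e))"
    using m \<kappa> by (intro add_mono 1 2 3 mult_left_mono order_refl) auto
  also have "\<dots> = \<kappa> * (1 - e) * xi m \<kappa> DW DV \<eta>"
    unfolding xi_def E_def[symmetric] using \<kappa> e by (simp add: field_simps)
  finally show ?thesis by (simp only: de)
qed

text \<open>
  The forces add up to zero, so the common drift drops out of half the derivative of \<open>(R t)\<^sup>2\<close>.
\<close>

lemma order_parameter_growth:
  assumes t: "t \<ge> 0"
  shows "mean N (\<lambda>j. F j t * \<omega> j t)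
    \<ge> \<kappa> * (1 - decay t) * mean N (\<lambda>j. (F j t)\<^sup>2) - deviation t * mean N (\<lambda>j. \<bar>F j t\<bar>)"
proof -
  obtain g where g: "\<And>i t. i \<in> {1..N} \<Longrightarrow> t \<ge> 0 \<Longrightarrow> \<bar>\<omega> i t - g t - \<kappa> * (1 - decay t) * F i t\<bar> \<le> deviation t"
    using common_drift by blast
  have "mean N (\<lambda>j. F j t * \<omega> j t) = mean N (\<lambda>j. F j t * \<omega> j t - g t * F j t)"
    using mean_coupling[of N "\<lambda>j. \<theta> j t"] by (simp add: mean_diff mean_cmult)
  also have "\<dots> \<ge> mean N (\<lambda>j. \<kappa> * (1 - decay t) * (F j t)\<^sup>2 - deviation t * \<bar>F j t\<bar>)"
  proof (rule mean_mono)
    fix j assume j: "j \<in> {1..N}"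
    have "\<bar>F j t * (\<omega> j t - g t - \<kappa> * (1 - decay t) * F j t)\<bar> \<le> \<bar>F j t\<bar> * deviation t"
      unfolding abs_mult by (intro mult_left_mono g j t) simp
    then show "\<kappa> * (1 - decay t) * (F j t)\<^sup>2 - deviation t * \<bar>F j t\<bar> \<le> F j t * \<omega> j t - g t * F j t"
      by (simp add: algebra_simps power2_eq_square abs_le_iff)
  qed
  finally show ?thesis by (simp add: mean_diff mean_cmult)
qed

lemma memory_error_nonneg: "t \<ge> 0 \<Longrightarrow> memory_error t \<ge> 0"
  using velocity_representation[of 1 t] N by fastforce

lemma deviation_nonneg: "t \<ge> 0 \<Longrightarrow> deviation t \<ge> 0"
  using memory_error_nonneg[of t] decay_bounds(1)[of t] DV_nonneg DW_nonneg
  unfolding deviation_def by (intro add_nonneg_nonneg divide_nonneg_pos mult_nonneg_nonneg) auto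

text \<open>
  Only the deviation can destroy coherence, and since every force is at most \<open>R\<close> in modulus, \<open>R\<close>
  decreases at most at the rate \<open>deviation\<close>. Its integral over the initial layer is bounded by \<open>zeta\<close>.
  Because \<open>R\<close> is not differentiable where it vanishes, the argument runs with \<open>sqrt ((R t)\<^sup>2 + \<epsilon>)\<close>.
\<close>

lemma order_parameter_initial_layer:
  assumes \<eta>: "\<eta> > 0"
  shows "R (\<eta> * m) \<ge> R 0 - zeta m \<kappa> DW DV \<eta>"
proof -
  define E where "E = exp (- \<eta>)"
  \<comment> \<open>An explicit antiderivative of a majorant of the deviation on the layer. The terms with \<open>DV\<close>
    and \<open>DV + 2 * \<kappa>\<close> are frozen at the end of the layer, where their bounds are largest.\<close>
  define B where "B = (\<lambda>t. m / 2 * (DW * (1 - decay t) + DV * (1 - E) * (t / m))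
    + m\<^sup>2 * \<kappa> * (DW * (1 / 2 * (1 - (decay t)\<^sup>2) - t / m * decay t) + (DV + 2 * \<kappa>) * (1 - E) ^ 3 * (t / m)))"
  define B' where "B' = (\<lambda>t. 1 / 2 * (DW * decay t + DV * (1 - E))
    + m * \<kappa> * (DW * ((decay t)\<^sup>2 - decay t + t / m * decay t) + (DV + 2 * \<kappa>) * (1 - E) ^ 3))"
  have dB: "(B has_real_derivative B' t) (at t)" for t
  proof -
    note d3 = decay_derivative[of t]
    have dx: "((\<lambda>t. t / m) has_real_derivative 1 / m) (at t)"
      by (rule DERIV_cdivide) (rule DERIV_ident)
    have d: "((\<lambda>t. 1 / 2 * (1 - (decay t)\<^sup>2) - t / m * decay t) has_real_derivative
        ((decay t)\<^sup>2 - decay t + t / m * decay t) / m) (at t)"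
      by (rule d3 dx derivative_eq_intros refl)+ (use m in \<open>simp_all add: field_simps power2_eq_square\<close>)
    have d1: "((\<lambda>t. 1 - decay t) has_real_derivative decay t / m) (at t)"
      by (rule d3 derivative_eq_intros refl)+ simp
    show ?thesis unfolding B_def B'_def
      by (rule DERIV_cong, (rule DERIV_add DERIV_cmult dx d d1)+) (use m in \<open>simp add: field_simps power2_eq_square\<close>)
  qed
  have dev: "deviation t \<le> B' t" if t: "0 < t" "t < \<eta> * m" for t
  proof -
    define x e where "x = t / m" and "e = exp (- x)"
    have de: "decay t = e" by (simp add: e_def x_def)
    have x: "x \<ge> 0" "x \<le> \<eta>" using t m by (auto simp: x_def field_simps)
    have e: "E \<le> e" "e \<le> 1" using x by (auto simp: e_def E_def)
    have "1 - 2 * x * e - e\<^sup>2 \<le> (1 - e) ^ 3" using memory_bound_cubic[OF x(1)] by (simp add: e_def)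
    also have "\<dots> \<le> (1 - E) ^ 3" using e by (intro power_mono) auto
    finally have 1: "(DV + 2 * \<kappa>) * (1 - 2 * x * e - e\<^sup>2) \<le> (DV + 2 * \<kappa>) * (1 - E) ^ 3"
      using DV_nonneg \<kappa> by (intro mult_left_mono) auto
    have 2: "(1 - e) * DV \<le> DV * (1 - E)" using mult_right_mono[of "1 - e" "1 - E" DV] e DV_nonneg by (simp add: mult.commute)
    have mem: "memory_error t = m * \<kappa> * (DW * (e\<^sup>2 - e + x * e) + (DV + 2 * \<kappa>) * (1 - 2 * x * e - e\<^sup>2))"
      unfolding memory_error_def de x_def[symmetric] by (simp add: algebra_simps power2_eq_square)
    have "deviation t = 1 / 2 * (DW * e + (1 - e) * DV)
      + m * \<kappa> * (DW * (e\<^sup>2 - e + x * e) + (DV + 2 * \<kappa>) * (1 - 2 * x * e - e\<^sup>2))"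
      unfolding deviation_def de mem by (simp add: mult.commute add_divide_distrib)
    also have "\<dots> \<le> B' t"
      unfolding B'_def de x_def[symmetric]
    proof (rule add_mono)
      show "1 / 2 * (DW * e + (1 - e) * DV) \<le> 1 / 2 * (DW * e + DV * (1 - E))" using 2 by simp
      show "m * \<kappa> * (DW * (e\<^sup>2 - e + x * e) + (DV + 2 * \<kappa>) * (1 - 2 * x * e - e\<^sup>2))
        \<le> m * \<kappa> * (DW * (e\<^sup>2 - e + x * e) + (DV + 2 * \<kappa>) * (1 - E) ^ 3)"
        by (rule mult_left_mono[OF add_left_mono[OF 1]]) (use m \<kappa> in simp)
    qed
    finally show ?thesis .
  qed
  have Bz: "B (\<eta> * m) \<le> zeta m \<kappa> DW DV \<eta>"
  proof -
    have "DW * ((1 - E\<^sup>2) / 2 - \<eta> * E) \<le> DW * (3 / 4 * (1 - E) ^ 3)"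
      using integrated_memory_bound_cubic[of \<eta>] \<eta> DW_nonneg unfolding E_def by (intro mult_left_mono) auto
    moreover have "B (\<eta> * m) = m / 2 * (DW * (1 - E) + DV * (1 - E) * \<eta>)
      + m\<^sup>2 * \<kappa> * (DW * ((1 - E\<^sup>2) / 2 - \<eta> * E) + (DV + 2 * \<kappa>) * (1 - E) ^ 3 * \<eta>)"
      unfolding B_def E_def using m by simp
    ultimately have "B (\<eta> * m) \<le> m / 2 * (DW * (1 - E) + DV * (1 - E) * \<eta>)
      + m\<^sup>2 * \<kappa> * (DW * (3 / 4 * (1 - E) ^ 3) + (DV + 2 * \<kappa>) * (1 - E) ^ 3 * \<eta>)"
      using m \<kappa> by simp
    also have "\<dots> = zeta m \<kappa> DW DV \<eta>"
      unfolding zeta_def E_def[symmetric] by (simp add: field_simps)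
    finally show ?thesis .
  qed
  have "R 0 - B (\<eta> * m) \<le> sqrt ((R (\<eta> * m))\<^sup>2 + \<epsilon>)" if \<epsilon>: "\<epsilon> > 0" for \<epsilon>
  proof -
    define f where "f = (\<lambda>t. sqrt ((R t)\<^sup>2 + \<epsilon>) + B t)"
    have pos: "(R t)\<^sup>2 + \<epsilon> > 0" for t using \<epsilon> by (simp add: add_nonneg_pos)
    have cont: "continuous_on {0..\<eta> * m} f"
      unfolding f_def
      by (intro continuous_intros continuous_on_subset[OF continuous_order_parameter_squared]
            DERIV_continuous_on[OF has_field_derivative_at_within[OF dB]]) auto
    have "f 0 \<le> f (\<eta> * m)"
    proof (rule DERIV_nonneg_imp_increasing_open[OF _ _ cont])
      show "0 \<le> \<eta> * m" using \<eta> m by simp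
      fix t assume t: "0 < t" "t < \<eta> * m"
      let ?D = "2 * mean N (\<lambda>j. F j t * \<omega> j t)" and ?s = "sqrt ((R t)\<^sup>2 + \<epsilon>)"
      have s: "?s > 0" "R t \<le> ?s" using pos[of t] \<epsilon> order_parameter_nonneg[of N]
        by (auto intro!: real_le_rsqrt)
      have "(f has_real_derivative ?D / (2 * ?s) + B' t) (at t)"
        unfolding f_def using DERIV_chain2[OF DERIV_real_sqrt[OF pos[of t]]
            DERIV_add[OF order_parameter_squared_derivative[OF t(1)] DERIV_const]]
        by (intro DERIV_add dB) (simp add: field_simps)
      moreover have "0 \<le> ?D / (2 * ?s) + B' t"
      proof -
        have "mean N (\<lambda>j. \<bar>F j t\<bar>) \<le> mean N (\<lambda>j. R t)"
          by (intro mean_mono abs_coupling_le_order_parameter)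
        then have "mean N (\<lambda>j. \<bar>F j t\<bar>) \<le> ?s" using N s by (simp add: mean_const)
        then have "deviation t * mean N (\<lambda>j. \<bar>F j t\<bar>) \<le> deviation t * ?s"
          using deviation_nonneg[of t] t by (intro mult_left_mono) auto
        moreover have "0 \<le> \<kappa> * (1 - decay t) * mean N (\<lambda>j. (F j t)\<^sup>2)"
          using \<kappa> decay_bounds(1)[of t] t mean_mono[of N "\<lambda>i. 0" "\<lambda>j. (F j t)\<^sup>2"] N
          by (intro mult_nonneg_nonneg) (auto simp: mean_const)
        ultimately have "?D \<ge> - 2 * (deviation t * ?s)" using order_parameter_growth[of t] t by linarith
        then have "?D / (2 * ?s) \<ge> - deviation t" using s by (simp add: field_simps)
        then show ?thesis using dev[OF t] by linarith
      qed
      ultimately show "\<exists>y. (f has_real_derivative y) (at t) \<and> 0 \<le> y" by blast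
    qed
    moreover have "B 0 = 0" by (simp add: B_def)
    moreover have "R 0 \<le> sqrt ((R 0)\<^sup>2 + \<epsilon>)" using \<epsilon> by (intro real_le_rsqrt) simp
    ultimately show ?thesis by (simp add: f_def)
  qed
  then have "R 0 - B (\<eta> * m) \<le> R (\<eta> * m)"
  proof -
    assume *: "\<And>\<epsilon>. \<epsilon> > 0 \<Longrightarrow> R 0 - B (\<eta> * m) \<le> sqrt ((R (\<eta> * m))\<^sup>2 + \<epsilon>)"
    have "((\<lambda>\<epsilon>. sqrt ((R (\<eta> * m))\<^sup>2 + \<epsilon>)) \<longlongrightarrow> sqrt ((R (\<eta> * m))\<^sup>2 + 0)) (at_right 0)"
      by (intro tendsto_intros)
    then have "R 0 - B (\<eta> * m) \<le> sqrt ((R (\<eta> * m))\<^sup>2 + 0)"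
      by (rule tendsto_lowerbound) (use * in \<open>auto simp: eventually_at_right_less eventually_at_filter\<close>)
    then show ?thesis using order_parameter_nonneg by simp
  qed
  with Bz show ?thesis by linarith
qed

end

section \<open>Formation and persistence of a majority cluster\<close>

text \<open>
  At the last time at which \<open>f \<ge> c\<close> holds, \<open>f\<close> would have to increase.
\<close>

lemma stays_above_if_increasing_above:
  fixes f f' :: "real \<Rightarrow> real"
  assumes cont: "continuous_on {a..} f" and start: "f a \<ge> c"
    and df: "\<And>t. t \<ge> a \<Longrightarrow> (f has_real_derivative f' t) (at t)"
    and pos: "\<And>t. t \<ge> a \<Longrightarrow> f t \<ge> c \<Longrightarrow> f' t > 0"
    and b: "b \<ge> a"
  shows "f b \<ge> c"
proof (rule ccontr)
  assume fb: "\<not> f b \<ge> c"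
  define S where "S = {a..b} \<inter> f -` {c..}"
  have "closed S" unfolding S_def
    by (intro continuous_closed_preimage continuous_on_subset[OF cont]) auto
  moreover have S: "a \<in> S" "bdd_above S" using start b by (auto simp: S_def)
  ultimately have s: "Sup S \<in> S" using closed_contains_Sup by blast
  define s where "s = Sup S"
  have s': "s \<ge> a" "s < b" "f s \<ge> c" using s fb by (auto simp: s_def S_def order_le_less)
  obtain d where d: "d > 0" "\<And>h. h > 0 \<Longrightarrow> h < d \<Longrightarrow> f s < f (s + h)"
    using DERIV_pos_inc_right[OF df[OF s'(1)] pos[OF s'(1,3)]] by blast
  define h where "h = min (d / 2) (b - s)"
  have h: "h > 0" "h < d" "s + h \<le> b" using d s' by (auto simp: h_def min_def)
  have "s + h \<in> S" using d(2)[OF h(1,2)] h s' by (auto simp: S_def)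
  then have "s + h \<le> s" unfolding s_def using S by (intro cSup_upper)
  with h show False by simp
qed

lemma linear_growth:
  fixes f f' :: "real \<Rightarrow> real"
  assumes df: "\<And>t. t \<ge> a \<Longrightarrow> (f has_real_derivative f' t) (at t)"
    and ge: "\<And>t. t \<ge> a \<Longrightarrow> f' t \<ge> c" and b: "b \<ge> a"
  shows "f b \<ge> f a + c * (b - a)"
proof -
  have "(\<lambda>t. f t - c * t) a \<le> (\<lambda>t. f t - c * t) b"
  proof (rule DERIV_nonneg_imp_nondecreasing[OF b], intro exI conjI)
    fix t assume "a \<le> t"
    show "((\<lambda>t. f t - c * t) has_real_derivative f' t - c) (at t)"
      by (rule derivative_eq_intros df[OF \<open>a \<le> t\<close>] refl)+ simp
    show "0 \<le> f' t - c" using ge[OF \<open>a \<le> t\<close>] by simp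
  qed
  then show ?thesis by (simp add: algebra_simps)
qed

lemma order_parameter_polar:
  obtains \<phi> where "\<And>i. alignment N x i = order_parameter N x * cos (x i - \<phi>)"
proof (cases "order_parameter N x = 0")
  case True
  then have "alignment N x i = 0" for i
    using coupling_alignment_Pythagoras[of N x i] by (simp add: sum_power2_eq_zero_iff)
  with True show ?thesis by (intro that) simp
next
  case False
  let ?X = "mean N (\<lambda>j. cos (x j))" and ?Y = "mean N (\<lambda>j. sin (x j))" and ?R = "order_parameter N x"
  have "(?X / ?R)\<^sup>2 + (?Y / ?R)\<^sup>2 = (?X\<^sup>2 + ?Y\<^sup>2) / ?R\<^sup>2"
    by (simp add: power_divide add_divide_distrib)
  then have "(?X / ?R)\<^sup>2 + (?Y / ?R)\<^sup>2 = 1"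
    using False by (simp add: order_parameter_cartesian[symmetric])
  then obtain \<phi> where "?X / ?R = cos \<phi>" "?Y / ?R = sin \<phi>"
    using sincos_total_2pi by metis
  then have "?X = ?R * cos \<phi>" "?Y = ?R * sin \<phi>" using False by (auto simp: field_simps)
  then have "alignment N x i = ?R * cos (x i - \<phi>)" for i
    unfolding alignment_def mean_shifted_cos by (simp add: cos_diff algebra_simps)
  then show ?thesis by (rule that)
qed

text \<open>
  The oscillators at distance less than \<open>l / 2\<close> from the mean phase, expressed so that no mean phase has
  to be chosen.
\<close>

definition aligned :: "nat \<Rightarrow> real \<Rightarrow> (nat \<Rightarrow> real) \<Rightarrow> nat set" where
  "aligned N l x = {i\<in>{1..N}. order_parameter N x * cos (l / 2) < alignment N x i}"

lemma aligned_within_arc: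
  assumes l: "0 < l" "l < pi" and R: "order_parameter N x > 0"
  obtains k :: "nat \<Rightarrow> int" where
    "\<And>i j. i \<in> aligned N l x \<Longrightarrow> j \<in> aligned N l x \<Longrightarrow>
      (x i - 2 * real_of_int (k i) * pi) - (x j - 2 * real_of_int (k j) * pi) < l"
proof -
  obtain \<phi> where \<phi>: "\<And>i. alignment N x i = order_parameter N x * cos (x i - \<phi>)"
    using order_parameter_polar[of N x] by blast
  define k where "k i = round ((x i - \<phi>) / (2 * pi))" for i
  have "\<bar>x i - 2 * real_of_int (k i) * pi - \<phi>\<bar> < l / 2" if i: "i \<in> aligned N l x" for i
  proof -
    let ?y = "x i - 2 * real_of_int (k i) * pi - \<phi>"
    have "\<bar>real_of_int (k i) - (x i - \<phi>) / (2 * pi)\<bar> \<le> 1 / 2"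
      unfolding k_def by (rule of_int_round_abs_le)
    then have "\<bar>real_of_int (k i) - (x i - \<phi>) / (2 * pi)\<bar> * (2 * pi) \<le> 1 / 2 * (2 * pi)"
      by (intro mult_right_mono) auto
    moreover have "\<bar>real_of_int (k i) - (x i - \<phi>) / (2 * pi)\<bar> * (2 * pi)
        = \<bar>(real_of_int (k i) - (x i - \<phi>) / (2 * pi)) * (2 * pi)\<bar>" by (simp add: abs_mult)
    moreover have "(real_of_int (k i) - (x i - \<phi>) / (2 * pi)) * (2 * pi) = - ?y"
      using pi_gt_zero by (simp only: left_diff_distrib) simp
    ultimately have y: "\<bar>?y\<bar> \<le> pi" by simp
    have "cos (l / 2) < cos (x i - \<phi>)" using i R by (simp add: aligned_def \<phi>)
    then have "cos (l / 2) < cos \<bar>?y\<bar>" by (simp add: cos_shift)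
    then show ?thesis using y l by (subst (asm) cos_mono_less_eq) auto
  qed
  then have "(x i - 2 * real_of_int (k i) * pi) - (x j - 2 * real_of_int (k j) * pi) < l"
    if "i \<in> aligned N l x" "j \<in> aligned N l x" for i j
    using that by (smt (verit) field_sum_of_halves)
  then show ?thesis by (rule that)
qed

lemma mean_indicator: "A \<subseteq> {1..N} \<Longrightarrow> mean N (\<lambda>i. if i \<in> A then 1 else 0) = real (card A) / real N"
  by (simp add: mean_eq_sum_div sum.If_cases Int_absorb1)

text \<open>
  The order parameter averages the cosines of the angles to the mean phase; these are at most \<open>1\<close> on
  the aligned oscillators and at most \<open>cos (l / 2)\<close> on the others.
\<close>

lemma order_parameter_le_aligned_fraction:
  assumes N: "N \<ge> 1" and R: "order_parameter N x > 0"
  shows "order_parameter N x \<le> cos (l / 2) + (1 - cos (l / 2)) * (real (card (aligned N l x)) / real N)"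
proof -
  let ?R = "order_parameter N x" and ?A = "aligned N l x" and ?C = "cos (l / 2)"
  have A: "?A \<subseteq> {1..N}" by (auto simp: aligned_def)
  have "?R * ?R = mean N (alignment N x)" by (simp add: mean_alignment power2_eq_square)
  also have "\<dots> \<le> mean N (\<lambda>i. ?R * (?C + (1 - ?C) * (if i \<in> ?A then 1 else 0)))"
  proof (rule mean_mono)
    fix i assume i: "i \<in> {1..N}"
    have "\<bar>alignment N x i\<bar> \<le> ?R"
      using coupling_alignment_Pythagoras[of N x i] R
      by (metis abs_le_square_iff abs_of_pos le_add_same_cancel2 zero_le_power2)
    then show "alignment N x i \<le> ?R * (?C + (1 - ?C) * (if i \<in> ?A then 1 else 0))"
      using i by (auto simp: aligned_def)
  qed
  also have "\<dots> = ?R * (?C + (1 - ?C) * (real (card ?A) / real N))"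
    using N by (simp only: mean_cmult mean_add mean_const mean_indicator[OF A])
  finally show ?thesis using R by (simp only: mult_le_cancel_left_pos)
qed

text \<open>
  Write \<open>c\<close> for the cosine of the angle between an oscillator and the mean phase and \<open>C = cos (l / 2)\<close>.
  Then \<open>1 + c - (1 - c\<^sup>2) / (1 - C)\<close> is at most \<open>2\<close>, and at most \<open>0\<close> if \<open>c \<le> C\<close>. Averaging this over all
  oscillators is the claim, since \<open>1 - c\<^sup>2\<close> is the squared force divided by the squared order parameter.
  So small forces can only mean that few oscillators sit far from the mean phase.
\<close>

lemma aligned_fraction_lower_bound:
  assumes N: "N \<ge> 1" and R: "order_parameter N x > 0" and C: "cos (l / 2) < 1"
  shows "1 + order_parameter N x - mean N (\<lambda>i. (coupling N x i)\<^sup>2) / ((order_parameter N x)\<^sup>2 * (1 - cos (l / 2)))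
    \<le> 2 * (real (card (aligned N l x)) / real N)"
proof -
  let ?R = "order_parameter N x" and ?A = "aligned N l x" and ?C = "cos (l / 2)"
  have A: "?A \<subseteq> {1..N}" by (auto simp: aligned_def)
  have "mean N (\<lambda>i. 1 + alignment N x i / ?R - (coupling N x i)\<^sup>2 / (?R\<^sup>2 * (1 - ?C)))
     \<le> mean N (\<lambda>i. 2 * (if i \<in> ?A then 1 else 0))"
  proof (rule mean_mono)
    fix i assume i: "i \<in> {1..N}"
    define c where "c = alignment N x i / ?R"
    have F: "(coupling N x i)\<^sup>2 = ?R\<^sup>2 * (1 - c\<^sup>2)"
    proof -
      have "?R\<^sup>2 * c\<^sup>2 = (alignment N x i)\<^sup>2" using R by (simp add: c_def power_divide)
      then show ?thesis using coupling_alignment_Pythagoras[of N x i] by (simp add: right_diff_distrib)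
    qed
    have "0 \<le> ?R\<^sup>2 * (1 - c\<^sup>2)" unfolding F[symmetric] by simp
    then have c2: "c\<^sup>2 \<le> 1" using R by (simp add: zero_le_mult_iff)
    then have c: "- 1 \<le> c" "c \<le> 1" by (auto simp: power2_le_iff_abs_le abs_le_iff abs_square_le_1)
    have eq: "1 + c - (coupling N x i)\<^sup>2 / (?R\<^sup>2 * (1 - ?C)) = 1 + c - (1 - c\<^sup>2) / (1 - ?C)"
      unfolding F using R by simp
    have "1 + c - (1 - c\<^sup>2) / (1 - ?C) \<le> 2 * (if i \<in> ?A then 1 else 0)"
    proof (cases "i \<in> ?A")
      case True
      have "0 \<le> (1 - c\<^sup>2) / (1 - ?C)" using c2 C by (intro divide_nonneg_pos) auto
      then show ?thesis using True c by simp
    next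
      case False
      then have "c \<le> ?C" using i R by (simp add: aligned_def c_def field_simps)
      then have "(1 + c) * (1 - ?C) \<le> (1 + c) * (1 - c)" using c by (intro mult_left_mono) auto
      then have "1 + c \<le> (1 - c\<^sup>2) / (1 - ?C)" using C by (simp add: pos_le_divide_eq power2_eq_square algebra_simps)
      then show ?thesis using False by simp
    qed
    then show "1 + alignment N x i / ?R - (coupling N x i)\<^sup>2 / (?R\<^sup>2 * (1 - ?C)) \<le> 2 * (if i \<in> ?A then 1 else 0)"
      using eq by (simp add: c_def)
  qed
  also have "mean N (\<lambda>i. 1 + alignment N x i / ?R - (coupling N x i)\<^sup>2 / (?R\<^sup>2 * (1 - ?C)))
    = mean N (\<lambda>i. 1 + inverse ?R * alignment N x i - inverse (?R\<^sup>2 * (1 - ?C)) * (coupling N x i)\<^sup>2)"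
    by (intro mean_cong) (simp only: divide_inverse mult.commute)
  also have "\<dots> = 1 + inverse ?R * ?R\<^sup>2 - inverse (?R\<^sup>2 * (1 - ?C)) * mean N (\<lambda>i. (coupling N x i)\<^sup>2)"
    using N mean_alignment[of N x] by (simp only: mean_add mean_diff mean_cmult mean_const)
  also have "\<dots> = 1 + ?R - mean N (\<lambda>i. (coupling N x i)\<^sup>2) / (?R\<^sup>2 * (1 - ?C))"
  proof -
    have "inverse ?R * ?R\<^sup>2 = ?R" using R by (simp add: power2_eq_square)
    then show ?thesis by (simp only: divide_inverse mult.commute)
  qed
  also have "mean N (\<lambda>i. 2 * (if i \<in> ?A then 1 else 0)) = 2 * (real (card ?A) / real N)"
    by (simp only: mean_cmult mean_indicator[OF A])
  finally show ?thesis .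
qed

text \<open>
  A fraction \<open>lam\<close> of the oscillators in an arc of length \<open>d\<close> draws the ends of this arc together with at
  least twice this force, whatever the other oscillators do; see \<open>coupling_gap_of_majority\<close>.
\<close>

definition restoring :: "real \<Rightarrow> real \<Rightarrow> real" where
  "restoring lam d = sin (d / 2) * (lam * cos (d / 2) - (1 - lam))"

lemma coupling_gap_of_majority:
  assumes N: "N \<ge> 1" and A: "A \<subseteq> {1..N}" "lam * real N \<le> real (card A)"
    and between: "\<And>k. k \<in> A \<Longrightarrow> x j \<le> x k \<and> x k \<le> x i"
    and d: "0 \<le> x i - x j" "x i - x j \<le> 2 * pi"
  shows "2 * restoring lam (x i - x j) \<le> coupling N x j - coupling N x i"
proof -
  let ?d = "x i - x j"
  have "lam * cos (?d / 2) - (1 - lam) \<le> mean N (\<lambda>k. cos (x k - (x i + x j) / 2))"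
  proof (rule mean_ge_of_majority[OF A N])
    fix k assume "k \<in> A"
    then have "\<bar>x k - (x i + x j) / 2\<bar> \<le> ?d / 2"
      using between[of k] unfolding abs_le_iff by (auto simp: field_simps)
    then have "cos (?d / 2) \<le> cos \<bar>x k - (x i + x j) / 2\<bar>"
      using d by (intro cos_monotone_0_pi_le) auto
    then show "cos (?d / 2) \<le> cos (x k - (x i + x j) / 2)" by simp
  qed auto
  then have "sin (?d / 2) * (lam * cos (?d / 2) - (1 - lam)) \<le> sin (?d / 2) * mean N (\<lambda>k. cos (x k - (x i + x j) / 2))"
    using d by (intro mult_left_mono sin_ge_zero) auto
  then show ?thesis unfolding restoring_def coupling_difference_chord by simp
qed

text \<open>
  The hypotheses under which a majority cluster forms and survives. A fraction \<open>\<delta>\<close> of the initial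
  coherence outlives the initial layer; \<open>restoring lam l\<close> in the last assumption is the force that keeps
  a majority inside an arc of length \<open>l\<close>.
\<close>

locale clustering_regime = inertial_kuramoto +
  fixes l lam \<eta> \<delta> :: real
  assumes l: "0 < l" "l < pi" and lam: "1 / 2 < lam" "lam \<le> 1" and \<eta>: "0 < \<eta>" and \<delta>: "0 < \<delta>" "\<delta> < 1"
    and initial_coherence: "order_parameter N \<theta>0 > 0" "zeta m \<kappa> DW DV \<eta> \<le> (1 - \<delta>) * order_parameter N \<theta>0"
    and cluster_formation: "\<delta> * order_parameter N \<theta>0 \<ge> lam + (1 - lam) * cos (l / 2) \<or>
      2 * lam + (xi m \<kappa> DW DV \<eta> / (\<delta> * order_parameter N \<theta>0))\<^sup>2 * (1 / (1 - cos (l / 2)))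
        \<le> 1 + \<delta> * order_parameter N \<theta>0"
    and cluster_stability: "xi m \<kappa> DW DV \<eta> < restoring lam l"
begin

abbreviation "\<xi> \<equiv> xi m \<kappa> DW DV \<eta>"
text \<open>
  The coherence that is left when the initial layer ends at time \<open>\<eta> * m\<close>.
\<close>

definition R_low :: real where "R_low = \<delta> * order_parameter N \<theta>0"

lemma R_low_pos: "R_low > 0" using \<delta> initial_coherence by (simp add: R_low_def)

text \<open>
  The strictness comes from the inertial summand \<open>(DV + 2 * \<kappa>) * m\<close> of \<open>xi\<close>. In equilibrium the forces on two
  oscillators differ by at most \<open>DV / \<kappa>\<close>, so the limit state obeys a strictly better bound than the flow.
\<close>

lemma DV_less_xi: "DV / \<kappa> < 2 * \<xi>"
proof -
  have "0 \<le> DW * m * max 1 \<eta> * exp (- max 1 \<eta>)" using DW_nonneg m \<eta> by simp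
  moreover have "0 \<le> DW / (2 * \<kappa>) * (exp (- \<eta>) / (1 - exp (- \<eta>)))"
    using DW_nonneg \<kappa> \<eta> by (intro mult_nonneg_nonneg divide_nonneg_nonneg) auto
  moreover have "0 < (DV + 2 * \<kappa>) * m" using DV_nonneg \<kappa> m by (intro mult_pos_pos) auto
  ultimately have "DV / (2 * \<kappa>) < \<xi>" unfolding xi_def by linarith
  then show ?thesis by (simp add: field_simps)
qed

lemma xi_pos: "\<xi> > 0"
proof -
  have "0 \<le> DV / \<kappa>" using DV_nonneg \<kappa> by simp
  with DV_less_xi show ?thesis by linarith
qed

lemma order_parameter_after_layer: "R (\<eta> * m) \<ge> R_low"
proof -
  have "R 0 = order_parameter N \<theta>0"
    unfolding order_parameter_def by (simp add: initial_state)
  then show ?thesis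
    using order_parameter_initial_layer[OF \<eta>] initial_coherence(2) by (simp add: R_low_def algebra_simps)
qed

lemma post_layer:
  assumes "t \<ge> \<eta> * m" shows "t > 0" "decay t \<le> exp (- \<eta>)" "1 - decay t > 0"
proof -
  have "\<eta> * m > 0" using \<eta> m by simp
  with assms show "t > 0" by linarith
  show "decay t \<le> exp (- \<eta>)" using assms m by (simp add: field_simps)
  moreover have "exp (- \<eta>) < 1" using \<eta> by simp
  ultimately show "1 - decay t > 0" by linarith
qed

lemma order_parameter_growth_post_layer:
  assumes t: "t \<ge> \<eta> * m"
  defines "P \<equiv> mean N (\<lambda>j. (F j t)\<^sup>2)"
  shows "2 * mean N (\<lambda>j. F j t * \<omega> j t) \<ge> 2 * \<kappa> * (1 - decay t) * (P - \<xi> * sqrt P)"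
proof -
  note pl = post_layer[OF t]
  have "deviation t * mean N (\<lambda>j. \<bar>F j t\<bar>) \<le> (\<kappa> * (1 - decay t) * \<xi>) * sqrt P"
    unfolding P_def using pl \<kappa> xi_pos
    by (intro mult_mono deviation_le_xi \<eta> t mean_abs_le_root_mean_square N)
      (auto simp: mean_def intro!: mult_nonneg_nonneg divide_nonneg_nonneg sum_nonneg)
  with order_parameter_growth[of t] pl(1) show ?thesis by (simp add: P_def algebra_simps)
qed

text \<open>
  Under the first alternative for cluster formation the coherence at the end of the initial layer
  already forces a majority to be aligned. Under the second one, suppose that no majority is ever
  aligned. Then \<open>aligned_fraction_lower_bound\<close> keeps the mean square force above \<open>\<xi>\<^sup>2\<close>, hence \<open>R\<^sup>2\<close> increases;
  once it has gained a little, the mean square force exceeds \<open>\<xi>\<^sup>2\<close> by a fixed amount, and \<open>R\<^sup>2\<close> grows at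
  least linearly, although it is at most \<open>1\<close>.
\<close>

lemma majority_aligned_at_some_time:
  obtains T where "T \<ge> \<eta> * m" "R T > 0" "lam * real N \<le> real (card (aligned N l (\<lambda>j. \<theta> j T)))"
proof -
  note witness = that
  let ?T = "\<eta> * m" and ?C = "cos (l / 2)"
  have C: "?C < 1" using cos_monotone_0_pi[of 0 "l / 2"] l by auto
  from cluster_formation[folded R_low_def] show ?thesis
  proof
    assume "R_low \<ge> lam + (1 - lam) * ?C"
    moreover have R: "R ?T \<ge> R_low" "R ?T > 0" using order_parameter_after_layer R_low_pos by auto
    moreover note order_parameter_le_aligned_fraction[OF N R(2), of l]
    ultimately have "lam + (1 - lam) * ?C \<le> ?C + (1 - ?C) * (real (card (aligned N l (\<lambda>j. \<theta> j ?T))) / real N)"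
      by linarith
    then have "(1 - ?C) * lam \<le> (1 - ?C) * (real (card (aligned N l (\<lambda>j. \<theta> j ?T))) / real N)"
      by (simp add: algebra_simps)
    then have "lam \<le> real (card (aligned N l (\<lambda>j. \<theta> j ?T))) / real N"
      using C by (simp only: mult_le_cancel_left_pos)
    then show ?thesis using N R by (intro that[of ?T]) (auto simp: pos_le_divide_eq)
  next
    assume F2: "2 * lam + (\<xi> / R_low)\<^sup>2 * (1 / (1 - ?C)) \<le> 1 + R_low"
    show ?thesis
    proof (rule ccontr)
      assume no: "\<not> thesis"
      let ?P = "\<lambda>t. mean N (\<lambda>j. (F j t)\<^sup>2)"
      have large: "?P t > \<xi>\<^sup>2 + R_low\<^sup>2 * (1 - ?C) * (R t - R_low)" if t: "t \<ge> ?T" and Rt: "R t \<ge> R_low" for t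
      proof -
        have Rpos: "R t > 0" using Rt R_low_pos by linarith
        have "\<not> lam * real N \<le> real (card (aligned N l (\<lambda>j. \<theta> j t)))"
          using no witness[of t] t Rpos by blast
        then have "real (card (aligned N l (\<lambda>j. \<theta> j t))) / real N < lam"
          using N by (simp add: pos_divide_less_eq)
        with aligned_fraction_lower_bound[OF N Rpos C]
        have "1 + R t - ?P t / ((R t)\<^sup>2 * (1 - ?C)) < 2 * lam" by linarith
        with F2 have "(\<xi> / R_low)\<^sup>2 * (1 / (1 - ?C)) + (R t - R_low) < ?P t / ((R t)\<^sup>2 * (1 - ?C))" by linarith
        then have "((\<xi> / R_low)\<^sup>2 * (1 / (1 - ?C)) + (R t - R_low)) * ((R t)\<^sup>2 * (1 - ?C)) < ?P t"
          using Rpos C by (simp add: pos_less_divide_eq)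
        moreover have "(a * (1 / (1 - ?C)) + b) * (c * (1 - ?C)) = (a + (1 - ?C) * b) * c" for a b c
          using C by (simp add: field_simps)
        then have "((\<xi> / R_low)\<^sup>2 * (1 / (1 - ?C)) + (R t - R_low)) * ((R t)\<^sup>2 * (1 - ?C))
          = ((\<xi> / R_low)\<^sup>2 + (1 - ?C) * (R t - R_low)) * (R t)\<^sup>2" .
        moreover have "0 \<le> (\<xi> / R_low)\<^sup>2 + (1 - ?C) * (R t - R_low)"
          using C Rt by (intro add_nonneg_nonneg mult_nonneg_nonneg zero_le_power2) auto
        then have "((\<xi> / R_low)\<^sup>2 + (1 - ?C) * (R t - R_low)) * R_low\<^sup>2 \<le> ((\<xi> / R_low)\<^sup>2 + (1 - ?C) * (R t - R_low)) * (R t)\<^sup>2"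
          using power_mono[OF Rt, of 2] R_low_pos by (intro mult_left_mono) (auto simp only: less_imp_le)
        moreover have "(\<xi> / R_low)\<^sup>2 * R_low\<^sup>2 = \<xi>\<^sup>2" using R_low_pos by (simp add: power_divide)
        then have "((\<xi> / R_low)\<^sup>2 + (1 - ?C) * (R t - R_low)) * R_low\<^sup>2 = \<xi>\<^sup>2 + R_low\<^sup>2 * (1 - ?C) * (R t - R_low)"
          by (simp only: distrib_right) (simp add: algebra_simps)
        ultimately show ?thesis by linarith
      qed
      have T0: "0 \<le> ?T" using \<eta> m by simp
      let ?Q = "\<lambda>t. (R t)\<^sup>2" and ?Q' = "\<lambda>t. 2 * mean N (\<lambda>j. F j t * \<omega> j t)"
      have dQ: "(?Q has_real_derivative ?Q' t) (at t)" if "t \<ge> ?T" for t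
        by (rule order_parameter_squared_derivative[OF post_layer(1)[OF that]])
      have growth: "?Q' t \<ge> 2 * \<kappa> * (1 - exp (- \<eta>)) * (q * (q - \<xi>))"
        if t: "t \<ge> ?T" and q: "q \<ge> \<xi>" "q\<^sup>2 \<le> ?P t" for t q
      proof -
        have sq: "q \<le> sqrt (?P t)" using q by (intro real_le_rsqrt)
        have P0: "?P t \<ge> 0" using q(2) zero_le_power2[of q] by linarith
        have "q * (q - \<xi>) \<le> sqrt (?P t) * (sqrt (?P t) - \<xi>)"
          using sq q xi_pos P0 by (intro mult_mono) auto
        also have "\<dots> = ?P t - \<xi> * sqrt (?P t)" using P0 by (simp add: algebra_simps)
        finally have root: "q * (q - \<xi>) \<le> ?P t - \<xi> * sqrt (?P t)" .
        have "2 * \<kappa> * (1 - exp (- \<eta>)) * (q * (q - \<xi>)) \<le> 2 * \<kappa> * (1 - decay t) * (?P t - \<xi> * sqrt (?P t))"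
        proof (rule mult_mono[OF _ root])
          show "2 * \<kappa> * (1 - exp (- \<eta>)) \<le> 2 * \<kappa> * (1 - decay t)"
            by (rule mult_left_mono) (use post_layer(2)[OF t] \<kappa> in auto)
          show "0 \<le> 2 * \<kappa> * (1 - decay t)" using post_layer(3)[OF t] \<kappa> by simp
          show "0 \<le> q * (q - \<xi>)" using q(1) xi_pos by (intro mult_nonneg_nonneg) auto
        qed
        with order_parameter_growth_post_layer[OF t] show ?thesis by linarith
      qed
      have sqrt_gt: "sqrt (\<xi>\<^sup>2 + c) > \<xi>" if "c > 0" for c
        using xi_pos that by (intro real_less_rsqrt) simp
      have Rr: "R t \<ge> R_low" if t: "t \<ge> ?T" and "?Q t \<ge> R_low\<^sup>2" for t
        using that(2) order_parameter_nonneg by (rule power2_le_imp_le)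
      have increasing: "?Q' t > 0" if t: "t \<ge> ?T" and Q: "?Q t \<ge> R_low\<^sup>2" for t
      proof -
        have "\<xi>\<^sup>2 < ?P t"
        proof -
          have "0 \<le> R_low\<^sup>2 * (1 - ?C) * (R t - R_low)"
            using Rr[OF t Q] C by (intro mult_nonneg_nonneg) auto
          with large[OF t Rr[OF t Q]] show ?thesis by linarith
        qed
        then have root: "\<xi> < sqrt (?P t)" using xi_pos by (intro real_less_rsqrt)
        have P0: "?P t \<ge> 0" using \<open>\<xi>\<^sup>2 < ?P t\<close> zero_le_power2[of \<xi>] by linarith
        have "0 < sqrt (?P t)" using root xi_pos by linarith
        then have "0 < 2 * \<kappa> * (1 - exp (- \<eta>)) * (sqrt (?P t) * (sqrt (?P t) - \<xi>))"
          using \<kappa> \<eta> root by (intro mult_pos_pos) (auto simp del: real_sqrt_gt_0_iff)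
        moreover have "2 * \<kappa> * (1 - exp (- \<eta>)) * (sqrt (?P t) * (sqrt (?P t) - \<xi>)) \<le> ?Q' t"
          by (rule growth[OF t]) (use root P0 in auto)
        ultimately show ?thesis by linarith
      qed
      have above: "?Q t \<ge> R_low\<^sup>2" if "t \<ge> ?T" for t
      proof (rule stays_above_if_increasing_above[OF _ _ dQ increasing that])
        show "continuous_on {?T..} ?Q"
          by (rule continuous_on_subset[OF continuous_order_parameter_squared]) (use T0 in auto)
        show "R_low\<^sup>2 \<le> ?Q ?T" using order_parameter_after_layer R_low_pos by (intro power_mono) auto
      qed
      have "?Q ?T < ?Q (?T + 1)"
        by (rule DERIV_pos_imp_increasing, simp, intro exI conjI, rule dQ, assumption, rule increasing[OF _ above])
      then have "R_low\<^sup>2 < ?Q (?T + 1)" using above[of ?T] by simp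
      then have R1: "R_low < R (?T + 1)" using order_parameter_nonneg by (rule power2_less_imp_less)
      \<comment> \<open>A lower bound for the root mean square force from time \<open>?T + 1\<close> on.\<close>
      define q where "q = sqrt (\<xi>\<^sup>2 + R_low\<^sup>2 * (1 - ?C) * (R (?T + 1) - R_low))"
      have gap: "R_low\<^sup>2 * (1 - ?C) * (R (?T + 1) - R_low) > 0" using R1 R_low_pos C by (intro mult_pos_pos) auto
      have q: "q > \<xi>" unfolding q_def by (rule sqrt_gt[OF gap])
      define c where "c = 2 * \<kappa> * (1 - exp (- \<eta>)) * (q * (q - \<xi>))"
      have c: "c > 0" unfolding c_def using \<kappa> \<eta> q xi_pos by (intro mult_pos_pos) auto
      have "?Q' t \<ge> c" if t: "t \<ge> ?T + 1" for t
      proof -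
        have "?Q (?T + 1) \<le> ?Q t"
          proof (rule DERIV_nonneg_imp_nondecreasing[OF t], intro exI conjI)
          fix s assume "?T + 1 \<le> s"
          then have s: "?T \<le> s" by simp
          show "(?Q has_real_derivative ?Q' s) (at s)" by (rule dQ[OF s])
          show "0 \<le> ?Q' s" using increasing[OF s above[OF s]] by simp
        qed
        then have "R (?T + 1) \<le> R t" using order_parameter_nonneg by (rule power2_le_imp_le)
        then have "R_low\<^sup>2 * (1 - ?C) * (R (?T + 1) - R_low) \<le> R_low\<^sup>2 * (1 - ?C) * (R t - R_low)"
          using C by (intro mult_left_mono) auto
        moreover have tT: "t \<ge> ?T" using t by simp
        ultimately have "q\<^sup>2 \<le> ?P t"
          using large[OF tT Rr[OF tT above[OF tT]]] gap unfolding q_def by (simp add: real_sqrt_pow2 add_nonneg_pos less_imp_le)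
        then show ?thesis unfolding c_def using q by (intro growth tT) auto
      qed
      \<comment> \<open>After the further time \<open>2 / c\<close> a quantity bounded by \<open>1\<close> would have grown by \<open>2\<close>.\<close>
      then have "?Q (?T + 1) + c * ((?T + 1 + 2 / c) - (?T + 1)) \<le> ?Q (?T + 1 + 2 / c)"
        using c by (intro linear_growth[where f' = ?Q'] dQ) auto
      moreover have "c * ((?T + 1 + 2 / c) - (?T + 1)) = 2" using c by simp
      moreover have "?Q (?T + 1 + 2 / c) \<le> 1"
        using order_parameter_le_1[OF N] order_parameter_nonneg by (simp add: power_le_one)
      moreover have "?Q (?T + 1) \<ge> 0" by simp
      ultimately show False by linarith
    qed
  qed
qed

lemma velocity_gap:
  assumes t: "t \<ge> \<eta> * m" and i: "i \<in> {1..N}" and j: "j \<in> {1..N}"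
  shows "\<omega> i t - \<omega> j t \<le> \<kappa> * (1 - decay t) * (2 * \<xi> - (F j t - F i t))"
proof -
  obtain g where g: "\<And>i t. i \<in> {1..N} \<Longrightarrow> t \<ge> 0 \<Longrightarrow> \<bar>\<omega> i t - g t - \<kappa> * (1 - decay t) * F i t\<bar> \<le> deviation t"
    using common_drift by blast
  have "\<bar>\<omega> i t - g t - \<kappa> * (1 - decay t) * F i t\<bar> \<le> deviation t"
    "\<bar>\<omega> j t - g t - \<kappa> * (1 - decay t) * F j t\<bar> \<le> deviation t"
    using g i j post_layer(1)[OF t] by auto
  with deviation_le_xi[OF \<eta> t]
  have "\<omega> i t - \<omega> j t \<le> \<kappa> * (1 - decay t) * F i t - \<kappa> * (1 - decay t) * F j t + 2 * (\<kappa> * (1 - decay t) * \<xi>)"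
    by linarith
  then show ?thesis by (simp add: algebra_simps)
qed

lemma majority_nonempty:
  assumes "A \<subseteq> {1..N}" "lam * real N \<le> real (card A)" shows "finite A" "A \<noteq> {}"
proof -
  show "finite A" using assms(1) finite_subset by blast
  have "lam * real N > 0" using lam N by (intro mult_pos_pos) auto
  with assms(2) show "A \<noteq> {}" by auto
qed

text \<open>
  At the first time at which two members are \<open>l\<close> apart they are the two ends of the cluster. The
  restoring force between them then outweighs the error \<open>2 * \<xi>\<close>, so they approach each other, although
  their distance was smaller just before.
\<close>

lemma cluster_persists:
  fixes k :: "nat \<Rightarrow> int"
  assumes A: "A \<subseteq> {1..N}" "lam * real N \<le> real (card A)" and t0: "t0 \<ge> \<eta> * m"
    and start: "diam_on A (\<lambda>i. \<theta> i t0 - 2 * real_of_int (k i) * pi) < l" and t: "t \<ge> t0"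
  shows "diam_on A (\<lambda>i. \<theta> i t - 2 * real_of_int (k i) * pi) < l"
proof (rule ccontr)
  define \<psi> where "\<psi> = (\<lambda>i t. \<theta> i t - 2 * real_of_int (k i) * pi)"
  have fin: "finite A" "A \<noteq> {}" using majority_nonempty[OF A] by auto
  note lt_iff = diam_on_less_iff[OF fin]
  assume "\<not> ?thesis"
  then have "\<not> (\<forall>i\<in>A. \<forall>j\<in>A. \<psi> i t - \<psi> j t < l)" unfolding lt_iff \<psi>_def .
  then obtain i0 j0 where ij0: "i0 \<in> A" "j0 \<in> A" "\<psi> i0 t - \<psi> j0 t \<ge> l" by force
  have start': "\<psi> i t0 - \<psi> j t0 < l" if "i \<in> A" "j \<in> A" for i j
    using start that unfolding lt_iff \<psi>_def by blast
  have t0p: "t0 > 0" using post_layer(1)[OF t0] .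
  have cont: "continuous_on {t0..t} (\<lambda>s. \<psi> i s - \<psi> j s)" if "i \<in> A" "j \<in> A" for i j
    unfolding \<psi>_def using A(1) that t0p
    by (intro continuous_intros continuous_on_subset[OF continuous_theta]) auto
  define B where "B = (\<Union>(i, j)\<in>A \<times> A. {t0..t} \<inter> (\<lambda>s. \<psi> i s - \<psi> j s) -` {l..})"
  have "closed B" unfolding B_def using fin
    by (intro closed_UN) (auto intro!: continuous_closed_preimage cont)
  moreover have B: "t \<in> B" "bdd_below B" using ij0 t by (auto simp: B_def intro!: bdd_belowI[of _ t0])
  ultimately have "Inf B \<in> B" using closed_contains_Inf by blast
  define s where "s = Inf B"
  have "s \<in> B" using \<open>Inf B \<in> B\<close> by (simp add: s_def)
  then obtain i j where ij: "i \<in> A" "j \<in> A" "\<psi> i s - \<psi> j s \<ge> l" and s: "t0 \<le> s" "s \<le> t"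
    unfolding B_def by auto
  have "s \<noteq> t0" using start'[OF ij(1,2)] ij(3) by auto
  with s have s0: "t0 < s" by simp
  have before: "\<psi> i' u - \<psi> j' u < l" if "i' \<in> A" "j' \<in> A" "t0 \<le> u" "u < s" for i' j' u
  proof (rule ccontr)
    assume "\<not> ?thesis"
    then have "u \<in> B" using that s unfolding B_def by force
    then have "s \<le> u" unfolding s_def using B(2) by (rule cInf_lower)
    with that show False by simp
  qed
  have le: "\<psi> i' s - \<psi> j' s \<le> l" if "i' \<in> A" "j' \<in> A" for i' j'
  proof -
    have "((\<lambda>u. \<psi> i' u - \<psi> j' u) \<longlongrightarrow> \<psi> i' s - \<psi> j' s) (at s within {t0..t})"
      using cont[OF that] s by (auto simp: continuous_on_def)
    then have "((\<lambda>u. \<psi> i' u - \<psi> j' u) \<longlongrightarrow> \<psi> i' s - \<psi> j' s) (at s within {t0<..<s})"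
      by (rule tendsto_within_subset) (use s in auto)
    then show ?thesis
    proof (rule tendsto_upperbound)
      show "\<forall>\<^sub>F u in at s within {t0<..<s}. \<psi> i' u - \<psi> j' u \<le> l"
        unfolding eventually_at_filter using before[OF that] by (auto intro!: always_eventually simp: less_imp_le)
      show "at s within {t0<..<s} \<noteq> bot"
        using s0 by (simp add: at_within_eq_bot_iff)
    qed
  qed
  have d: "\<psi> i s - \<psi> j s = l" using le[OF ij(1,2)] ij(3) by simp
  have between: "\<psi> j s \<le> \<psi> k' s \<and> \<psi> k' s \<le> \<psi> i s" if "k' \<in> A" for k'
    using le[OF ij(1) that] le[OF that ij(2)] d by auto
  have "2 * restoring lam (\<psi> i s - \<psi> j s) \<le> coupling N (\<lambda>i. \<psi> i s) j - coupling N (\<lambda>i. \<psi> i s) i"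
    by (rule coupling_gap_of_majority[OF N A]) (use between d l in auto)
  then have gap: "2 * restoring lam l \<le> F j s - F i s"
    unfolding d by (simp only: \<psi>_def coupling_shift)
  have se: "s \<ge> \<eta> * m" using s t0 by simp
  have "\<omega> i s - \<omega> j s \<le> \<kappa> * (1 - decay s) * (2 * \<xi> - (F j s - F i s))"
    by (rule velocity_gap[OF se]) (use A(1) ij(1,2) in auto)
  also have "\<dots> < 0"
    using gap cluster_stability \<kappa> post_layer(3)[OF se] by (intro mult_pos_neg mult_pos_pos) auto
  finally have neg: "\<omega> i s - \<omega> j s < 0" .
  have "((\<lambda>u. \<psi> i u - \<psi> j u) has_real_derivative (\<omega> i s - 0) - (\<omega> j s - 0)) (at s)"
    unfolding \<psi>_def using A(1) ij s0 t0p by (intro DERIV_diff theta_derivative DERIV_const) auto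
  then have "((\<lambda>u. \<psi> i u - \<psi> j u) has_real_derivative \<omega> i s - \<omega> j s) (at s)" by simp
  from DERIV_neg_dec_left[OF this neg] obtain e where
    e: "e > 0" "\<And>h. h > 0 \<Longrightarrow> h < e \<Longrightarrow> \<psi> i s - \<psi> j s < \<psi> i (s - h) - \<psi> j (s - h)" by blast
  define h where "h = min (e / 2) (s - t0)"
  have h: "h > 0" "h < e" "s - h \<ge> t0" using e s0 by (auto simp: h_def min_def)
  show False using e(2)[OF h(1,2)] before[OF ij(1,2) h(3)] d h(1) by simp
qed

lemma majority_cluster_exists: "\<exists>A k. majority_cluster N lam l \<theta> A k"
proof -
  obtain T where T: "T \<ge> \<eta> * m" "R T > 0" "lam * real N \<le> real (card (aligned N l (\<lambda>j. \<theta> j T)))"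
    by (rule majority_aligned_at_some_time)
  let ?A = "aligned N l (\<lambda>j. \<theta> j T)"
  have A: "?A \<subseteq> {1..N}" by (auto simp: aligned_def)
  obtain k :: "nat \<Rightarrow> int" where k: "\<And>i j. i \<in> ?A \<Longrightarrow> j \<in> ?A \<Longrightarrow>
      (\<theta> i T - 2 * real_of_int (k i) * pi) - (\<theta> j T - 2 * real_of_int (k j) * pi) < l"
    using aligned_within_arc[OF l T(2)] by blast
  have "diam_on ?A (\<lambda>i. \<theta> i T - 2 * real_of_int (k i) * pi) < l"
    unfolding diam_on_less_iff[OF majority_nonempty[OF A T(3)]] using k by blast
  then have "\<forall>t\<ge>T. diam_on ?A (\<lambda>i. \<theta> i t - 2 * real_of_int (k i) * pi) < l"
    using cluster_persists[OF A T(3,1)] by blast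
  then show ?thesis unfolding majority_cluster_def using A T(3) post_layer(1)[OF T(1)] by blast
qed

end

section \<open>From bounded relative phases to phase-locking\<close>

lemma decreasing_bounded_converges:
  fixes f f' :: "real \<Rightarrow> real"
  assumes df: "\<And>t. t \<ge> T \<Longrightarrow> (f has_real_derivative f' t) (at t)"
    and neg: "\<And>t. t \<ge> T \<Longrightarrow> f' t \<le> 0" and bd: "\<And>t. t \<ge> T \<Longrightarrow> B \<le> f t"
  shows "\<exists>L. (f \<longlongrightarrow> L) at_top"
proof -
  have mono: "f t \<le> f s" if "T \<le> s" "s \<le> t" for s t
    by (rule DERIV_nonpos_imp_nonincreasing[OF that(2)], intro exI conjI, rule df, use that neg in auto)
  define L where "L = Inf (f ` {T..})"
  have bdd: "bdd_below (f ` {T..})" using bd by (auto intro!: bdd_belowI[of _ B])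
  have "(f \<longlongrightarrow> L) at_top"
  proof (rule order_tendstoI)
    fix a assume "a < L"
    have "a < f t" if "t \<ge> T" for t
    proof -
      have "L \<le> f t" unfolding L_def using bdd that by (intro cInf_lower) auto
      with \<open>a < L\<close> show ?thesis by simp
    qed
    then show "\<forall>\<^sub>F t in at_top. a < f t" unfolding eventually_at_top_linorder by blast
  next
    fix a assume "L < a"
    then obtain s where s: "s \<ge> T" "f s < a"
      unfolding L_def using cInf_less_iff[OF _ bdd] by auto
    have "f t < a" if "t \<ge> s" for t using mono[OF s(1) that] s(2) by simp
    then show "\<forall>\<^sub>F t in at_top. f t < a" unfolding eventually_at_top_linorder by blast
  qed
  then show ?thesis by blast
qed

lemma avoids_integers_imp_bounded:
  fixes f :: "real \<Rightarrow> real"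
  assumes cont: "continuous_on {T..} f" and avoid: "\<And>t n. t \<ge> T \<Longrightarrow> f t \<noteq> real_of_int n" and t: "t \<ge> T"
  shows "of_int \<lfloor>f T\<rfloor> < f t" "f t < of_int \<lfloor>f T\<rfloor> + 1"
proof -
  have c: "continuous_on {T..t} f" by (rule continuous_on_subset[OF cont]) auto
  have lo: "of_int \<lfloor>f T\<rfloor> \<le> f T" "f T \<le> of_int (\<lfloor>f T\<rfloor> + 1)" by linarith+
  show "of_int \<lfloor>f T\<rfloor> < f t"
  proof (rule ccontr)
    assume "\<not> ?thesis"
    then obtain s where "T \<le> s" "f s = of_int \<lfloor>f T\<rfloor>"
      using IVT2'[of f t "of_int \<lfloor>f T\<rfloor>" T] lo t c by auto
    with avoid show False by blast
  qed
  show "f t < of_int \<lfloor>f T\<rfloor> + 1"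
  proof (rule ccontr)
    assume "\<not> ?thesis"
    then obtain s where "T \<le> s" "f s = of_int (\<lfloor>f T\<rfloor> + 1)"
      using IVT'[of f T "of_int (\<lfloor>f T\<rfloor> + 1)" t] lo t c by auto
    with avoid show False by blast
  qed
qed

lemma frequent_value_eq_limit:
  fixes f :: "real \<Rightarrow> real"
  assumes "(f \<longlongrightarrow> l) at_top" "\<exists>\<^sub>F t in at_top. f t = y"
  shows "l = y"
  using assms tendsto_imp_eventually_ne[OF assms(1), of y] by (auto simp: frequently_def)

context inertial_kuramoto
begin

lemma velocity_bounded: "\<exists>K. \<forall>i\<in>{1..N}. \<forall>t\<ge>0. \<bar>\<omega> i t\<bar> \<le> K"
proof -
  have "\<bar>\<omega> i t\<bar> \<le> \<bar>\<omega>0 i\<bar> + \<bar>\<nu> i\<bar> + \<kappa>" if i: "i \<in> {1..N}" and t: "t \<ge> 0" for i t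
  proof (rule relaxation_bound[OF m continuous_omega[OF i] _ omega_derivative[OF i], where G' = "\<lambda>t. 0"])
    fix s :: real assume "s > 0"
    have "\<bar>F i s\<bar> \<le> 1"
      using abs_coupling_le_order_parameter order_parameter_le_1[OF N] order_trans by blast
    then have "\<bar>\<kappa> * F i s\<bar> \<le> \<kappa>" using \<kappa> by (simp add: abs_mult)
    moreover have eq: "m * ((\<nu> i + \<kappa> * F i s - \<omega> i s) / m) + \<omega> i s = \<nu> i + \<kappa> * F i s" using m by simp
    ultimately show "\<bar>m * ((\<nu> i + \<kappa> * F i s - \<omega> i s) / m) + \<omega> i s\<bar> \<le> m * 0 + (\<bar>\<omega>0 i\<bar> + \<bar>\<nu> i\<bar> + \<kappa>)"
      unfolding eq by linarith
  qed (use t \<kappa> initial_state(2)[OF i] in auto)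
  then have "\<bar>\<omega> i t\<bar> \<le> (\<Sum>j\<in>{1..N}. \<bar>\<omega>0 j\<bar> + \<bar>\<nu> j\<bar> + \<kappa>)" if i: "i \<in> {1..N}" and t: "t \<ge> 0" for i t
    using that member_le_sum[of i "{1..N}" "\<lambda>j. \<bar>\<omega>0 j\<bar> + \<bar>\<nu> j\<bar> + \<kappa>"] \<kappa> by fastforce
  then show ?thesis by blast
qed

abbreviation "\<nu>c \<equiv> mean N \<nu>"
abbreviation "acc i t \<equiv> (\<nu> i + \<kappa> * F i t - \<omega> i t) / m"

lemma acceleration_bounded: "\<exists>K. \<forall>i\<in>{1..N}. \<forall>t\<ge>0. \<bar>acc i t\<bar> \<le> K"
proof -
  obtain K where K: "\<And>i t. i \<in> {1..N} \<Longrightarrow> t \<ge> 0 \<Longrightarrow> \<bar>\<omega> i t\<bar> \<le> K" using velocity_bounded by blast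
  have "\<bar>acc i t\<bar> \<le> ((\<Sum>j\<in>{1..N}. \<bar>\<nu> j\<bar>) + \<kappa> + K) / m" if i: "i \<in> {1..N}" and t: "t \<ge> 0" for i t
  proof -
    have "\<bar>F i t\<bar> \<le> 1"
      using abs_coupling_le_order_parameter order_parameter_le_1[OF N] order_trans by blast
    then have "\<bar>\<kappa> * F i t\<bar> \<le> \<kappa>" using \<kappa> by (simp add: abs_mult)
    moreover have "\<bar>\<nu> i\<bar> \<le> (\<Sum>j\<in>{1..N}. \<bar>\<nu> j\<bar>)" using i by (intro member_le_sum) auto
    ultimately have "\<bar>\<nu> i + \<kappa> * F i t - \<omega> i t\<bar> \<le> (\<Sum>j\<in>{1..N}. \<bar>\<nu> j\<bar>) + \<kappa> + K"
      using K[OF i t] by linarith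
    then show ?thesis using m by (simp add: divide_right_mono)
  qed
  then show ?thesis by blast
qed

text \<open>
  The mechanical energy per oscillator in the frame of the mean frequency. The interaction potential,
  a double sum of cosines, is a multiple of the squared order parameter.
\<close>

definition energy :: "real \<Rightarrow> real" where
  "energy t = m / 2 * mean N (\<lambda>i. (\<omega> i t - \<nu>c)\<^sup>2) - mean N (\<lambda>i. (\<nu> i - \<nu>c) * \<theta> i t) - \<kappa> / 2 * (R t)\<^sup>2"

lemma mean_centred_frequency: "mean N (\<lambda>i. \<nu> i - \<nu>c) = 0"
  using N by (simp add: mean_diff mean_const)

lemma kinetic_derivative:
  assumes t: "t > 0"
  shows "((\<lambda>t. mean N (\<lambda>i. (\<omega> i t - \<nu>c)\<^sup>2)) has_real_derivative mean N (\<lambda>i. 2 * (\<omega> i t - \<nu>c) * acc i t)) (at t)"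
proof (rule has_real_derivative_mean)
  fix i assume i: "i \<in> {1..N}"
  show "((\<lambda>t. (\<omega> i t - \<nu>c)\<^sup>2) has_real_derivative 2 * (\<omega> i t - \<nu>c) * acc i t) (at t)"
    by (rule omega_derivative[OF i t] derivative_eq_intros refl)+ simp
qed

lemma energy_dissipation:
  assumes t: "t > 0"
  shows "(energy has_real_derivative - mean N (\<lambda>i. (\<omega> i t - \<nu>c)\<^sup>2)) (at t)"
proof -
  have d2: "((\<lambda>t. mean N (\<lambda>i. (\<nu> i - \<nu>c) * \<theta> i t)) has_real_derivative mean N (\<lambda>i. (\<nu> i - \<nu>c) * \<omega> i t)) (at t)"
    by (intro has_real_derivative_mean DERIV_cmult theta_derivative t)
  have "(energy has_real_derivative m / 2 * mean N (\<lambda>i. 2 * (\<omega> i t - \<nu>c) * acc i t)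
      - mean N (\<lambda>i. (\<nu> i - \<nu>c) * \<omega> i t) - \<kappa> / 2 * (2 * mean N (\<lambda>i. F i t * \<omega> i t))) (at t)"
    unfolding energy_def
    by (intro DERIV_diff DERIV_cmult kinetic_derivative d2 order_parameter_squared_derivative t)
  moreover have "m / 2 * mean N (\<lambda>i. 2 * (\<omega> i t - \<nu>c) * acc i t)
      - mean N (\<lambda>i. (\<nu> i - \<nu>c) * \<omega> i t) - \<kappa> / 2 * (2 * mean N (\<lambda>i. F i t * \<omega> i t))
     = mean N (\<lambda>i. m / 2 * (2 * (\<omega> i t - \<nu>c) * acc i t) - (\<nu> i - \<nu>c) * \<omega> i t - \<kappa> * (F i t * \<omega> i t))"
    by (simp only: mean_diff mean_cmult)
  moreover have "\<dots> = mean N (\<lambda>i. - 1 * (\<omega> i t - \<nu>c)\<^sup>2 + ((- \<nu>c) * (\<nu> i - \<nu>c) + (- \<nu>c * \<kappa>) * F i t))"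
  proof (rule mean_cong)
    fix i
    have "m / 2 * (2 * (\<omega> i t - \<nu>c) * acc i t) = (\<omega> i t - \<nu>c) * (\<nu> i + \<kappa> * F i t - \<omega> i t)"
      using m by simp
    then show "m / 2 * (2 * (\<omega> i t - \<nu>c) * acc i t) - (\<nu> i - \<nu>c) * \<omega> i t - \<kappa> * (F i t * \<omega> i t)
      = - 1 * (\<omega> i t - \<nu>c)\<^sup>2 + ((- \<nu>c) * (\<nu> i - \<nu>c) + (- \<nu>c * \<kappa>) * F i t)"
      by (simp add: algebra_simps power2_eq_square)
  qed
  moreover have "\<dots> = - mean N (\<lambda>i. (\<omega> i t - \<nu>c)\<^sup>2)"
    using mean_coupling[of N "\<lambda>j. \<theta> j t"] mean_centred_frequency
    by (simp only: mean_add mean_cmult)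
  ultimately show ?thesis by (simp only:)
qed

text \<open>
  The centred frequencies add up to zero, so the linear part of the energy involves relative phases
  only; if these are bounded, the energy is bounded below and converges. By \<open>barbalat\<close> its dissipation
  rate tends to zero.
\<close>

lemma velocity_synchronization:
  assumes bd: "\<And>i j t. i \<in> {1..N} \<Longrightarrow> j \<in> {1..N} \<Longrightarrow> t \<ge> T \<Longrightarrow> \<bar>\<theta> i t - \<theta> j t\<bar> \<le> M"
    and T: "T > 0" and i: "i \<in> {1..N}"
  shows "(\<omega> i \<longlongrightarrow> \<nu>c) at_top"
proof -
  have one: "1 \<in> {1..N}" using N by auto
  let ?K = "\<lambda>t. mean N (\<lambda>i. (\<omega> i t - \<nu>c)\<^sup>2)"
  have Kpos: "0 \<le> ?K t" for t unfolding mean_def by (intro mult_nonneg_nonneg sum_nonneg) auto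
  have lower: "- mean N (\<lambda>i. \<bar>\<nu> i - \<nu>c\<bar> * M) - \<kappa> / 2 \<le> energy t" if t: "t \<ge> T" for t
  proof -
    have "mean N (\<lambda>i. (\<nu> i - \<nu>c) * \<theta> i t) = mean N (\<lambda>i. (\<nu> i - \<nu>c) * \<theta> i t - \<theta> 1 t * (\<nu> i - \<nu>c))"
      using mean_centred_frequency by (simp only: mean_diff mean_cmult)
    also have "\<dots> \<le> mean N (\<lambda>i. \<bar>\<nu> i - \<nu>c\<bar> * M)"
    proof (rule mean_mono)
      fix i assume i: "i \<in> {1..N}"
      have "(\<nu> i - \<nu>c) * \<theta> i t - \<theta> 1 t * (\<nu> i - \<nu>c) = (\<nu> i - \<nu>c) * (\<theta> i t - \<theta> 1 t)" by (simp add: algebra_simps)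
      also have "\<dots> \<le> \<bar>(\<nu> i - \<nu>c) * (\<theta> i t - \<theta> 1 t)\<bar>" by simp
      also have "\<dots> \<le> \<bar>\<nu> i - \<nu>c\<bar> * M" unfolding abs_mult by (intro mult_left_mono bd i one t) simp
      finally show "(\<nu> i - \<nu>c) * \<theta> i t - \<theta> 1 t * (\<nu> i - \<nu>c) \<le> \<bar>\<nu> i - \<nu>c\<bar> * M" .
    qed
    moreover have "(R t)\<^sup>2 \<le> 1" using order_parameter_le_1[OF N] order_parameter_nonneg by (simp add: power_le_one)
    then have "\<kappa> / 2 * (R t)\<^sup>2 \<le> \<kappa> / 2 * 1" using \<kappa> by (intro mult_left_mono) auto
    moreover have "0 \<le> m / 2 * ?K t" using m Kpos[of t] by simp
    ultimately show ?thesis unfolding energy_def by linarith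
  qed
  have dE: "(energy has_real_derivative - ?K t) (at t)" if "t \<ge> T" for t
    by (rule energy_dissipation) (use that T in simp)
  obtain L where L: "(energy \<longlongrightarrow> L) at_top"
    using decreasing_bounded_converges[OF dE _ lower] Kpos by auto
  obtain V where V: "\<And>i t. i \<in> {1..N} \<Longrightarrow> t \<ge> 0 \<Longrightarrow> \<bar>\<omega> i t\<bar> \<le> V" using velocity_bounded by blast
  obtain A where A: "\<And>i t. i \<in> {1..N} \<Longrightarrow> t \<ge> 0 \<Longrightarrow> \<bar>acc i t\<bar> \<le> A" using acceleration_bounded by blast
  have "((\<lambda>t. - ?K t) \<longlongrightarrow> 0) at_top"
  proof (rule barbalat[OF dE _ _ L])
    fix t assume t: "t \<ge> T"
    show "((\<lambda>t. - ?K t) has_real_derivative - mean N (\<lambda>i. 2 * (\<omega> i t - \<nu>c) * acc i t)) (at t)"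
      by (intro DERIV_minus kinetic_derivative) (use t T in simp)
    have "\<bar>mean N (\<lambda>i. 2 * (\<omega> i t - \<nu>c) * acc i t)\<bar> \<le> 2 * (V + \<bar>\<nu>c\<bar>) * A"
    proof (rule mean_abs_le[OF N])
      fix i assume i: "i \<in> {1..N}"
      show "\<bar>2 * (\<omega> i t - \<nu>c) * acc i t\<bar> \<le> 2 * (V + \<bar>\<nu>c\<bar>) * A"
        unfolding abs_mult[of _ "acc i t"]
        by (intro mult_mono A i) (use V[OF i, of t] t T in auto)
    qed
    then show "\<bar>- mean N (\<lambda>i. 2 * (\<omega> i t - \<nu>c) * acc i t)\<bar> \<le> 2 * (V + \<bar>\<nu>c\<bar>) * A" by simp
  qed
  then have K: "(?K \<longlongrightarrow> 0) at_top" using tendsto_minus_cancel_left[of ?K 0 at_top] by simp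
  have "((\<lambda>t. (\<omega> i t - \<nu>c)\<^sup>2) \<longlongrightarrow> 0) at_top"
  proof (rule tendsto_sandwich[OF _ _ tendsto_const])
    show "((\<lambda>t. real N * ?K t) \<longlongrightarrow> 0) at_top" using tendsto_mult_left[OF K, of "real N"] by simp
    have "(\<omega> i t - \<nu>c)\<^sup>2 \<le> real N * ?K t" for t
      using member_le_sum[of i "{1..N}" "\<lambda>i. (\<omega> i t - \<nu>c)\<^sup>2"] i N by (simp add: mean_def)
    then show "\<forall>\<^sub>F t in at_top. (\<omega> i t - \<nu>c)\<^sup>2 \<le> real N * ?K t" by simp
  qed auto
  then have "((\<lambda>t. \<omega> i t - \<nu>c) \<longlongrightarrow> 0) at_top" by (simp add: power_tendsto_0_iff)
  then show ?thesis by (simp add: LIM_zero_iff)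
qed

text \<open>
  By \<open>barbalat\<close>, now applied to a velocity, the acceleration vanishes in the limit, and the equation of
  motion yields the limit of the force.
\<close>

lemma coupling_limit:
  assumes i: "i \<in> {1..N}" and lim: "(\<omega> i \<longlongrightarrow> \<nu>c) at_top"
  shows "(F i \<longlongrightarrow> - (\<nu> i - \<nu>c) / \<kappa>) at_top"
proof -
  obtain V where V: "\<And>i t. i \<in> {1..N} \<Longrightarrow> t \<ge> 0 \<Longrightarrow> \<bar>\<omega> i t\<bar> \<le> V" using velocity_bounded by blast
  obtain A where A: "\<And>i t. i \<in> {1..N} \<Longrightarrow> t \<ge> 0 \<Longrightarrow> \<bar>acc i t\<bar> \<le> A" using acceleration_bounded by blast
  let ?F' = "\<lambda>t. mean N (\<lambda>j. cos (\<theta> j t - \<theta> i t) * (\<omega> j t - \<omega> i t))"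
  have "(acc i \<longlongrightarrow> 0) at_top"
  proof (rule barbalat[OF _ _ _ lim, where T = 1])
    fix t :: real assume t: "1 \<le> t"
    then have t0: "t > 0" by simp
    show "(\<omega> i has_real_derivative acc i t) (at t)" by (rule omega_derivative[OF i t0])
    show "(acc i has_real_derivative (0 + \<kappa> * ?F' t - acc i t) / m) (at t)"
      by (intro DERIV_cdivide DERIV_diff DERIV_add DERIV_cmult DERIV_const coupling_derivative omega_derivative i t0)
    have "\<bar>?F' t\<bar> \<le> 2 * V"
    proof (rule mean_abs_le[OF N])
      fix j assume j: "j \<in> {1..N}"
      have "\<bar>cos (\<theta> j t - \<theta> i t) * (\<omega> j t - \<omega> i t)\<bar> \<le> 1 * \<bar>\<omega> j t - \<omega> i t\<bar>"
        unfolding abs_mult by (intro mult_right_mono) auto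
      also have "\<dots> \<le> 2 * V" using V[OF i, of t] V[OF j, of t] t0 by simp
      finally show "\<bar>cos (\<theta> j t - \<theta> i t) * (\<omega> j t - \<omega> i t)\<bar> \<le> 2 * V" .
    qed
    then have "\<bar>\<kappa> * ?F' t\<bar> \<le> \<kappa> * (2 * V)" using \<kappa> by (simp add: abs_mult)
    then have "\<bar>0 + \<kappa> * ?F' t - acc i t\<bar> \<le> \<kappa> * (2 * V) + A" using A[OF i, of t] t0 by linarith
    then show "\<bar>(0 + \<kappa> * ?F' t - acc i t) / m\<bar> \<le> (\<kappa> * (2 * V) + A) / m"
      unfolding abs_divide using m by (simp add: divide_right_mono)
  qed
  then have "((\<lambda>t. (m * acc i t + \<omega> i t - \<nu> i) / \<kappa>) \<longlongrightarrow> (m * 0 + \<nu>c - \<nu> i) / \<kappa>) at_top"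
    by (intro tendsto_intros lim) (use \<kappa> in auto)
  moreover have "(m * acc i t + \<omega> i t - \<nu> i) / \<kappa> = F i t" for t using m \<kappa> by simp
  ultimately show ?thesis by simp
qed

text \<open>
  Since \<open>(C i)\<^sup>2 = R\<^sup>2 - (F i)\<^sup>2\<close> and \<open>R\<^sup>2\<close> is the mean of the alignments \<open>C i\<close>, it is the mean of the numbers
  \<open>\<sigma> i * sqrt (R\<^sup>2 - (F i)\<^sup>2)\<close> for suitable signs \<open>\<sigma> i\<close>. If \<open>R\<^sup>2\<close> takes the value \<open>y\<close> at arbitrarily late times,
  one of the finitely many sign patterns recurs, and in the limit
  \<open>y\<close> is the mean of \<open>\<sigma> i * sqrt (y - (f i)\<^sup>2)\<close>. Only countably many \<open>y\<close> satisfy such an equation.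
\<close>

lemma order_parameter_converges:
  assumes lim: "\<And>i. i \<in> {1..N} \<Longrightarrow> (F i \<longlongrightarrow> f i) at_top"
  shows "\<exists>q. ((\<lambda>t. (R t)\<^sup>2) \<longlongrightarrow> q) at_top"
proof (rule convergent_if_recurrent_values_countable)
  define \<beta> where "\<beta> = Max ((\<lambda>i. (f i)\<^sup>2) ` {1..N})"
  have \<beta>: "(f i)\<^sup>2 \<le> \<beta>" if "i \<in> {1..N}" for i unfolding \<beta>_def using that by (intro Max_ge) auto
  define \<Sigma> where "\<Sigma> = PiE {1..N} (\<lambda>i. {- 1, 1 :: real})"
  have \<Sigma>: "finite \<Sigma>" unfolding \<Sigma>_def by (intro finite_PiE) auto
  \<comment> \<open>The branch point \<open>\<beta>\<close> itself lies outside the reach of the holomorphic argument and is added by hand.\<close>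
  define S where "S = insert \<beta> (\<Union>\<sigma>\<in>\<Sigma>. {y. \<beta> < y \<and> y = mean N (\<lambda>i. \<sigma> i * sqrt (y - (f i)\<^sup>2))})"
  show "continuous_on {0..} (\<lambda>t. (R t)\<^sup>2)" by (rule continuous_order_parameter_squared)
  show "\<bar>(R t)\<^sup>2\<bar> \<le> 1" for t
    using order_parameter_le_1[OF N] order_parameter_nonneg by (simp add: power_le_one)
  show "countable S"
  proof -
    have "countable {y. \<beta> < y \<and> y = mean N (\<lambda>i. \<sigma> i * sqrt (y - (f i)\<^sup>2))}" if \<sigma>: "\<sigma> \<in> \<Sigma>" for \<sigma>
    proof (rule countable_square_root_sum_zeros[OF N])
      fix i assume i: "i \<in> {1..N}"
      then have "\<sigma> i \<in> {- 1, 1}" using \<sigma> unfolding \<Sigma>_def by (rule PiE_mem[rotated])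
      then show "\<bar>\<sigma> i\<bar> \<le> 1" by auto
      show "0 \<le> (f i)\<^sup>2 \<and> (f i)\<^sup>2 \<le> \<beta>" using \<beta>[OF i] by simp
    qed
    then show ?thesis unfolding S_def using countable_finite[OF \<Sigma>] by (intro countable_insert countable_UN) auto
  qed
  fix y assume rec: "\<exists>\<^sub>F t in at_top. (R t)\<^sup>2 = y"
  have "(f i)\<^sup>2 \<le> y" if i: "i \<in> {1..N}" for i
  proof (rule ccontr)
    assume "\<not> ?thesis"
    moreover have "((\<lambda>t. (F i t)\<^sup>2) \<longlongrightarrow> (f i)\<^sup>2) at_top" by (intro tendsto_intros lim i)
    ultimately have "\<forall>\<^sub>F t in at_top. y < (F i t)\<^sup>2" by (intro order_tendstoD(1)) auto
    then have "\<forall>\<^sub>F t in at_top. (R t)\<^sup>2 \<noteq> y"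
    proof (rule eventually_mono)
      fix t assume "y < (F i t)\<^sup>2"
      moreover have "(F i t)\<^sup>2 \<le> (R t)\<^sup>2"
        using coupling_alignment_Pythagoras[of N "\<lambda>j. \<theta> j t" i] by (metis le_add_same_cancel1 zero_le_power2)
      ultimately show "(R t)\<^sup>2 \<noteq> y" by simp
    qed
    with rec show False unfolding frequently_def by simp
  qed
  then have "\<beta> \<le> y" unfolding \<beta>_def using index_nonempty by (subst Max_le_iff) auto
  have "\<exists>\<^sub>F t in at_top. \<exists>\<sigma>\<in>\<Sigma>. mean N (\<lambda>i. \<sigma> i * sqrt (y - (F i t)\<^sup>2)) = y"
  proof (rule frequently_elim1[OF rec])
    fix t assume y: "(R t)\<^sup>2 = y"
    define \<sigma> where "\<sigma> = restrict (\<lambda>i. if C i t \<ge> 0 then 1 else - 1 :: real) {1..N}"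
    have "\<sigma> \<in> \<Sigma>" unfolding \<sigma>_def \<Sigma>_def by auto
    moreover have "mean N (\<lambda>i. \<sigma> i * sqrt (y - (F i t)\<^sup>2)) = mean N (\<lambda>i. C i t)"
    proof (rule mean_cong)
      fix i assume i: "i \<in> {1..N}"
      have "y - (F i t)\<^sup>2 = (C i t)\<^sup>2"
        using coupling_alignment_Pythagoras[of N "\<lambda>j. \<theta> j t" i] y by simp
      then show "\<sigma> i * sqrt (y - (F i t)\<^sup>2) = C i t" using i by (simp add: \<sigma>_def)
    qed
    ultimately show "\<exists>\<sigma>\<in>\<Sigma>. mean N (\<lambda>i. \<sigma> i * sqrt (y - (F i t)\<^sup>2)) = y"
      using mean_alignment[of N "\<lambda>j. \<theta> j t"] y by auto
  qed
  then have "\<exists>\<sigma>\<in>\<Sigma>. \<exists>\<^sub>F t in at_top. mean N (\<lambda>i. \<sigma> i * sqrt (y - (F i t)\<^sup>2)) = y"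
    by (rule frequently_bex_finite[OF \<Sigma>])
  then obtain \<sigma> where \<sigma>: "\<sigma> \<in> \<Sigma>" "\<exists>\<^sub>F t in at_top. mean N (\<lambda>i. \<sigma> i * sqrt (y - (F i t)\<^sup>2)) = y"
    by blast
  have "((\<lambda>t. mean N (\<lambda>i. \<sigma> i * sqrt (y - (F i t)\<^sup>2))) \<longlongrightarrow> mean N (\<lambda>i. \<sigma> i * sqrt (y - (f i)\<^sup>2))) at_top"
    by (intro tendsto_intros lim)
  then have "mean N (\<lambda>i. \<sigma> i * sqrt (y - (f i)\<^sup>2)) = y"
    using \<sigma>(2) by (rule frequent_value_eq_limit)
  then have eq: "y = mean N (\<lambda>i. \<sigma> i * sqrt (y - (f i)\<^sup>2))" by (rule sym)
  show "y \<in> S"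
  proof (cases "y = \<beta>")
    case False
    then have "\<beta> < y" using \<open>\<beta> \<le> y\<close> by simp
    with eq show ?thesis unfolding S_def by (intro insertI2 UN_I[OF \<sigma>(1)] CollectI conjI)
  qed (simp add: S_def)
qed

text \<open>
  Its square converges, so the alignment has at most two recurrent values.
\<close>

lemma alignment_converges:
  assumes i: "i \<in> {1..N}" and lim: "(F i \<longlongrightarrow> f) at_top" and Q: "((\<lambda>t. (R t)\<^sup>2) \<longlongrightarrow> q) at_top"
  shows "\<exists>c. (C i \<longlongrightarrow> c) at_top"
proof (rule convergent_if_recurrent_values_countable[OF continuous_alignment[OF i]])
  have sq: "(C i t)\<^sup>2 = (R t)\<^sup>2 - (F i t)\<^sup>2" for t
    using coupling_alignment_Pythagoras[of N "\<lambda>j. \<theta> j t" i] by simp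
  show "\<bar>C i t\<bar> \<le> 1" for t unfolding alignment_def by (intro mean_abs_le N) auto
  show "countable {sqrt (q - f\<^sup>2), - sqrt (q - f\<^sup>2)}" by simp
  fix y assume "\<exists>\<^sub>F t in at_top. C i t = y"
  then have "\<exists>\<^sub>F t in at_top. (C i t)\<^sup>2 = y\<^sup>2" by (rule frequently_elim1) simp
  moreover have "((\<lambda>t. (C i t)\<^sup>2) \<longlongrightarrow> q - f\<^sup>2) at_top" unfolding sq by (intro tendsto_intros lim Q)
  ultimately have "q - f\<^sup>2 = y\<^sup>2" by (intro frequent_value_eq_limit)
  then show "y \<in> {sqrt (q - f\<^sup>2), - sqrt (q - f\<^sup>2)}" by (cases "y \<ge> 0") auto
qed

text \<open>
  Forces, alignments and order parameter determine the cosine of a phase difference, which therefore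
  converges as long as the order parameter stays away from zero. The recurrent values of the phase
  difference then share one cosine.
\<close>

lemma phase_difference_converges:
  assumes i: "i \<in> {1..N}" and j: "j \<in> {1..N}"
    and lim: "\<And>i. i \<in> {1..N} \<Longrightarrow> (F i \<longlongrightarrow> f i) at_top"
    and bd: "\<And>t. t \<ge> T \<Longrightarrow> \<bar>\<theta> i t - \<theta> j t\<bar> \<le> M" and T: "T > 0"
    and R: "\<And>t. t \<ge> T \<Longrightarrow> R t \<ge> \<rho>" and \<rho>: "\<rho> > 0"
  shows "\<exists>d. ((\<lambda>t. \<theta> i t - \<theta> j t) \<longlongrightarrow> d) at_top"
proof -
  obtain q where q: "((\<lambda>t. (R t)\<^sup>2) \<longlongrightarrow> q) at_top" using order_parameter_converges[of f] lim by blast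
  have "\<rho>\<^sup>2 \<le> q"
  proof (rule tendsto_lowerbound[OF q])
    show "\<forall>\<^sub>F t in at_top. \<rho>\<^sup>2 \<le> (R t)\<^sup>2"
      unfolding eventually_at_top_linorder using R \<rho> by (intro exI[of _ T]) (auto intro!: power_mono)
  qed simp
  moreover have "0 < \<rho>\<^sup>2" using \<rho> by simp
  ultimately have q0: "q \<noteq> 0" by linarith
  obtain ci cj where c: "(C i \<longlongrightarrow> ci) at_top" "(C j \<longlongrightarrow> cj) at_top"
    using alignment_converges[OF i lim[OF i] q] alignment_converges[OF j lim[OF j] q] by blast
  have "((\<lambda>t. (C i t * C j t + F i t * F j t) / (R t)\<^sup>2) \<longlongrightarrow> (ci * cj + f i * f j) / q) at_top"
    by (intro tendsto_intros c lim i j q q0)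
  moreover have "\<forall>\<^sub>F t in at_top. (C i t * C j t + F i t * F j t) / (R t)\<^sup>2 = cos (\<theta> i t - \<theta> j t)"
    unfolding eventually_at_top_linorder
  proof (intro exI[of _ T] allI impI)
    fix t assume "t \<ge> T"
    then have "R t > 0" using R[of t] \<rho> by linarith
    then show "(C i t * C j t + F i t * F j t) / (R t)\<^sup>2 = cos (\<theta> i t - \<theta> j t)"
      unfolding alignment_product by simp
  qed
  ultimately have cosl: "((\<lambda>t. cos (\<theta> i t - \<theta> j t)) \<longlongrightarrow> (ci * cj + f i * f j) / q) at_top"
    by (rule Lim_transform_eventually)
  show ?thesis
  proof (rule convergent_if_recurrent_values_countable)
    show "continuous_on {T..} (\<lambda>t. \<theta> i t - \<theta> j t)"
      by (intro continuous_intros continuous_on_subset[OF continuous_theta] i j) (use T in auto)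
    show "\<bar>\<theta> i t - \<theta> j t\<bar> \<le> M" if "t \<ge> T" for t by (rule bd[OF that])
    show "countable {y. cos y = (ci * cj + f i * f j) / q}" by (rule countable_cos_eq)
    fix y assume "\<exists>\<^sub>F t in at_top. \<theta> i t - \<theta> j t = y"
    then have "\<exists>\<^sub>F t in at_top. cos (\<theta> i t - \<theta> j t) = cos y" by (rule frequently_elim1) simp
    with cosl have "(ci * cj + f i * f j) / q = cos y" by (rule frequent_value_eq_limit)
    then show "y \<in> {y. cos y = (ci * cj + f i * f j) / q}" by simp
  qed
qed

text \<open>
  The coupling cancels in the mean, and \<open>mean \<theta> + m * mean \<omega> - \<nu>c * t\<close> is conserved.
\<close>

lemma mean_phase_converges:
  assumes lim: "\<And>i. i \<in> {1..N} \<Longrightarrow> (\<omega> i \<longlongrightarrow> \<nu>c) at_top"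
  shows "\<exists>c. ((\<lambda>t. mean N (\<lambda>i. \<theta> i t) - \<nu>c * t) \<longlongrightarrow> c) at_top"
proof -
  let ?g = "\<lambda>t. mean N (\<lambda>i. \<theta> i t) + m * mean N (\<lambda>i. \<omega> i t) - \<nu>c * t"
  have dg: "(?g has_real_derivative 0) (at t)" if t: "t > 0" for t
  proof -
    have "(?g has_real_derivative mean N (\<lambda>i. \<omega> i t) + m * mean N (\<lambda>i. acc i t) - \<nu>c * 1) (at t)"
      by (intro DERIV_diff DERIV_add DERIV_cmult has_real_derivative_mean theta_derivative omega_derivative DERIV_ident t)
    moreover have "mean N (\<lambda>i. \<omega> i t) + m * mean N (\<lambda>i. acc i t) = mean N (\<lambda>i. \<nu> i + \<kappa> * F i t)"
      unfolding mean_cmult[symmetric] mean_add[symmetric] using m by simp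
    moreover have "\<dots> = \<nu>c" using mean_coupling[of N "\<lambda>j. \<theta> j t"] by (simp only: mean_add mean_cmult)
    ultimately show ?thesis by simp
  qed
  have const: "?g t = ?g 1" if "t \<ge> 1" for t
  proof (cases "t = 1")
    case False
    then have "t > 1" using that by simp
    have "\<exists>z>1. z < t \<and> ?g t - ?g 1 = (t - 1) * 0"
      by (rule MVT2[OF \<open>t > 1\<close>]) (rule dg, simp)
    then have "?g t = ?g 1" by auto
    then show ?thesis .
  qed simp
  have "((\<lambda>t. ?g 1 - m * mean N (\<lambda>i. \<omega> i t)) \<longlongrightarrow> ?g 1 - m * mean N (\<lambda>i. \<nu>c)) at_top"
    by (intro tendsto_intros lim)
  moreover have "\<forall>\<^sub>F t in at_top. ?g 1 - m * mean N (\<lambda>i. \<omega> i t) = mean N (\<lambda>i. \<theta> i t) - \<nu>c * t"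
    unfolding eventually_at_top_linorder using const by (intro exI[of _ 1]) (simp add: algebra_simps)
  ultimately have "((\<lambda>t. mean N (\<lambda>i. \<theta> i t) - \<nu>c * t) \<longlongrightarrow> ?g 1 - m * mean N (\<lambda>i. \<nu>c)) at_top"
    by (rule Lim_transform_eventually)
  then show ?thesis by blast
qed

lemma phase_locking_if_coherent_and_bounded:
  assumes bd: "\<And>i j t. i \<in> {1..N} \<Longrightarrow> j \<in> {1..N} \<Longrightarrow> t \<ge> T \<Longrightarrow> \<bar>\<theta> i t - \<theta> j t\<bar> \<le> M"
    and T: "T > 0" and R: "\<And>t. t \<ge> T \<Longrightarrow> R t \<ge> \<rho>" and \<rho>: "\<rho> > 0"
  shows "\<exists>p. \<forall>i\<in>{1..N}. ((\<lambda>t. \<theta> i t - \<nu>c * t) \<longlongrightarrow> p i) at_top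
    \<and> (\<omega> i \<longlongrightarrow> \<nu>c) at_top \<and> coupling N p i = - (\<nu> i - \<nu>c) / \<kappa>"
proof -
  have sync: "(\<omega> i \<longlongrightarrow> \<nu>c) at_top" if "i \<in> {1..N}" for i
    using velocity_synchronization[OF bd T that] .
  note Flim = coupling_limit[OF _ sync]
  have "\<exists>d. ((\<lambda>t. \<theta> i t - \<theta> j t) \<longlongrightarrow> d) at_top" if i: "i \<in> {1..N}" and j: "j \<in> {1..N}" for i j
    by (rule phase_difference_converges[OF i j _ bd[OF i j] T R \<rho>, where f = "\<lambda>i. - (\<nu> i - \<nu>c) / \<kappa>"])
       (rule Flim)
  then obtain d where d: "\<And>i j. i \<in> {1..N} \<Longrightarrow> j \<in> {1..N} \<Longrightarrow> ((\<lambda>t. \<theta> i t - \<theta> j t) \<longlongrightarrow> d i j) at_top"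
    by metis
  obtain c where c: "((\<lambda>t. mean N (\<lambda>i. \<theta> i t) - \<nu>c * t) \<longlongrightarrow> c) at_top"
    using mean_phase_converges[OF sync] by blast
  define p where "p i = c + mean N (d i)" for i
  have p: "((\<lambda>t. \<theta> i t - \<nu>c * t) \<longlongrightarrow> p i) at_top" if i: "i \<in> {1..N}" for i
  proof -
    have "((\<lambda>t. (mean N (\<lambda>i. \<theta> i t) - \<nu>c * t) + mean N (\<lambda>j. \<theta> i t - \<theta> j t)) \<longlongrightarrow> p i) at_top"
      unfolding p_def by (intro tendsto_intros c d i)
    then show ?thesis using N by (simp add: mean_diff mean_const)
  qed
  have "coupling N p i = - (\<nu> i - \<nu>c) / \<kappa>" if i: "i \<in> {1..N}" for i
  proof -
    have "((\<lambda>t. mean N (\<lambda>j. sin ((\<theta> j t - \<nu>c * t) - (\<theta> i t - \<nu>c * t)))) \<longlongrightarrow> coupling N p i) at_top"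
      unfolding coupling_def by (intro tendsto_intros p i)
    then have "(F i \<longlongrightarrow> coupling N p i) at_top" by (simp add: coupling_def)
    then show ?thesis using Flim[OF i i] tendsto_unique[OF trivial_limit_at_top_linorder] by blast
  qed
  with p sync show ?thesis by (intro exI[of _ p] ballI conjI)
qed

end

section \<open>The restoring force as a function of the arc length\<close>

lemma restoring_expand: "restoring lam d = (lam * sin d - 2 * (1 - lam) * sin (d / 2)) / 2"
  using sin_double[of "d / 2"] by (simp add: restoring_def algebra_simps)

lemma restoring_antimono:
  assumes "pi / 2 \<le> x" "x \<le> y" "y \<le> pi" "0 \<le> lam" "lam \<le> 1"
  shows "restoring lam y \<le> restoring lam x"
proof -
  have "sin (pi - y) \<le> sin (pi - x)" using assms by (intro sin_monotone_2pi_le) auto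
  then have "lam * sin y \<le> lam * sin x" using assms by (intro mult_left_mono) auto
  moreover have "sin (x / 2) \<le> sin (y / 2)" using assms by (intro sin_monotone_2pi_le) auto
  then have "2 * (1 - lam) * sin (x / 2) \<le> 2 * (1 - lam) * sin (y / 2)" using assms by (intro mult_left_mono) auto
  ultimately show ?thesis unfolding restoring_expand by simp
qed

text \<open>
  Concavity is what localises cluster diameters: the equilibrium condition bounds \<open>restoring lam\<close> at the
  diameter from above, and a concave function that exceeds a value at both ends of an interval
  exceeds it inside as well.
\<close>

lemma restoring_concave:
  assumes b: "0 \<le> b" "b \<le> pi" and lam: "0 \<le> lam" and c: "(1 - lam) / 4 \<le> lam * cos (b / 2)"
  shows "convex_on {0..b} (\<lambda>d. - restoring lam d)"
proof (rule f''_ge0_imp_convex[where f' = "\<lambda>d. - (lam * cos d - (1 - lam) * cos (d / 2)) / 2"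
      and f'' = "\<lambda>d. (lam * sin d - (1 - lam) / 2 * sin (d / 2)) / 2"])
  fix d assume d: "d \<in> {0..b}"
  show "((\<lambda>d. - restoring lam d) has_real_derivative - (lam * cos d - (1 - lam) * cos (d / 2)) / 2) (at d)"
    unfolding restoring_expand by (auto intro!: derivative_eq_intros simp: field_simps)
  show "((\<lambda>d. - (lam * cos d - (1 - lam) * cos (d / 2)) / 2) has_real_derivative
      (lam * sin d - (1 - lam) / 2 * sin (d / 2)) / 2) (at d)"
    by (auto intro!: derivative_eq_intros simp: field_simps)
  have "cos (b / 2) \<le> cos (d / 2)" using d b by (intro cos_monotone_0_pi_le) auto
  then have "lam * cos (b / 2) \<le> lam * cos (d / 2)" using lam by (intro mult_left_mono)
  then have "0 \<le> sin (d / 2) * (2 * (lam * cos (d / 2)) - (1 - lam) / 2)"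
    using c d b by (intro mult_nonneg_nonneg sin_ge_zero) auto
  also have "\<dots> = lam * sin d - (1 - lam) / 2 * sin (d / 2)"
    using sin_double[of "d / 2"] by (simp add: algebra_simps)
  finally show "0 \<le> (lam * sin d - (1 - lam) / 2 * sin (d / 2)) / 2" by simp
qed simp

lemma restoring_chord:
  assumes "convex_on {0..b} (\<lambda>d. - restoring lam d)" and "0 \<le> x" "x < y" "y \<le> b" "x \<le> z" "z \<le> y"
  shows "(1 - (z - x) / (y - x)) * restoring lam x + (z - x) / (y - x) * restoring lam y \<le> restoring lam z"
proof -
  define s where "s = (z - x) / (y - x)"
  have s: "0 \<le> s" "s \<le> 1" using assms by (auto simp: s_def)
  have "(1 - s) * x + s * y = x + s * (y - x)" by (simp add: algebra_simps)
  also have "s * (y - x) = z - x" using assms by (simp add: s_def)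
  finally have "(1 - s) *\<^sub>R x + s *\<^sub>R y = z" by simp
  with convex_onD[OF assms(1) s, of x y] assms show ?thesis unfolding s_def[symmetric] by simp
qed

text \<open>
  Inside an arc shorter than this a majority \<open>lam\<close> outweighs all others at each of its members:
  \<open>lam * cos d > 1 - lam\<close>.
\<close>

definition critical_arc :: "real \<Rightarrow> real" where
  "critical_arc lam = arccos ((1 - lam) / lam)"

text \<open>
  The frequency spread, relative to the coupling, that a majority spread over the critical arc can
  just balance; \<open>critical_arc(4)\<close> below is this identity.
\<close>

definition critical_strength :: "real \<Rightarrow> real" where
  "critical_strength lam = (2 * lam - 1) powr (3 / 2) / sqrt (2 * lam) * ((2 - lam) / (sqrt (lam / 2) + (1 - lam)))"

text \<open>
  By the half-angle formula the critical arc \<open>d\<close> satisfies \<open>cos (d / 2) = 1 / sqrt (2 * lam)\<close>, so that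
  \<open>lam * cos (d / 2) = sqrt (lam / 2)\<close>. Rationalising \<open>sqrt (lam / 2) - (1 - lam)\<close> produces the remaining
  factors of \<open>critical_strength\<close>.
\<close>

lemma critical_arc:
  assumes lam: "1 / 2 < lam" "lam \<le> 1"
  shows "0 < critical_arc lam" "critical_arc lam \<le> pi / 2" "lam * cos (critical_arc lam) = 1 - lam"
    "critical_strength lam = 2 * restoring lam (critical_arc lam)"
    "(1 - lam) / 4 \<le> lam * cos (critical_arc lam / 2)"
    "0 < critical_strength lam"
proof -
  let ?q = "(1 - lam) / lam" and ?d = "critical_arc lam"
  have q: "0 \<le> ?q" "?q < 1" using lam by (auto simp: field_simps)
  show d0: "0 < ?d" unfolding critical_arc_def using arccos_less_arccos[of ?q 1] q by simp
  show d1: "?d \<le> pi / 2" unfolding critical_arc_def using arccos_le_arccos[of 0 ?q] q by simp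
  have cd: "cos ?d = ?q" unfolding critical_arc_def using q by (intro cos_arccos) auto
  then show "lam * cos ?d = 1 - lam" using lam by simp
  have c0: "0 \<le> cos (?d / 2)" "0 \<le> sin (?d / 2)" using d0 d1 by (auto intro!: cos_ge_zero sin_ge_zero)
  have "cos ?d = 2 * (cos (?d / 2))\<^sup>2 - 1" using cos_double_cos[of "?d / 2"] by simp
  then have "(cos (?d / 2))\<^sup>2 = 1 / (2 * lam)" using cd lam by (simp add: field_simps)
  then have c: "cos (?d / 2) = 1 / sqrt (2 * lam)" using c0(1) by (metis real_sqrt_divide real_sqrt_one real_sqrt_unique)
  have "(sin (?d / 2))\<^sup>2 = (2 * lam - 1) / (2 * lam)"
    unfolding sin_squared_eq \<open>(cos (?d / 2))\<^sup>2 = 1 / (2 * lam)\<close> using lam by (simp add: field_simps)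
  then have s: "sin (?d / 2) = sqrt (2 * lam - 1) / sqrt (2 * lam)"
    using c0(2) by (metis real_sqrt_divide real_sqrt_unique)
  have lc: "lam * cos (?d / 2) = sqrt (lam / 2)"
  proof (rule real_sqrt_unique[symmetric])
    show "(lam * cos (?d / 2))\<^sup>2 = lam / 2"
      unfolding power_mult_distrib \<open>(cos (?d / 2))\<^sup>2 = 1 / (2 * lam)\<close>
      using lam by (simp add: power2_eq_square)
    show "0 \<le> lam * cos (?d / 2)" using c0 lam by simp
  qed
  have half: "1 / 2 \<le> sqrt (lam / 2)" using lam by (intro real_le_rsqrt) (simp add: power2_eq_square)
  show "(1 - lam) / 4 \<le> lam * cos (?d / 2)" unfolding lc by (rule order.trans[OF _ half]) (use lam in simp)
  have pos: "0 < sqrt (lam / 2) + (1 - lam)" using lam by (intro add_pos_nonneg) auto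
  have sq: "sqrt (lam / 2) * sqrt (lam / 2) = lam / 2" using lam by simp
  have "(sqrt (lam / 2) - (1 - lam)) * (sqrt (lam / 2) + (1 - lam)) = sqrt (lam / 2) * sqrt (lam / 2) - (1 - lam) * (1 - lam)"
    by (simp add: algebra_simps)
  also have "\<dots> = (2 * lam - 1) * (2 - lam) / 2" unfolding sq by (simp add: field_simps)
  finally have "sqrt (lam / 2) - (1 - lam) = (2 * lam - 1) * (2 - lam) / 2 / (sqrt (lam / 2) + (1 - lam))"
    using pos by (simp only: eq_divide_eq) simp
  then have r: "2 * restoring lam ?d = 2 * (sqrt (2 * lam - 1) / sqrt (2 * lam) * ((2 * lam - 1) * (2 - lam) / 2 / (sqrt (lam / 2) + (1 - lam))))"
    by (simp only: restoring_def lc s)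
  have "(2 * lam - 1) powr (3 / 2) = (2 * lam - 1) powr (1 + 1 / 2)" by simp
  also have "\<dots> = (2 * lam - 1) * sqrt (2 * lam - 1)" using lam by (subst powr_add) (simp add: powr_half_sqrt)
  finally have p: "(2 * lam - 1) powr (3 / 2) = (2 * lam - 1) * sqrt (2 * lam - 1)" .
  show "critical_strength lam = 2 * restoring lam ?d"
  proof -
    have "2 * (a / b * (c * d / 2 / e)) = c * a / b * (d / e)" for a b c d e :: real by simp
    then show ?thesis unfolding r critical_strength_def p by (rule sym)
  qed
  show "0 < critical_strength lam"
    unfolding critical_strength_def p using lam pos by (intro mult_pos_pos divide_pos_pos) auto
qed

text \<open>
  The mean value theorem for \<open>y \<mapsto> mean N (\<lambda>k. sin (y - x k))\<close>: as long as \<open>y\<close> stays between members of a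
  cluster of diameter \<open>D\<close>, its slope is governed by the majority.
\<close>

lemma coupling_gap_linear:
  assumes N: "N \<ge> 1" and A: "A \<subseteq> {1..N}" "lam * real N \<le> real (card A)" and ij: "i \<in> A" "j \<in> A"
    and D: "D \<le> pi" "\<forall>k\<in>A. \<forall>l\<in>A. x k - x l \<le> D" and less: "x j < x i"
  obtains s where "lam * cos D - (1 - lam) \<le> s" "s \<le> 1" "coupling N x j - coupling N x i = (x i - x j) * s"
proof -
  let ?S = "\<lambda>y. mean N (\<lambda>k. sin (x k - y))"
  have "((\<lambda>y. - ?S y) has_real_derivative mean N (\<lambda>k. cos (x k - y))) (at y)" for y
  proof -
    have "(?S has_real_derivative mean N (\<lambda>k. - 1 * cos (x k - y))) (at y)"
      by (rule has_real_derivative_mean) (auto intro!: derivative_eq_intros)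
    from DERIV_minus[OF this] show ?thesis by (simp only: mean_cmult) simp
  qed
  then obtain y where y: "x j < y" "y < x i" "- ?S (x i) - - ?S (x j) = (x i - x j) * mean N (\<lambda>k. cos (x k - y))"
    using MVT2[OF less, of "\<lambda>y. - ?S y" "\<lambda>y. mean N (\<lambda>k. cos (x k - y))"] by blast
  have "lam * cos D - (1 - lam) \<le> mean N (\<lambda>k. cos (x k - y))"
  proof (rule mean_ge_of_majority[OF A N])
    fix k assume k: "k \<in> A"
    have "x k - x j \<le> D" "x i - x k \<le> D" using D(2) k ij by auto
    then have "\<bar>x k - y\<bar> \<le> D" using y by linarith
    then have "cos D \<le> cos \<bar>x k - y\<bar>" using D(1) by (intro cos_monotone_0_pi_le) auto
    then show "cos D \<le> cos (x k - y)" by simp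
  qed auto
  moreover have "mean N (\<lambda>k. cos (x k - y)) \<le> 1"
    using mean_mono[of N "\<lambda>k. cos (x k - y)" "\<lambda>k. 1"] N by (simp add: mean_const)
  moreover have "coupling N x j - coupling N x i = (x i - x j) * mean N (\<lambda>k. cos (x k - y))"
    using y(3) by (simp add: coupling_def)
  ultimately show ?thesis by (rule that)
qed

section \<open>Phase-locking in the clustering regime\<close>

context clustering_regime
begin

lemma alignment_margin_pos: "lam * cos (l / 2) - (1 - lam) > 0"
proof -
  have "0 < sin (l / 2)" using l by (intro sin_gt_zero) auto
  moreover have "0 < sin (l / 2) * (lam * cos (l / 2) - (1 - lam))"
    using cluster_stability xi_pos unfolding restoring_def by linarith
  ultimately show ?thesis by (simp add: zero_less_mult_iff)
qed

lemma majority_cluster_late: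
  assumes "majority_cluster N lam l \<theta> A k"
  shows "A \<subseteq> {1..N}" "lam * real N \<le> real (card A)"
    "\<exists>T\<ge>\<eta> * m. \<forall>t\<ge>T. diam_on A (\<lambda>i. \<theta> i t - 2 * real_of_int (k i) * pi) < l"
proof -
  show "A \<subseteq> {1..N}" "lam * real N \<le> real (card A)" using assms by (auto simp: majority_cluster_def)
  obtain T where "\<forall>t\<ge>T. diam_on A (\<lambda>i. \<theta> i t - 2 * real_of_int (k i) * pi) < l"
    using assms by (auto simp: majority_cluster_def)
  then show "\<exists>T\<ge>\<eta> * m. \<forall>t\<ge>T. diam_on A (\<lambda>i. \<theta> i t - 2 * real_of_int (k i) * pi) < l"
    by (intro exI[of _ "max T (\<eta> * m)"]) auto
qed

lemma order_parameter_ge_margin: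
  assumes A: "A \<subseteq> {1..N}" "lam * real N \<le> real (card A)"
    and D: "diam_on A (\<lambda>i. \<theta> i t - 2 * real_of_int (k i) * pi) < l"
  shows "R t \<ge> lam * cos (l / 2) - (1 - lam)"
proof -
  let ?\<psi> = "\<lambda>i. \<theta> i t - 2 * real_of_int (k i) * pi"
  obtain c where c: "\<And>i. i \<in> A \<Longrightarrow> \<bar>?\<psi> i - c\<bar> \<le> diam_on A ?\<psi> / 2"
    using diam_on_midpoint[OF majority_nonempty[OF A], of ?\<psi>] by blast
  have "lam * cos (l / 2) - (1 - lam) \<le> mean N (\<lambda>i. cos (\<theta> i t - c))"
  proof (rule mean_ge_of_majority[OF A N])
    fix i assume i: "i \<in> A"
    have "cos (l / 2) \<le> cos \<bar>?\<psi> i - c\<bar>"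
      using c[OF i] D l by (intro cos_monotone_0_pi_le) auto
    then show "cos (l / 2) \<le> cos (\<theta> i t - c)" by (simp add: cos_shift)
  qed auto
  also have "\<dots> \<le> R t" by (rule mean_cos_ge_order_parameter)
  finally show ?thesis .
qed

text \<open>
  Either the phase of \<open>j\<close> meets that of the member \<open>a\<close> modulo \<open>2 * pi\<close> at some late time. Then \<open>j\<close> can be
  added to the cluster without enlarging its diameter, and the enlarged cluster persists. Or it never
  does, and then continuity confines it between two consecutive copies of the phase of \<open>a\<close>.
\<close>

lemma relative_phase_bounded:
  assumes A: "A \<subseteq> {1..N}" "lam * real N \<le> real (card A)" and T: "T \<ge> \<eta> * m"
    and cl: "\<And>t. t \<ge> T \<Longrightarrow> diam_on A (\<lambda>i. \<theta> i t - 2 * real_of_int (k i) * pi) < l"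
    and a: "a \<in> A" and j: "j \<in> {1..N}"
  shows "\<exists>M T'. \<forall>t\<ge>T'. \<bar>\<theta> j t - \<theta> a t\<bar> \<le> M"
proof -
  have member: ?thesis if B: "B \<subseteq> {1..N}" "lam * real N \<le> real (card B)" "a \<in> B" "j \<in> B" and t1: "t1 \<ge> \<eta> * m"
    and d: "diam_on B (\<lambda>i. \<theta> i t1 - 2 * real_of_int (k' i) * pi) < l" for B t1 and k' :: "nat \<Rightarrow> int"
  proof -
    note fin = majority_nonempty[OF B(1,2)]
    have "\<bar>\<theta> j t - \<theta> a t\<bar> \<le> l + \<bar>2 * real_of_int (k' j) * pi - 2 * real_of_int (k' a) * pi\<bar>" if "t \<ge> t1" for t
      using cluster_persists[OF B(1,2) t1 d that] diam_on_upper[OF fin(1) B(4,3), of "\<lambda>i. \<theta> i t - 2 * real_of_int (k' i) * pi"]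
      by linarith
    then show ?thesis by blast
  qed
  show ?thesis
  proof (cases "j \<in> A")
    case True
    with member[OF A a _ T cl[OF order_refl]] show ?thesis .
  next
    case nA: False
    let ?f = "\<lambda>t. (\<theta> j t - (\<theta> a t - 2 * real_of_int (k a) * pi)) / (2 * pi)"
    have Tpos: "T > 0" using post_layer(1)[OF T] .
    show ?thesis
    proof (cases "\<exists>t\<ge>T. \<exists>n. ?f t = real_of_int n")
      case True
      then obtain t n where t: "t \<ge> T" and "?f t = real_of_int n" by blast
      then have n: "\<theta> j t - 2 * real_of_int n * pi = \<theta> a t - 2 * real_of_int (k a) * pi"
        by (simp add: field_simps)
      let ?B = "insert j A" and ?k = "k(j := n)"
      have fin: "finite A" "A \<noteq> {}" using majority_nonempty[OF A] by auto
      have "card A \<le> card ?B" using fin by (intro card_mono) auto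
      then have B: "?B \<subseteq> {1..N}" "lam * real N \<le> real (card ?B)" using A j by auto
      have "diam_on ?B (\<lambda>i. \<theta> i t - 2 * real_of_int (?k i) * pi) < l"
      proof (subst diam_on_less_iff)
        have *: "\<And>i i'. i \<in> A \<Longrightarrow> i' \<in> A \<Longrightarrow>
            (\<theta> i t - 2 * real_of_int (k i) * pi) - (\<theta> i' t - 2 * real_of_int (k i') * pi) < l"
          using cl[OF t] unfolding diam_on_less_iff[OF fin] by blast
        have rep: "\<exists>i'\<in>A. \<theta> i t - 2 * real_of_int (?k i) * pi = \<theta> i' t - 2 * real_of_int (k i') * pi" if "i \<in> ?B" for i
          using that n a by (cases "i = j") auto
        show "\<forall>i\<in>?B. \<forall>i'\<in>?B. (\<theta> i t - 2 * real_of_int (?k i) * pi) - (\<theta> i' t - 2 * real_of_int (?k i') * pi) < l"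
        proof (intro ballI)
          fix i i' assume "i \<in> ?B" "i' \<in> ?B"
          with rep obtain u v where "u \<in> A" "v \<in> A"
            "\<theta> i t - 2 * real_of_int (?k i) * pi = \<theta> u t - 2 * real_of_int (k u) * pi"
            "\<theta> i' t - 2 * real_of_int (?k i') * pi = \<theta> v t - 2 * real_of_int (k v) * pi" by metis
          with * show "(\<theta> i t - 2 * real_of_int (?k i) * pi) - (\<theta> i' t - 2 * real_of_int (?k i') * pi) < l" by simp
        qed
      qed (use fin in auto)
      moreover have "t \<ge> \<eta> * m" using t T by simp
      ultimately show ?thesis using member[OF B, of t ?k] a by blast
    next
      case False
      have cont: "continuous_on {T..} ?f"
        by (intro continuous_intros continuous_on_subset[OF continuous_theta]) (use A a j Tpos in auto)
      have "\<bar>?f t\<bar> \<le> \<bar>of_int \<lfloor>?f T\<rfloor>\<bar> + 1" if t: "t \<ge> T" for t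
        using avoids_integers_imp_bounded[OF cont _ t] False by (smt (verit))
      moreover have "\<theta> j t - \<theta> a t = ?f t * (2 * pi) - 2 * real_of_int (k a) * pi" for t
        by (simp add: field_simps)
      ultimately have "\<bar>\<theta> j t - \<theta> a t\<bar> \<le> (\<bar>of_int \<lfloor>?f T\<rfloor>\<bar> + 1) * (2 * pi) + \<bar>2 * real_of_int (k a) * pi\<bar>"
        if t: "t \<ge> T" for t
      proof -
        assume b: "\<And>t. T \<le> t \<Longrightarrow> \<bar>?f t\<bar> \<le> \<bar>of_int \<lfloor>?f T\<rfloor>\<bar> + 1"
          and e: "\<And>t. \<theta> j t - \<theta> a t = ?f t * (2 * pi) - 2 * real_of_int (k a) * pi"
        have "\<bar>?f t * (2 * pi)\<bar> \<le> (\<bar>of_int \<lfloor>?f T\<rfloor>\<bar> + 1) * (2 * pi)"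
          unfolding abs_mult using b[OF t] by (intro mult_mono) auto
        then show ?thesis unfolding e[of t] by linarith
      qed
      then show ?thesis by blast
    qed
  qed
qed

lemma relative_phases_bounded:
  assumes A: "A \<subseteq> {1..N}" "lam * real N \<le> real (card A)" and T: "T \<ge> \<eta> * m"
    and cl: "\<And>t. t \<ge> T \<Longrightarrow> diam_on A (\<lambda>i. \<theta> i t - 2 * real_of_int (k i) * pi) < l"
  shows "\<exists>M. \<exists>T'\<ge>T. \<forall>i\<in>{1..N}. \<forall>j\<in>{1..N}. \<forall>t\<ge>T'. \<bar>\<theta> i t - \<theta> j t\<bar> \<le> M"
proof -
  obtain a where a: "a \<in> A" using majority_nonempty(2)[OF A] by blast
  have "\<exists>M. \<forall>\<^sub>F t in at_top. \<bar>\<theta> j t - \<theta> a t\<bar> \<le> M" if "j \<in> {1..N}" for j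
    using relative_phase_bounded[OF A T cl a that] unfolding eventually_at_top_linorder by blast
  then obtain M where "\<And>j. j \<in> {1..N} \<Longrightarrow> \<forall>\<^sub>F t in at_top. \<bar>\<theta> j t - \<theta> a t\<bar> \<le> M j" by metis
  then have "\<forall>\<^sub>F t in at_top. \<forall>j\<in>{1..N}. \<bar>\<theta> j t - \<theta> a t\<bar> \<le> M j" by (intro eventually_ball_finite) auto
  then obtain S where S: "\<And>t j. t \<ge> S \<Longrightarrow> j \<in> {1..N} \<Longrightarrow> \<bar>\<theta> j t - \<theta> a t\<bar> \<le> M j"
    unfolding eventually_at_top_linorder by blast
  define K where "K = (\<Sum>j\<in>{1..N}. \<bar>M j\<bar>)"
  have K: "M j \<le> K" if "j \<in> {1..N}" for j
    using member_le_sum[of j "{1..N}" "\<lambda>j. \<bar>M j\<bar>"] that unfolding K_def by fastforce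
  have "\<bar>\<theta> i t - \<theta> j t\<bar> \<le> 2 * K" if "i \<in> {1..N}" "j \<in> {1..N}" "t \<ge> max S T" for i j t
    using S[of t i] S[of t j] K[of i] K[of j] that by (simp add: abs_le_iff)
  then show ?thesis by (intro exI[of _ "2 * K"] exI[of _ "max S T"]) auto
qed

lemma phase_locking:
  shows "\<exists>p. \<forall>i\<in>{1..N}. ((\<lambda>t. \<theta> i t - \<nu>c * t) \<longlongrightarrow> p i) at_top
    \<and> (\<omega> i \<longlongrightarrow> \<nu>c) at_top \<and> coupling N p i = - (\<nu> i - \<nu>c) / \<kappa>"
proof -
  obtain A k where "majority_cluster N lam l \<theta> A k" using majority_cluster_exists by blast
  note late = majority_cluster_late[OF this]
  note A = late(1,2)
  obtain T where T: "T \<ge> \<eta> * m"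
    and cl: "\<And>t. t \<ge> T \<Longrightarrow> diam_on A (\<lambda>i. \<theta> i t - 2 * real_of_int (k i) * pi) < l"
    using late(3) by auto
  obtain M T' where T': "T' \<ge> T"
    and bd: "\<And>i j t. i \<in> {1..N} \<Longrightarrow> j \<in> {1..N} \<Longrightarrow> t \<ge> T' \<Longrightarrow> \<bar>\<theta> i t - \<theta> j t\<bar> \<le> M"
    using relative_phases_bounded[OF A T cl] by metis
  have "T' > 0" by (rule post_layer(1)) (use T T' in simp)
  have "\<And>t. t \<ge> T' \<Longrightarrow> R t \<ge> lam * cos (l / 2) - (1 - lam)"
    by (rule order_parameter_ge_margin[OF A cl]) (use T' in simp)
  then show ?thesis
    using bd by (intro phase_locking_if_coherent_and_bounded[OF _ \<open>T' > 0\<close> _ alignment_margin_pos])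
qed

end

section \<open>Majority clusters in the limit state\<close>

text \<open>
  Here \<open>p\<close> is the limit state in the frame that moves with the mean frequency. The remaining claims are
  statements about this equilibrium.
\<close>

locale locked_regime = clustering_regime +
  fixes p :: "nat \<Rightarrow> real"
  assumes limit_phase: "\<And>i. i \<in> {1..N} \<Longrightarrow> ((\<lambda>t. \<theta> i t - \<nu>c * t) \<longlongrightarrow> p i) at_top"
    and equilibrium: "\<And>i. i \<in> {1..N} \<Longrightarrow> coupling N p i = - (\<nu> i - \<nu>c) / \<kappa>"
begin

lemma phase_difference_limit:
  assumes "i \<in> {1..N}" "j \<in> {1..N}"
  shows "((\<lambda>t. (\<theta> i t - c) - (\<theta> j t - d)) \<longlongrightarrow> (p i - c) - (p j - d)) at_top"
proof -
  have "((\<lambda>t. ((\<theta> i t - \<nu>c * t) - c) - ((\<theta> j t - \<nu>c * t) - d)) \<longlongrightarrow> (p i - c) - (p j - d)) at_top"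
    by (intro tendsto_intros limit_phase assms)
  then show ?thesis by (simp add: algebra_simps)
qed

lemma equilibrium_gap:
  assumes "i \<in> {1..N}" "j \<in> {1..N}"
  shows "coupling N (\<lambda>i. p i - 2 * real_of_int (k i) * pi) j - coupling N (\<lambda>i. p i - 2 * real_of_int (k i) * pi) i
    = (\<nu> i - \<nu> j) / \<kappa>" "(\<nu> i - \<nu> j) / \<kappa> \<le> DV / \<kappa>"
proof -
  show "coupling N (\<lambda>i. p i - 2 * real_of_int (k i) * pi) j - coupling N (\<lambda>i. p i - 2 * real_of_int (k i) * pi) i
    = (\<nu> i - \<nu> j) / \<kappa>"
    unfolding coupling_shift equilibrium[OF assms(1)] equilibrium[OF assms(2)]
    using \<kappa> by (simp add: field_simps)
  have "\<nu> i - \<nu> j \<le> DV" using diam_on_upper[of "{1..N}" i j \<nu>] assms by simp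
  then show "(\<nu> i - \<nu> j) / \<kappa> \<le> DV / \<kappa>" using \<kappa> by (simp add: divide_right_mono)
qed

text \<open>
  In the limit, the restoring force between the ends of the cluster exactly balances their frequency
  difference. This also excludes the diameter \<open>l\<close>, where the restoring force is too strong.
\<close>

lemma limit_cluster_diameter:
  assumes cl: "majority_cluster N lam l \<theta> A k"
  defines "D \<equiv> diam_on A (\<lambda>i. p i - 2 * real_of_int (k i) * pi)"
  shows "0 \<le> D" "D < l" "2 * restoring lam D \<le> DV / \<kappa>"
proof -
  let ?\<psi> = "\<lambda>i. p i - 2 * real_of_int (k i) * pi"
  note A = majority_cluster_late(1,2)[OF cl]
  obtain T where T': "\<And>t. t \<ge> T \<Longrightarrow> diam_on A (\<lambda>i. \<theta> i t - 2 * real_of_int (k i) * pi) < l"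
    using majority_cluster_late(3)[OF cl] by auto
  have fin: "finite A" "A \<noteq> {}" using majority_nonempty[OF A] by auto
  show D0: "0 \<le> D" unfolding D_def using fin by (rule diam_on_nonneg)
  obtain i j where ij: "i \<in> A" "j \<in> A" and D: "D = ?\<psi> i - ?\<psi> j"
    using diam_on_attained[OF fin, of ?\<psi>] unfolding D_def by blast
  have ijN: "i \<in> {1..N}" "j \<in> {1..N}" using ij A by auto
  have Dl: "D \<le> l"
    unfolding D
  proof (rule tendsto_upperbound[OF phase_difference_limit[OF ijN]])
    show "\<forall>\<^sub>F t in at_top. (\<theta> i t - 2 * real_of_int (k i) * pi) - (\<theta> j t - 2 * real_of_int (k j) * pi) \<le> l"
      unfolding eventually_at_top_linorder
      using T' ij unfolding diam_on_less_iff[OF fin] by (intro exI[of _ T]) (auto intro: less_imp_le)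
  qed simp
  have "2 * restoring lam (?\<psi> i - ?\<psi> j) \<le> coupling N ?\<psi> j - coupling N ?\<psi> i"
    by (rule coupling_gap_of_majority[OF N A])
       (use diam_on_between[OF fin(1) ij, of ?\<psi>] D D0 Dl l in \<open>auto simp: D_def\<close>)
  then show gap: "2 * restoring lam D \<le> DV / \<kappa>"
    unfolding D[symmetric] using equilibrium_gap(1)[OF ijN, of k] equilibrium_gap(2)[OF ijN] by linarith
  have "D \<noteq> l" using gap DV_less_xi cluster_stability by auto
  with Dl show "D < l" by simp
qed

text \<open>
  Beyond a right angle the restoring force decreases, so it would be even stronger at the diameter
  of the cluster than at \<open>l\<close>.
\<close>

lemma limit_cluster_diameter_le_right_angle:
  assumes cl: "majority_cluster N lam l \<theta> A k"
  shows "diam_on A (\<lambda>i. p i - 2 * real_of_int (k i) * pi) \<le> pi / 2" (is "?D \<le> _")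
proof (rule ccontr)
  assume "\<not> ?thesis"
  then have "restoring lam l \<le> restoring lam ?D"
    using limit_cluster_diameter(2)[OF cl] l lam by (intro restoring_antimono) auto
  with limit_cluster_diameter(3)[OF cl] DV_less_xi cluster_stability show False by linarith
qed

text \<open>
  Two majorities share a member \<open>a\<close>, and normalising the second family of integers at \<open>a\<close> makes both
  families agree on the whole intersection. Suppose that the union had a limit diameter \<open>d \<ge> l\<close>, and let \<open>D\<close>
  be the larger of the two limit diameters, so that \<open>d \<le> 2 * D \<le> pi\<close>. Common members are within \<open>D\<close> of both
  ends, hence within \<open>D - d / 2\<close> of the midpoint, and all members are within \<open>d / 2\<close> of it. Since \<open>D - d / 2\<close>
  is at most \<open>l / 2\<close>, the ends of the union attract each other at least as strongly as those of a single
  majority cluster of diameter \<open>l\<close>, which is incompatible with equilibrium.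
\<close>

lemma majority_clusters_union:
  assumes clA: "majority_cluster N lam l \<theta> A k" and clB: "majority_cluster N lam l \<theta> B k'"
  shows "\<exists>k''. majority_cluster N lam l \<theta> (A \<union> B) k''"
proof -
  have A: "A \<subseteq> {1..N}" "lam * real N \<le> real (card A)" and B: "B \<subseteq> {1..N}" "lam * real N \<le> real (card B)"
    using clA clB unfolding majority_cluster_def by auto
  have fA: "finite A" "A \<noteq> {}" and fB: "finite B" "B \<noteq> {}"
    using majority_nonempty[OF A] majority_nonempty[OF B] by auto
  let ?U = "A \<union> B" and ?I = "A \<inter> B"
  have fU: "finite ?U" "?U \<noteq> {}" and UN: "?U \<subseteq> {1..N}" using fA fB A B by auto
  have count: "real (card ?U) + real (card ?I) = real (card A) + real (card B)"
    using card_Un_Int[OF fA(1) fB(1)] by linarith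
  have cU: "lam * real N \<le> real (card ?U)" "real (card ?U) \<le> real N"
    using A(2) card_mono[OF fU(1), of A] card_mono[OF _ UN] by auto
  have "real N < lam * real N + lam * real N" using lam N by (simp add: field_simps)
  then have "0 < real (card ?I)" using count cU A B by linarith
  then obtain a where a: "a \<in> A" "a \<in> B" by (metis IntE card_gt_0_iff ex_in_conv of_nat_0_less_iff)
  define D where "D = max (diam_on A (\<lambda>i. p i - 2 * real_of_int (k i) * pi)) (diam_on B (\<lambda>i. p i - 2 * real_of_int (k' i) * pi))"
  have D: "0 \<le> D" "D < l" "D \<le> pi / 2"
    using limit_cluster_diameter[OF clA] limit_cluster_diameter[OF clB]
      limit_cluster_diameter_le_right_angle[OF clA] limit_cluster_diameter_le_right_angle[OF clB]
    unfolding D_def by auto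
  have dA: "\<bar>(p i - 2 * real_of_int (k i) * pi) - (p j - 2 * real_of_int (k j) * pi)\<bar> \<le> D" if "i \<in> A" "j \<in> A" for i j
    using diam_on_upper[OF fA(1) that, of "\<lambda>i. p i - 2 * real_of_int (k i) * pi"] unfolding D_def by linarith
  have dB: "\<bar>(p i - 2 * real_of_int (k' i) * pi) - (p j - 2 * real_of_int (k' j) * pi)\<bar> \<le> D" if "i \<in> B" "j \<in> B" for i j
    using diam_on_upper[OF fB(1) that, of "\<lambda>i. p i - 2 * real_of_int (k' i) * pi"] unfolding D_def by linarith
  define n where "n = k a - k' a"
  define k'' where "k'' i = (if i \<in> A then k i else k' i + n)" for i
  have agree: "k i = k' i + n" if i: "i \<in> A" "i \<in> B" for i
  proof -
    have h: "\<bar>2 * real_of_int (k i - k' i - n) * pi\<bar> \<le> D + D"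
      using dA[OF i(1) a(1)] dB[OF i(2) a(2)] unfolding n_def by (simp add: algebra_simps abs_le_iff)
    have "\<bar>2 * real_of_int z * pi\<bar> = \<bar>real_of_int z\<bar> * (2 * pi)" for z by (simp add: abs_mult)
    from h[unfolded this] have "\<bar>real_of_int (k i - k' i - n)\<bar> * (2 * pi) \<le> pi" using D(3) by linarith
    then have "\<bar>real_of_int (k i - k' i - n)\<bar> * (2 * pi) < 1 * (2 * pi)" using pi_gt_zero by linarith
    then have "\<bar>real_of_int (k i - k' i - n)\<bar> < 1" using pi_gt_zero by (simp only: mult_less_cancel_right_pos)
    then show ?thesis by linarith
  qed
  define x where "x i = p i - 2 * real_of_int (k'' i) * pi" for i
  have xA: "x i = p i - 2 * real_of_int (k i) * pi" if "i \<in> A" for i using that by (simp add: x_def k''_def)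
  have xB: "x i = p i - 2 * real_of_int (k' i) * pi - 2 * real_of_int n * pi" if "i \<in> B" for i
    using that agree[of i] by (simp add: x_def k''_def algebra_simps)
  have cA: "\<bar>x i - x j\<bar> \<le> D" if "i \<in> A" "j \<in> A" for i j using dA[OF that] that by (simp add: xA)
  have cB: "\<bar>x i - x j\<bar> \<le> D" if "i \<in> B" "j \<in> B" for i j using dB[OF that] that by (simp add: xB)
  have near: "\<bar>x i - x j\<bar> \<le> D" if "i \<in> ?U" "j \<in> ?I" for i j using cA cB that by blast
  have "diam_on ?U x < l"
  proof (rule ccontr)
    assume not: "\<not> ?thesis"
    obtain i j where ij: "i \<in> ?U" "j \<in> ?U" and d: "diam_on ?U x = x i - x j"
      using diam_on_attained[OF fU, of x] by blast
    define d where "d = x i - x j"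
    have dl: "l \<le> d" using not d by (simp add: d_def)
    have d2D: "d \<le> 2 * D" using near[OF ij(1), of a] near[OF ij(2), of a] a unfolding d_def by (simp add: abs_le_iff)
    let ?mid = "(x i + x j) / 2"
    let ?c = "cos (D - d / 2)"
    have "lam * ?c - (1 - lam) \<le> mean N (\<lambda>k. cos (x k - ?mid))"
    proof -
      \<comment> \<open>Common members count \<open>?c\<close>, other members at least \<open>0\<close>, and outsiders at least \<open>- 1\<close>.\<close>
      have pointwise: "?c * (if k \<in> ?I then 1 else 0) + (if k \<in> ?U then 1 else 0) - 1 \<le> cos (x k - ?mid)" for k
      proof (cases "k \<in> ?U")
        case True
        have "\<bar>x k - ?mid\<bar> \<le> d / 2"
          using diam_on_between[OF fU(1) ij _ True, of x] \<open>diam_on ?U x = x i - x j\<close>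
          unfolding d_def abs_le_iff by (auto simp: field_simps)
        moreover have "d / 2 \<le> pi / 2" using d2D D by simp
        ultimately have "\<bar>x k - ?mid\<bar> \<le> pi / 2" by linarith
        then have "0 \<le> cos (x k - ?mid)" unfolding abs_le_iff by (intro cos_ge_zero) linarith+
        moreover have "?c \<le> cos (x k - ?mid)" if k: "k \<in> ?I"
        proof -
          have "\<bar>x k - ?mid\<bar> \<le> D - d / 2"
            using near[OF ij(1) k] near[OF ij(2) k] unfolding d_def abs_le_iff by (auto simp: field_simps)
          then have "?c \<le> cos \<bar>x k - ?mid\<bar>" using D dl l by (intro cos_monotone_0_pi_le) auto
          then show ?thesis by simp
        qed
        ultimately show ?thesis using True by auto
      qed auto
      have I: "?I \<subseteq> {1..N}" using A by auto
      have "mean N (\<lambda>k. ?c * (if k \<in> ?I then 1 else 0) + (if k \<in> ?U then 1 else 0) - 1)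
          = ?c * (real (card ?I) / real N) + real (card ?U) / real N - 1"
        using N by (simp only: mean_diff mean_add mean_cmult mean_const mean_indicator[OF I] mean_indicator[OF UN])
      then have "?c * (real (card ?I) / real N) + real (card ?U) / real N - 1 \<le> mean N (\<lambda>k. cos (x k - ?mid))"
        using mean_mono[of N "\<lambda>k. ?c * (if k \<in> ?I then 1 else 0) + (if k \<in> ?U then 1 else 0) - 1"
            "\<lambda>k. cos (x k - ?mid)", OF pointwise] by (simp only:)
      moreover have "lam * ?c - (1 - lam) \<le> ?c * (real (card ?I) / real N) + real (card ?U) / real N - 1"
      proof -
        have c: "0 \<le> ?c" "?c \<le> 1" using D dl d2D l by (auto intro!: cos_ge_zero)
        have "(2 * lam * real N - real (card ?U)) * ?c \<le> real (card ?I) * ?c"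
          using count A(2) B(2) c by (intro mult_right_mono) auto
        moreover have "lam * real N * (1 - ?c) \<le> real (card ?U) * (1 - ?c)"
          using cU c by (intro mult_right_mono) auto
        ultimately have "(lam * ?c - (1 - lam)) * real N \<le> ?c * real (card ?I) + real (card ?U) - real N"
          by (simp add: algebra_simps)
        then have "lam * ?c - (1 - lam) \<le> (?c * real (card ?I) + real (card ?U) - real N) / real N"
          using N by (simp add: pos_le_divide_eq)
        also have "\<dots> = ?c * (real (card ?I) / real N) + real (card ?U) / real N - 1"
          using N by (simp add: add_divide_distrib diff_divide_distrib)
        finally show ?thesis .
      qed
      ultimately show ?thesis by linarith
    qed
    moreover have "lam * cos (l / 2) \<le> lam * ?c"
      using D dl d2D l lam by (intro mult_left_mono cos_monotone_0_pi_le) auto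
    ultimately have margin: "lam * cos (l / 2) - (1 - lam) \<le> mean N (\<lambda>k. cos (x k - ?mid))" by linarith
    have "sin (l / 2) \<le> sin (d / 2)" using D dl d2D l by (intro sin_monotone_2pi_le) auto
    then have "restoring lam l \<le> sin (d / 2) * mean N (\<lambda>k. cos (x k - ?mid))"
      unfolding restoring_def using margin alignment_margin_pos D d2D dl l
      by (intro mult_mono sin_ge_zero) auto
    then have "2 * restoring lam l \<le> coupling N x j - coupling N x i"
      unfolding coupling_difference_chord d_def by simp
    also have "\<dots> \<le> DV / \<kappa>"
    proof -
      have ijN: "i \<in> {1..N}" "j \<in> {1..N}" using ij UN by auto
      show ?thesis
        using equilibrium_gap(1)[OF ijN, of k''] equilibrium_gap(2)[OF ijN] unfolding x_def by linarith
    qed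
    finally show False using DV_less_xi cluster_stability by linarith
  qed
  then have lt: "x i - x j < l" if "i \<in> ?U" "j \<in> ?U" for i j using that unfolding diam_on_less_iff[OF fU] by blast
  have "\<forall>\<^sub>F t in at_top. \<forall>i\<in>?U. \<forall>j\<in>?U. (\<theta> i t - 2 * real_of_int (k'' i) * pi) - (\<theta> j t - 2 * real_of_int (k'' j) * pi) < l"
    using fU(1) lt UN unfolding x_def
    by (intro eventually_ball_finite ballI order_tendstoD(2)[OF phase_difference_limit]) auto
  then obtain T where "\<And>t. t \<ge> T \<Longrightarrow> diam_on ?U (\<lambda>i. \<theta> i t - 2 * real_of_int (k'' i) * pi) < l"
    unfolding diam_on_less_iff[OF fU] eventually_at_top_linorder by blast
  then have "majority_cluster N lam l \<theta> ?U k''"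
    unfolding majority_cluster_def using UN cU by (intro conjI exI[of _ "max T 1"]) auto
  then show ?thesis by blast
qed

text \<open>
  There are finitely many majority clusters, and by \<open>majority_clusters_union\<close> the union of all of them is
  again one.
\<close>

lemma maximal_majority_cluster_unique:
  "\<exists>!A. (\<exists>k. majority_cluster N lam l \<theta> A k) \<and>
     (\<forall>B. (\<exists>k. majority_cluster N lam l \<theta> B k) \<and> A \<subseteq> B \<longrightarrow> B = A)"
proof -
  define U where "U = \<Union>{A. \<exists>k. majority_cluster N lam l \<theta> A k}"
  let ?X = "{A. \<exists>k. majority_cluster N lam l \<theta> A k}"
  have "finite ?X" by (rule finite_subset[of _ "Pow {1..N}"]) (auto simp: majority_cluster_def)
  moreover have "?X \<noteq> {}" using majority_cluster_exists by blast
  ultimately have "\<Union>?X \<in> ?X"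
    by (rule finite_Sup_in) (use majority_clusters_union in blast)
  then have U: "\<exists>k. majority_cluster N lam l \<theta> U k" by (simp add: U_def)
  have sub: "B \<subseteq> U" if "\<exists>k. majority_cluster N lam l \<theta> B k" for B using that by (auto simp: U_def)
  show ?thesis
  proof (rule ex1I[of _ U], intro conjI allI impI)
    show "\<exists>k. majority_cluster N lam l \<theta> U k" by (rule U)
    show "B = U" if "(\<exists>k. majority_cluster N lam l \<theta> B k) \<and> U \<subseteq> B" for B using that sub by blast
    show "A = U" if "(\<exists>k. majority_cluster N lam l \<theta> A k) \<and>
      (\<forall>B. (\<exists>k. majority_cluster N lam l \<theta> B k) \<and> A \<subseteq> B \<longrightarrow> B = A)" for A using that sub U by blast
  qed
qed

text \<open>
  Concavity of \<open>restoring lam\<close> puts the limit diameter \<open>D\<close> below the critical arc, and below the fraction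
  \<open>(DV / \<kappa>) / critical_strength lam\<close> of it. On such an arc the force is a function of the position with a
  slope between \<open>\<gamma>\<close> and \<open>1\<close>, so phase differences and frequency differences have the same sign and are
  comparable.
\<close>

lemma cluster_ordered_by_frequency:
  assumes cl: "majority_cluster N lam l \<theta> A k" and ij: "i \<in> A" "j \<in> A" and \<nu>: "\<nu> i \<ge> \<nu> j"
    and strength: "DV / \<kappa> < critical_strength lam"
  defines "L \<equiv> p i - p j - 2 * real_of_int (k i - k j) * pi"
    and "\<gamma> \<equiv> lam * cos (critical_arc lam * (DV / \<kappa>) / critical_strength lam) - (1 - lam)"
  shows "(\<nu> i - \<nu> j) / \<kappa> \<le> L" "L \<le> 1 / \<gamma> * ((\<nu> i - \<nu> j) / \<kappa>)"
proof -
  let ?\<psi> = "\<lambda>i. p i - 2 * real_of_int (k i) * pi"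
  let ?d = "critical_arc lam" and ?h = "critical_strength lam"
  note ca = critical_arc[OF lam]
  define D where "D = diam_on A ?\<psi>"
  have D: "0 \<le> D" "D < l" "2 * restoring lam D \<le> DV / \<kappa>"
    using limit_cluster_diameter[OF cl] unfolding D_def by auto
  have A: "A \<subseteq> {1..N}" "lam * real N \<le> real (card A)" using cl unfolding majority_cluster_def by auto
  have fin: "finite A" "A \<noteq> {}" using majority_nonempty[OF A] by auto
  have DV0: "0 \<le> DV / \<kappa>" using DV_nonneg \<kappa> by simp
  \<comment> \<open>Otherwise \<open>D\<close> would lie between the critical arc and \<open>l\<close>, at both of which \<open>restoring lam\<close> is larger.\<close>
  have small: "D < ?d"
  proof (rule ccontr)
    assume "\<not> D < ?d"
    then have dD: "?d \<le> D" by simp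
    have conc: "convex_on {0..l} (\<lambda>d. - restoring lam d)"
      using alignment_margin_pos l lam by (intro restoring_concave) auto
    define s where "s = (D - ?d) / (l - ?d)"
    have s: "0 \<le> s" "s \<le> 1" using dD D ca(1) by (auto simp: s_def)
    have "(1 - s) * restoring lam ?d + s * restoring lam l \<le> restoring lam D"
      unfolding s_def by (rule restoring_chord[OF conc]) (use ca(1) dD D in auto)
    moreover have "restoring lam D < restoring lam ?d" "restoring lam D < restoring lam l"
      using D(3) strength ca(4) DV_less_xi cluster_stability by linarith+
    then have "(1 - s) * restoring lam D + s * restoring lam D < (1 - s) * restoring lam ?d + s * restoring lam l"
      using s by (cases "s = 0") (auto intro!: add_le_less_mono mult_left_mono mult_strict_left_mono)
    ultimately show False by (simp add: algebra_simps)
  qed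
  \<comment> \<open>The graph of \<open>restoring lam\<close> lies above the chord from \<open>0\<close> to the critical arc.\<close>
  have Dle: "D \<le> ?d * (DV / \<kappa>) / ?h"
  proof -
    have "convex_on {0..?d} (\<lambda>d. - restoring lam d)"
      using ca lam by (intro restoring_concave) auto
    then have "(1 - (D - 0) / (?d - 0)) * restoring lam 0 + (D - 0) / (?d - 0) * restoring lam ?d \<le> restoring lam D"
      by (rule restoring_chord) (use ca(1) D small in auto)
    then have "D / ?d * restoring lam ?d \<le> restoring lam D" by (simp add: restoring_def[of lam 0])
    moreover have "D / ?d * (2 * x) = 2 * (D / ?d * x)" for x by simp
    ultimately have "D / ?d * ?h \<le> 2 * restoring lam D" unfolding ca(4) by (simp only:)
    also have "\<dots> \<le> DV / \<kappa>" by (rule D(3))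
    finally have "D * ?h \<le> ?d * (DV / \<kappa>)" using ca(1) by (simp add: pos_divide_le_eq mult.commute)
    then show ?thesis using ca(6) by (simp only: pos_le_divide_eq)
  qed
  have lt: "?d * (DV / \<kappa>) / ?h < ?d"
  proof -
    have "?d * (DV / \<kappa>) < ?d * ?h" using strength ca(1) by (rule mult_strict_left_mono)
    then show ?thesis using ca(6) by (simp only: pos_divide_less_eq)
  qed
  have \<gamma>: "\<gamma> > 0"
  proof -
    have "cos ?d < cos (?d * (DV / \<kappa>) / ?h)"
      using lt Dle D ca(2) pi_gt_zero by (intro cos_monotone_0_pi) auto
    then have "lam * cos ?d < lam * cos (?d * (DV / \<kappa>) / ?h)" using lam by (intro mult_strict_left_mono) auto
    then show ?thesis unfolding \<gamma>_def using ca(3) by linarith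
  qed
  have slope: "\<gamma> \<le> lam * cos D - (1 - lam)"
  proof -
    have "cos (?d * (DV / \<kappa>) / ?h) \<le> cos D"
      using Dle D lt ca(2) pi_gt_zero by (intro cos_monotone_0_pi_le) auto
    then show ?thesis unfolding \<gamma>_def using lam by (simp add: mult_left_mono)
  qed
  have Dpi: "D \<le> pi" using D(2) l by simp
  have bd: "\<forall>k'\<in>A. \<forall>l'\<in>A. ?\<psi> k' - ?\<psi> l' \<le> D"
  proof (intro ballI)
    fix k' l' assume "k' \<in> A" "l' \<in> A"
    from diam_on_upper[OF fin(1) this, of ?\<psi>] show "?\<psi> k' - ?\<psi> l' \<le> D" unfolding D_def by linarith
  qed
  have ijN: "i \<in> {1..N}" "j \<in> {1..N}" using ij A by auto
  have L: "L = ?\<psi> i - ?\<psi> j" unfolding L_def by (simp add: algebra_simps)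
  have nn: "0 \<le> (\<nu> i - \<nu> j) / \<kappa>" using \<nu> \<kappa> by simp
  consider "L > 0" | "L = 0" | "L < 0" by linarith
  then have "(\<nu> i - \<nu> j) / \<kappa> \<le> L \<and> L \<le> 1 / \<gamma> * ((\<nu> i - \<nu> j) / \<kappa>)"
  proof cases
    case 1
    then have "?\<psi> j < ?\<psi> i" unfolding L by simp
    then obtain s where s: "lam * cos D - (1 - lam) \<le> s" "s \<le> 1"
      "coupling N ?\<psi> j - coupling N ?\<psi> i = (?\<psi> i - ?\<psi> j) * s"
      by (rule coupling_gap_linear[where x = ?\<psi>, OF N A ij Dpi bd])
    have eq: "(\<nu> i - \<nu> j) / \<kappa> = L * s" using s(3) equilibrium_gap(1)[OF ijN, of k] unfolding L by simp
    have "L * s \<le> L * 1" using 1 s(2) by (intro mult_left_mono) auto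
    moreover have "L * \<gamma> \<le> L * s" using 1 s(1) slope by (intro mult_left_mono) auto
    then have "L \<le> 1 / \<gamma> * (L * s)" using \<gamma> by (simp add: pos_le_divide_eq)
    ultimately show ?thesis unfolding eq by simp
  next
    case 2
    then have "?\<psi> i = ?\<psi> j" unfolding L by simp
    then have "coupling N ?\<psi> i = coupling N ?\<psi> j" unfolding coupling_def by simp
    then have "(\<nu> i - \<nu> j) / \<kappa> = 0" using equilibrium_gap(1)[OF ijN, of k] by simp
    then show ?thesis unfolding 2 by (simp only:) simp
  next
    case 3
    then have less: "?\<psi> i < ?\<psi> j" unfolding L by simp
    obtain s where s: "lam * cos D - (1 - lam) \<le> s" "s \<le> 1"
      "coupling N ?\<psi> i - coupling N ?\<psi> j = (?\<psi> j - ?\<psi> i) * s"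
      by (rule coupling_gap_linear[where x = ?\<psi>, OF N A ij(2,1) Dpi bd less])
    have "0 < (?\<psi> j - ?\<psi> i) * s" using less s(1) slope \<gamma> by (intro mult_pos_pos) auto
    with s(3) equilibrium_gap(1)[OF ijN, of k] nn show ?thesis by linarith
  qed
  then show "(\<nu> i - \<nu> j) / \<kappa> \<le> L" "L \<le> 1 / \<gamma> * ((\<nu> i - \<nu> j) / \<kappa>)" by auto
qed

end

section \<open>The clustering theorem\<close>

lemma sup_norm_on_tendsto_0:
  assumes I: "finite I" "I \<noteq> {}" and lim: "\<And>i. i \<in> I \<Longrightarrow> ((\<lambda>t. x t i) \<longlongrightarrow> 0) F"
  shows "((\<lambda>t. sup_norm_on I (x t)) \<longlongrightarrow> 0) F"
proof (rule tendsto_sandwich[OF _ _ tendsto_const])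
  have "((\<lambda>t. \<Sum>i\<in>I. \<bar>x t i\<bar>) \<longlongrightarrow> (\<Sum>i\<in>I. \<bar>0\<bar>)) F" by (intro tendsto_intros lim)
  then show "((\<lambda>t. \<Sum>i\<in>I. \<bar>x t i\<bar>) \<longlongrightarrow> 0) F" by simp
  show "\<forall>\<^sub>F t in F. 0 \<le> sup_norm_on I (x t)"
    unfolding sup_norm_on_def using I by (intro always_eventually allI) (auto simp: Max_ge_iff)
  show "\<forall>\<^sub>F t in F. sup_norm_on I (x t) \<le> (\<Sum>i\<in>I. \<bar>x t i\<bar>)"
    unfolding sup_norm_on_def using I by (intro always_eventually allI) (auto intro!: member_le_sum)
qed

theorem theorem3p2:
  "\<exists>c :: real \<Rightarrow> real \<Rightarrow> real \<Rightarrow> real.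
   \<forall>(N::nat) (m::real) (\<kappa>::real) (\<nu>::nat \<Rightarrow> real) (\<theta>0::nat \<Rightarrow> real) (\<omega>0::nat \<Rightarrow> real)
    (\<theta>::nat \<Rightarrow> real \<Rightarrow> real) (\<omega>::nat \<Rightarrow> real \<Rightarrow> real)
    (l::real) (lam::real) (\<eta>::real) (\<delta>::real) (DV::real) (DW::real) (R0::real).
     N \<ge> 1 \<and> m > 0 \<and> \<kappa> > 0 \<and>
     inertial_kuramoto_solution N m \<kappa> \<nu> \<theta>0 \<omega>0 \<theta> \<omega> \<and>
     0 < l \<and> l < pi \<and> 1 / 2 < lam \<and> lam \<le> 1 \<and> 0 < \<eta> \<and> 0 < \<delta> \<and> \<delta> < 1 \<and>
     DV = diam_on {1..N} \<nu> \<and> DW = diam_on {1..N} \<omega>0 \<and> R0 = order_parameter N \<theta>0 \<and>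
     (R0 > 0 \<and> zeta m \<kappa> DW DV \<eta> \<le> (1 - \<delta>) * R0) \<and>
     (\<delta> * R0 \<ge> lam + (1 - lam) * cos (l / 2) \<or>
      2 * lam + (xi m \<kappa> DW DV \<eta> / (\<delta> * R0))^2 * (1 / (1 - cos (l / 2))) \<le> 1 + \<delta> * R0) \<and>
     xi m \<kappa> DW DV \<eta> < sin (l / 2) * (lam * cos (l / 2) - (1 - lam))
     \<longrightarrow>
     (\<exists>\<theta>inf :: nat \<Rightarrow> real.
        ((\<lambda>t. sup_norm_on {1..N} (\<lambda>i. \<theta> i t - mean N \<nu> * t - \<theta>inf i)
              + sup_norm_on {1..N} (\<lambda>i. \<omega> i t - mean N \<nu>)) \<longlongrightarrow> 0) at_top) \<and>
     (\<exists>A k. majority_cluster N lam l \<theta> A k) \<and>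
     (\<exists>!A. (\<exists>k. majority_cluster N lam l \<theta> A k) \<and>
           (\<forall>B. (\<exists>k. majority_cluster N lam l \<theta> B k) \<and> A \<subseteq> B \<longrightarrow> B = A)) \<and>
     (DV / \<kappa> + 4 * m * \<kappa> + 2 * m * DV
        < (2 * lam - 1) powr (3 / 2) / sqrt (2 * lam) * ((2 - lam) / (sqrt (lam / 2) + (1 - lam)))
      \<longrightarrow>
      (\<forall>A k. majority_cluster N lam l \<theta> A k \<longrightarrow>
        (\<forall>i\<in>A. \<forall>j\<in>A. \<nu> i \<ge> \<nu> j \<longrightarrow>
          (\<exists>L. ((\<lambda>t. \<theta> i t - \<theta> j t - 2 * real_of_int (k i - k j) * pi) \<longlongrightarrow> L) at_top \<and>
               (\<nu> i - \<nu> j) / \<kappa> \<le> L \<and>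
               L \<le> c (DV / \<kappa>) (m * \<kappa>) lam * ((\<nu> i - \<nu> j) / \<kappa>)))))"
proof (rule exI[of _ "\<lambda>\<rho> _ lam. 1 / (lam * cos (critical_arc lam * \<rho> / critical_strength lam) - (1 - lam))"],
    intro allI impI)
  \<comment> \<open>The constant is the reciprocal of the least slope of the force on the widest arc that a cluster can
    occupy in the limit.\<close>
  fix N :: nat and m \<kappa> :: real and \<nu> \<theta>0 \<omega>0 :: "nat \<Rightarrow> real" and \<theta> \<omega> :: "nat \<Rightarrow> real \<Rightarrow> real"
    and l lam \<eta> \<delta> DV DW R0 :: real
  assume hyp: "N \<ge> 1 \<and> m > 0 \<and> \<kappa> > 0 \<and>
     inertial_kuramoto_solution N m \<kappa> \<nu> \<theta>0 \<omega>0 \<theta> \<omega> \<and>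
     0 < l \<and> l < pi \<and> 1 / 2 < lam \<and> lam \<le> 1 \<and> 0 < \<eta> \<and> 0 < \<delta> \<and> \<delta> < 1 \<and>
     DV = diam_on {1..N} \<nu> \<and> DW = diam_on {1..N} \<omega>0 \<and> R0 = order_parameter N \<theta>0 \<and>
     (R0 > 0 \<and> zeta m \<kappa> DW DV \<eta> \<le> (1 - \<delta>) * R0) \<and>
     (\<delta> * R0 \<ge> lam + (1 - lam) * cos (l / 2) \<or>
      2 * lam + (xi m \<kappa> DW DV \<eta> / (\<delta> * R0))^2 * (1 / (1 - cos (l / 2))) \<le> 1 + \<delta> * R0) \<and>
     xi m \<kappa> DW DV \<eta> < sin (l / 2) * (lam * cos (l / 2) - (1 - lam))"
  then have DV: "DV = diam_on {1..N} \<nu>" and m: "m > 0" and \<kappa>: "\<kappa> > 0" by auto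
  interpret clustering_regime N m \<kappa> \<nu> \<theta>0 \<omega>0 \<theta> \<omega> l lam \<eta> \<delta>
    using hyp by unfold_locales (auto simp: restoring_def)
  obtain p where p: "\<And>i. i \<in> {1..N} \<Longrightarrow> ((\<lambda>t. \<theta> i t - mean N \<nu> * t) \<longlongrightarrow> p i) at_top"
    and sync: "\<And>i. i \<in> {1..N} \<Longrightarrow> (\<omega> i \<longlongrightarrow> mean N \<nu>) at_top"
    and eq: "\<And>i. i \<in> {1..N} \<Longrightarrow> coupling N p i = - (\<nu> i - mean N \<nu>) / \<kappa>"
    using phase_locking by blast
  interpret locked_regime N m \<kappa> \<nu> \<theta>0 \<omega>0 \<theta> \<omega> l lam \<eta> \<delta> p
    by unfold_locales (rule p, assumption, rule eq, assumption)
  show "(\<exists>\<theta>inf :: nat \<Rightarrow> real.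
        ((\<lambda>t. sup_norm_on {1..N} (\<lambda>i. \<theta> i t - mean N \<nu> * t - \<theta>inf i)
              + sup_norm_on {1..N} (\<lambda>i. \<omega> i t - mean N \<nu>)) \<longlongrightarrow> 0) at_top) \<and>
     (\<exists>A k. majority_cluster N lam l \<theta> A k) \<and>
     (\<exists>!A. (\<exists>k. majority_cluster N lam l \<theta> A k) \<and>
           (\<forall>B. (\<exists>k. majority_cluster N lam l \<theta> B k) \<and> A \<subseteq> B \<longrightarrow> B = A)) \<and>
     (DV / \<kappa> + 4 * m * \<kappa> + 2 * m * DV
        < (2 * lam - 1) powr (3 / 2) / sqrt (2 * lam) * ((2 - lam) / (sqrt (lam / 2) + (1 - lam)))
      \<longrightarrow>
      (\<forall>A k. majority_cluster N lam l \<theta> A k \<longrightarrow>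
        (\<forall>i\<in>A. \<forall>j\<in>A. \<nu> i \<ge> \<nu> j \<longrightarrow>
          (\<exists>L. ((\<lambda>t. \<theta> i t - \<theta> j t - 2 * real_of_int (k i - k j) * pi) \<longlongrightarrow> L) at_top \<and>
               (\<nu> i - \<nu> j) / \<kappa> \<le> L \<and>
               L \<le> 1 / (lam * cos (critical_arc lam * (DV / \<kappa>) / critical_strength lam) - (1 - lam))
                 * ((\<nu> i - \<nu> j) / \<kappa>)))))"
  proof (intro conjI impI allI ballI)
    have "((\<lambda>t. sup_norm_on {1..N} (\<lambda>i. \<theta> i t - mean N \<nu> * t - p i)
        + sup_norm_on {1..N} (\<lambda>i. \<omega> i t - mean N \<nu>)) \<longlongrightarrow> 0 + 0) at_top"
      by (intro tendsto_add sup_norm_on_tendsto_0 LIM_zero p sync) (use index_nonempty in auto)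
    then show "\<exists>\<theta>inf :: nat \<Rightarrow> real.
        ((\<lambda>t. sup_norm_on {1..N} (\<lambda>i. \<theta> i t - mean N \<nu> * t - \<theta>inf i)
              + sup_norm_on {1..N} (\<lambda>i. \<omega> i t - mean N \<nu>)) \<longlongrightarrow> 0) at_top" by auto
    show "\<exists>A k. majority_cluster N lam l \<theta> A k" by (rule majority_cluster_exists)
    show "\<exists>!A. (\<exists>k. majority_cluster N lam l \<theta> A k) \<and>
           (\<forall>B. (\<exists>k. majority_cluster N lam l \<theta> B k) \<and> A \<subseteq> B \<longrightarrow> B = A)"
      by (rule maximal_majority_cluster_unique)
  next
    fix A k i j
    assume F4: "DV / \<kappa> + 4 * m * \<kappa> + 2 * m * DV
        < (2 * lam - 1) powr (3 / 2) / sqrt (2 * lam) * ((2 - lam) / (sqrt (lam / 2) + (1 - lam)))"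
      and cl: "majority_cluster N lam l \<theta> A k" and ij: "i \<in> A" "j \<in> A" and \<nu>: "\<nu> j \<le> \<nu> i"
    have "0 \<le> 4 * m * \<kappa>" "0 \<le> 2 * m * DV" using m \<kappa> DV_nonneg unfolding DV by auto
    then have strength: "DV / \<kappa> < critical_strength lam" using F4 unfolding critical_strength_def by linarith
    have ijN: "i \<in> {1..N}" "j \<in> {1..N}" using ij cl unfolding majority_cluster_def by auto
    have "((\<lambda>t. \<theta> i t - \<theta> j t - 2 * real_of_int (k i - k j) * pi) \<longlongrightarrow> p i - p j - 2 * real_of_int (k i - k j) * pi) at_top"
      using tendsto_diff[OF phase_difference_limit[OF ijN, of 0 0] tendsto_const] by simp
    with cluster_ordered_by_frequency[OF cl ij \<nu> strength[unfolded DV]]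
    show "\<exists>L. ((\<lambda>t. \<theta> i t - \<theta> j t - 2 * real_of_int (k i - k j) * pi) \<longlongrightarrow> L) at_top \<and>
               (\<nu> i - \<nu> j) / \<kappa> \<le> L \<and>
               L \<le> 1 / (lam * cos (critical_arc lam * (DV / \<kappa>) / critical_strength lam) - (1 - lam))
                 * ((\<nu> i - \<nu> j) / \<kappa>)" unfolding DV by blast
  qed
qed

end
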